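(* Let $X$ be a Banach space that has a boundary which is both $\sigma$-$w^*$-LRC and $w^*$-$K_\sigma$. Then $X$ admits an equivalent norm whose dual norm on $X^*$ is locally uniformly rotund (LUR).
   Context: Banach spaces are real. A boundary of a Banach space $(X,\|\cdot\|)$ is a set $B \subseteq B_{X^*}$ (the closed dual unit ball) such that for every $x \in X$ there exists $f \in B$ with $f(x) = \|x\|$. A subset $E \subseteq X^*$ is called $w^*$-LRC if for every $f \in E$ there is a $w^*$-open set $U \subseteq X^*$ with $f \in U$ such that the norm closure of $E \cap U$ is norm-compact. It is $\sigma$-$w^*$-LRC if it is a countable union of $w^*$-LRC sets, and $w^*$-$K_\sigma$ if it is a countable union of $w^*$-compact sets. A norm $\|\cdot\|$ on a Banach space $Z$ is locally uniformly rotund (LUR) if whenever $z \in Z$ with $\|z\|=1$ and $(z_n) \subseteq Z$ is a sequence with $\|z_n\| \to 1$ and $\|z+z_n\| \to 2$, we have $\|z-z_n\| \to 0$. *)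

theory Defs
  imports "HOL-Analysis.Analysis"
begin

text \<open>
  The dual of a real normed space \<open>'a\<close> is \<open>'a \<Rightarrow>\<^sub>L real\<close>; the norm, metric and topology
  that this type carries as a type-class instance are those of the dual norm. The weak-star topology
  is the topology of pointwise convergence, which is what the library calls the strong
  operator topology when the target space is \<open>real\<close>.
\<close>

abbreviation weak_star_topology :: "('a::real_normed_vector \<Rightarrow>\<^sub>L real) topology" where
  "weak_star_topology \<equiv> strong_operator_topology"

definition is_boundary :: "('a::real_normed_vector \<Rightarrow>\<^sub>L real) set \<Rightarrow> bool" where
  "is_boundary B \<longleftrightarrow> B \<subseteq> cball 0 1 \<and> (\<forall>x. \<exists>f\<in>B. blinfun_apply f x = norm x)"

definition weak_star_LRC :: "('a::real_normed_vector \<Rightarrow>\<^sub>L real) set \<Rightarrow> bool" where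
  "weak_star_LRC E \<longleftrightarrow>
     (\<forall>f\<in>E. \<exists>U. openin weak_star_topology U \<and> f \<in> U \<and> compact (closure (E \<inter> U)))"

definition sigma_weak_star_LRC :: "('a::real_normed_vector \<Rightarrow>\<^sub>L real) set \<Rightarrow> bool" where
  "sigma_weak_star_LRC B \<longleftrightarrow>
     (\<exists>\<E>. countable \<E> \<and> (\<forall>E\<in>\<E>. weak_star_LRC E) \<and> B = \<Union>\<E>)"

definition weak_star_K_sigma :: "('a::real_normed_vector \<Rightarrow>\<^sub>L real) set \<Rightarrow> bool" where
  "weak_star_K_sigma B \<longleftrightarrow>
     (\<exists>\<K>. countable \<K> \<and> (\<forall>K\<in>\<K>. compactin weak_star_topology K) \<and> B = \<Union>\<K>)"

text \<open>Norms other than the type-class norm are represented as real-valued functions.\<close>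

definition is_norm :: "('a::real_vector \<Rightarrow> real) \<Rightarrow> bool" where
  "is_norm N \<longleftrightarrow>
     (\<forall>x. 0 \<le> N x) \<and> (\<forall>x. N x = 0 \<longleftrightarrow> x = 0) \<and>
     (\<forall>x y. N (x + y) \<le> N x + N y) \<and> (\<forall>c x. N (c *\<^sub>R x) = \<bar>c\<bar> * N x)"

definition equivalent_norm :: "('a::real_normed_vector \<Rightarrow> real) \<Rightarrow> bool" where
  "equivalent_norm N \<longleftrightarrow>
     is_norm N \<and> (\<exists>a>0. \<exists>b>0. \<forall>x. a * norm x \<le> N x \<and> N x \<le> b * norm x)"

text \<open>
  The supremum is taken in \<open>real\<close>; the set is bounded above, so that this is the dual norm,
  whenever \<open>N\<close> is an equivalent norm.
\<close>

definition dual_norm :: "('a::real_normed_vector \<Rightarrow> real) \<Rightarrow> ('a \<Rightarrow>\<^sub>L real) \<Rightarrow> real" where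
  "dual_norm N f = (SUP x\<in>{x. N x \<le> 1}. \<bar>blinfun_apply f x\<bar>)"

definition LUR :: "('a::real_vector \<Rightarrow> real) \<Rightarrow> bool" where
  "LUR N \<longleftrightarrow>
     (\<forall>z s. N z = 1 \<longrightarrow> (\<lambda>n. N (s n)) \<longlonglongrightarrow> 1 \<longrightarrow> (\<lambda>n. N (z + s n)) \<longlonglongrightarrow> 2 \<longrightarrow>
        (\<lambda>n. N (z - s n)) \<longlonglongrightarrow> 0)"

end

theory Submission
  imports Defs "HOL-Real_Asymp.Real_Asymp"
begin

text \<open>
  Write the boundary as an increasing union of weak-star compact sets \<open>L\<^sub>n\<close>. Each positive functional
  \<open>\<nu>\<close> on \<open>C(L\<^sub>n)\<close>, that is, each positive Radon measure on \<open>L\<^sub>n\<close>, has a barycentre \<open>moment \<nu>\<close> in the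
  dual, and by Simons' argument the multiples of barycentres are norm dense. A weak-star LRC set is
  contained in a weak-star locally closed set on which the norm and weak-star topologies coincide, so
  a \<open>\<sigma>\<close>-disjoint cover of the dual by norm-open sets of small diameter splits each \<open>L\<^sub>n\<close> into countably
  many disjoint families of cells that become weak-star open after adding one open set. Countably many
  convex weak-star lower semicontinuous functions \<open>q\<^sub>i\<close> of \<open>\<nu>\<close>, built from the \<open>\<ell>\<^sub>2\<close> sums of the masses of
  the cells, therefore control the mass of every cell, hence the barycentre in norm. The infimal
  convolutions \<open>\<Omega>(f) = min\<^sub>\<nu> (\<parallel>f - moment \<nu>\<parallel>\<^sup>2 + c \<Sum>\<^sub>i 2\<^sup>-\<^sup>i q\<^sub>i(\<nu>)\<^sup>2)\<close> are weak-star lower semicontinuous,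
  and a weighted sum of their symmetrisations and \<open>\<parallel>f\<parallel>\<^sup>2\<close> is the square of the required dual norm.
\<close>

text \<open>A norm on the dual is a dual norm only if it is weak-star lower semicontinuous, whereas
  the mass of a cell is merely a difference of two open masses. Adding the mass of the open part to
  the l2 norm of the cell masses restores semicontinuity; as the open masses are among the
  \<open>q i\<close> too, convergence of all \<open>q i\<close> gives the l2 part back, and the
  parallelogram identity then yields convergence cell by cell. Finite meets of layers are included
  so that finitely many overlapping cells can be made disjoint. A point may have many representing
  functionals, or none, so the \<open>q i\<close> reach the dual only through the infimum over
  \<nu>. The residual \<open>f - moment \<nu>\<close> is measured by the original norm, which need
  not be rotund, and leaves an error of \<open>2 * sqrt (\<Omega> c z)\<close>. Density of the
  barycentres makes this small as \<open>c\<close> runs through \<open>1 / (m + 1)\<close>.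
  Everything is expressed by defects \<open>2 * F z + 2 * F s - F (z + s)\<close> of squares: they
  are nonnegative, additive in \<open>F\<close> and compatible with the infimum, so a vanishing
  defect of the sum makes each of them vanish in the limit.\<close>

section \<open>Riesz representation on a compact Hausdorff topology\<close>

lemma continuous_map_bounded:
  assumes "compact_space T" "continuous_map T euclideanreal g"
  shows "\<exists>b. \<forall>x\<in>topspace T. \<bar>g x\<bar> \<le> b"
proof -
  have "compact (g ` topspace T)"
    using image_compactin[OF _ assms(2), of "topspace T"] assms(1) by (simp add: compact_space_def)
  then show ?thesis using compact_imp_bounded bounded_real by (metis imageI)
qed

locale positive_functional =
  fixes T :: "'b topology" and \<nu> :: "('b \<Rightarrow> real) \<Rightarrow> real"
  assumes compact: "compact_space T" and hausdorff: "Hausdorff_space T"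
    and add: "\<And>g h. continuous_map T euclideanreal g \<Longrightarrow> continuous_map T euclideanreal h \<Longrightarrow>
      \<nu> (\<lambda>x. g x + h x) = \<nu> g + \<nu> h"
    and scale: "\<And>c g. continuous_map T euclideanreal g \<Longrightarrow> \<nu> (\<lambda>x. c * g x) = c * \<nu> g"
    and nonneg: "\<And>g. continuous_map T euclideanreal g \<Longrightarrow> (\<And>x. x \<in> topspace T \<Longrightarrow> 0 \<le> g x) \<Longrightarrow> 0 \<le> \<nu> g"
begin

lemma diff:
  assumes "continuous_map T euclideanreal g" "continuous_map T euclideanreal h"
  shows "\<nu> (\<lambda>x. g x - h x) = \<nu> g - \<nu> h"
proof -
  have c: "continuous_map T euclideanreal (\<lambda>x. (-1) * h x)"
    by (intro continuous_intros assms)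
  show ?thesis
    using add[OF assms(1) c] scale[OF assms(2), of "-1"] by simp
qed

lemma mono:
  assumes "continuous_map T euclideanreal g" "continuous_map T euclideanreal h"
    and "\<And>x. x \<in> topspace T \<Longrightarrow> g x \<le> h x"
  shows "\<nu> g \<le> \<nu> h"
  using nonneg[of "\<lambda>x. h x - g x"] diff[OF assms(2,1)] assms
  by (auto intro!: continuous_intros)

lemma const: "\<nu> (\<lambda>x. c) = c * \<nu> (\<lambda>x. 1)"
  using scale[of "\<lambda>x. 1" c] by simp

lemma mass_nonneg: "0 \<le> \<nu> (\<lambda>x. 1)"
  by (rule nonneg) auto

section \<open>Content of open sets, from continuous functions vanishing outside them\<close>

definition below :: "'b set \<Rightarrow> ('b \<Rightarrow> real) set" where
  "below U = {g. continuous_map T euclideanreal g \<and>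
     (\<forall>x\<in>topspace T. 0 \<le> g x \<and> g x \<le> 1 \<and> (x \<notin> U \<longrightarrow> g x = 0))}"

definition content :: "'b set \<Rightarrow> real" where
  "content U = Sup (\<nu> ` below U)"

lemma belowD:
  "g \<in> below U \<Longrightarrow> x \<in> topspace T \<Longrightarrow> 0 \<le> g x \<and> g x \<le> 1 \<and> (x \<notin> U \<longrightarrow> g x = 0)"
  by (auto simp: below_def)

lemma zero_below: "(\<lambda>x. 0) \<in> below U"
  by (auto simp: below_def)

lemma below_mass: "g \<in> below U \<Longrightarrow> \<nu> g \<le> \<nu> (\<lambda>x. 1)"
  by (rule mono) (auto simp: below_def)

lemma bdd_below_image: "bdd_above (\<nu> ` below U)"
  using below_mass by (auto simp: bdd_above_def)

lemma le_content: "g \<in> below U \<Longrightarrow> \<nu> g \<le> content U"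
  unfolding content_def by (rule cSUP_upper[OF _ bdd_below_image])

lemma content_le: "(\<And>g. g \<in> below U \<Longrightarrow> \<nu> g \<le> c) \<Longrightarrow> content U \<le> c"
  unfolding content_def by (rule cSUP_least) (use zero_below in auto)

lemma content_approx:
  assumes "e > 0"
  obtains g where "g \<in> below U" "content U - e < \<nu> g"
proof -
  have "\<not> content U \<le> content U - e" using assms by simp
  then show ?thesis
    using content_le[of U "content U - e"] that by (meson not_le)
qed

lemma content_nonneg: "0 \<le> content U"
  using le_content[OF zero_below] const[of 0] by simp

lemma content_mono: "U \<subseteq> V \<Longrightarrow> content U \<le> content V"
  by (rule content_le, rule le_content) (auto simp: below_def)

lemma content_topspace: "content (topspace T) = \<nu> (\<lambda>x. 1)"
proof (rule antisym)
  show "content (topspace T) \<le> \<nu> (\<lambda>x. 1)"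
    by (rule content_le) (rule below_mass)
  show "\<nu> (\<lambda>x. 1) \<le> content (topspace T)"
    by (rule le_content) (auto simp: below_def)
qed

text \<open>Vanishing outside \<open>U\<close> is weaker than having compact support in
  \<open>U\<close>. Lowering \<open>g\<close> by \<open>d\<close> confines it to the compact level
  set where \<open>d \<le> g\<close>, and costs at most \<open>d\<close> times the total
  mass.\<close>

lemma truncate:
  assumes g: "g \<in> below U" and d: "d > 0"
  shows "(\<lambda>x. max (g x - d) 0) \<in> below (U \<inter> {x \<in> topspace T. d \<le> g x})"
    and "\<nu> g \<le> \<nu> (\<lambda>x. max (g x - d) 0) + d * \<nu> (\<lambda>x. 1)"
proof -
  have gc: "continuous_map T euclideanreal g" using g by (simp add: below_def)
  have c: "continuous_map T euclideanreal (\<lambda>x. max (g x - d) 0)"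
    by (intro continuous_intros gc)
  show "(\<lambda>x. max (g x - d) 0) \<in> below (U \<inter> {x \<in> topspace T. d \<le> g x})"
    using g d c by (auto simp: below_def max_def)
  have "\<nu> g \<le> \<nu> (\<lambda>x. max (g x - d) 0 + d)"
    by (rule mono) (auto intro!: continuous_intros gc)
  also have "\<dots> = \<nu> (\<lambda>x. max (g x - d) 0) + d * \<nu> (\<lambda>x. 1)"
    using add[OF c, of "\<lambda>x. d"] const[of d] by simp
  finally show "\<nu> g \<le> \<nu> (\<lambda>x. max (g x - d) 0) + d * \<nu> (\<lambda>x. 1)" .
qed

lemma level_closed:
  assumes "continuous_map T euclideanreal g"
  shows "closedin T {x \<in> topspace T. d \<le> g x}" "compactin T {x \<in> topspace T. d \<le> g x}"
proof -
  show c: "closedin T {x \<in> topspace T. d \<le> g x}"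
    using closedin_continuous_map_preimage[OF assms, of "{d..}"] by simp
  then show "compactin T {x \<in> topspace T. d \<le> g x}"
    using closedin_compact_space compact by blast
qed

lemma small_multiple:
  assumes "(e::real) > 0"
  obtains d where "d > 0" "d * \<nu> (\<lambda>x. 1) \<le> e"
proof
  show "e / (\<nu> (\<lambda>x. 1) + 1) > 0" using assms mass_nonneg by simp
  show "e / (\<nu> (\<lambda>x. 1) + 1) * \<nu> (\<lambda>x. 1) \<le> e"
    using assms mass_nonneg by (simp add: field_simps)
qed

text \<open>A nearly optimal function, once truncated, lives on a compact level set, which finitely
  many members of the family cover. The family may be uncountable; this is what later reduces an
  uncountable family of cells to a finite one.\<close>

lemma content_Union_finite:
  assumes op: "\<And>U. U \<in> \<U> \<Longrightarrow> openin T U" and e: "e > 0"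
  obtains F where "finite F" "F \<subseteq> \<U>" "content (\<Union>\<U>) \<le> content (\<Union>F) + e"
proof -
  obtain g where g: "g \<in> below (\<Union>\<U>)" "content (\<Union>\<U>) - e/2 < \<nu> g"
    using content_approx[of "e/2"] e by auto
  obtain d where d: "d > 0" "d * \<nu> (\<lambda>x. 1) \<le> e/2"
    using small_multiple[of "e/2"] e by auto
  let ?K = "{x \<in> topspace T. d \<le> g x}"
  have gc: "continuous_map T euclideanreal g" using g by (simp add: below_def)
  have "?K \<subseteq> \<Union>\<U>" using g d by (force simp: below_def)
  then obtain F where F: "finite F" "F \<subseteq> \<U>" "?K \<subseteq> \<Union>F"
    using level_closed(2)[OF gc, of d] op unfolding compactin_def by (meson subsetD)
  have "(\<lambda>x. max (g x - d) 0) \<in> below (\<Union>F)"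
    using truncate(1)[OF g(1) d(1)] F(3) unfolding below_def by auto
  then have "\<nu> g \<le> content (\<Union>F) + e/2"
    using truncate(2)[OF g(1) d(1)] d(2) le_content[of "\<lambda>x. max (g x - d) 0" "\<Union>F"] by linarith
  then show ?thesis using that[OF F(1,2)] g(2) by linarith
qed

lemma normal: "normal_space T"
  using compact hausdorff compact_Hausdorff_or_regular_imp_normal_space by blast

text \<open>A Urysohn function that is 0 off \<open>U\<close> and 1 on the part of the compact level
  set outside \<open>V\<close> splits the truncated function into a summand below \<open>U\<close>
  and one below \<open>V\<close>.\<close>

lemma content_Un:
  assumes U: "openin T U" and V: "openin T V"
  shows "content (U \<union> V) \<le> content U + content V"
proof (rule content_le, rule field_le_epsilon)
  fix g and e :: real assume g: "g \<in> below (U \<union> V)" and e: "e > 0"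
  obtain d where d: "d > 0" "d * \<nu> (\<lambda>x. 1) \<le> e"
    using small_multiple[OF e] by auto
  have gc: "continuous_map T euclideanreal g" using g by (simp add: below_def)
  let ?K = "{x \<in> topspace T. d \<le> g x}" and ?g = "\<lambda>x. max (g x - d) 0"
  have gc': "continuous_map T euclideanreal ?g" by (intro continuous_intros gc)
  have "disjnt (topspace T - U) (?K - V)"
    using g d by (force simp: below_def disjnt_def)
  moreover have "closedin T (?K - V)" "closedin T (topspace T - U)"
    using level_closed(1)[OF gc] U V by (auto intro: closedin_diff)
  ultimately obtain f where f: "continuous_map T (top_of_set {0..1::real}) f"
    "f ` (topspace T - U) \<subseteq> {0}" "f ` (?K - V) \<subseteq> {1}"
    using Urysohn_lemma[OF normal, of "topspace T - U" "?K - V" 0 1] by auto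
  have fc: "continuous_map T euclideanreal f" and f01: "\<And>x. x \<in> topspace T \<Longrightarrow> f x \<in> {0..1}"
    using f(1) by (auto simp: continuous_map_in_subtopology)
  have g01: "0 \<le> ?g x" "?g x \<le> 1" if "x \<in> topspace T" for x
    using g that d by (auto simp: below_def)
  have "(\<lambda>x. ?g x * f x) \<in> below U"
    using f01 g01 f(2) unfolding below_def
    by (auto intro!: continuous_intros gc' fc mult_le_one)
  moreover have "(\<lambda>x. ?g x * (1 - f x)) \<in> below V"
    unfolding below_def
  proof (intro CollectI conjI ballI impI)
    show "continuous_map T euclideanreal (\<lambda>x. ?g x * (1 - f x))"
      by (intro continuous_intros gc' fc)
    fix x assume x: "x \<in> topspace T"
    show "0 \<le> ?g x * (1 - f x)" "?g x * (1 - f x) \<le> 1"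
      using f01[OF x] g01[OF x] by (auto intro: mult_le_one)
    show "?g x * (1 - f x) = 0" if "x \<notin> V"
      using f(3) x that by (cases "d \<le> g x") auto
  qed
  moreover have "\<nu> ?g = \<nu> (\<lambda>x. ?g x * f x) + \<nu> (\<lambda>x. ?g x * (1 - f x))"
    by (subst add[symmetric]) (auto intro!: continuous_intros gc' fc simp: algebra_simps)
  ultimately show "\<nu> g \<le> content U + content V + e"
    using truncate(2)[OF g d(1)] d(2) le_content[of "\<lambda>x. ?g x * f x" U]
      le_content[of "\<lambda>x. ?g x * (1 - f x)" V] by linarith
qed

lemma content_empty: "content {} = 0"
proof (rule antisym[OF content_le content_nonneg])
  fix g assume g: "g \<in> below {}"
  have "\<nu> g \<le> \<nu> (\<lambda>x. 0)"
    using g by (intro mono) (auto simp: below_def)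
  then show "\<nu> g \<le> 0" using const[of 0] by simp
qed

lemma content_UN_finite:
  assumes "finite I" "\<And>i. i \<in> I \<Longrightarrow> openin T (U i)"
  shows "content (\<Union>i\<in>I. U i) \<le> (\<Sum>i\<in>I. content (U i))"
  using assms
proof (induction I rule: finite_induct)
  case empty then show ?case by (simp add: content_empty)
next
  case (insert i I)
  then show ?case
    using content_Un[of "U i" "\<Union>i\<in>I. U i"] by fastforce
qed

text \<open>By \<open>content_Union_finite\<close> only finitely many of the sets count up to an
  error \<open>e\<close>, so finite subadditivity suffices.\<close>

lemma content_UN:
  fixes U :: "nat \<Rightarrow> 'b set"
  assumes "\<And>i. openin T (U i)"
  shows "ennreal (content (\<Union>i. U i)) \<le> (\<Sum>i. ennreal (content (U i)))"
proof (rule ennreal_le_epsilon)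
  fix e :: real assume e: "0 < e"
  obtain F where F: "finite F" "F \<subseteq> range U" "content (\<Union>i. U i) \<le> content (\<Union>F) + e"
    using content_Union_finite[of "range U" e] assms e by auto
  then obtain I where I: "finite I" "F = U ` I"
    using finite_subset_image by metis
  have "content (\<Union>i. U i) \<le> (\<Sum>i\<in>I. content (U i)) + e"
    using F(3) content_UN_finite[OF I(1), of U] assms I by simp
  then have "ennreal (content (\<Union>i. U i)) \<le> ennreal ((\<Sum>i\<in>I. content (U i)) + e)"
    by (rule ennreal_leI)
  also have "\<dots> = (\<Sum>i\<in>I. ennreal (content (U i))) + ennreal e"
    using e content_nonneg by (simp add: ennreal_plus sum_nonneg)
  also have "\<dots> \<le> (\<Sum>i. ennreal (content (U i))) + ennreal e"
    by (intro add_right_mono sum_le_suminf I) auto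
  finally show "ennreal (content (\<Union>i. U i)) \<le> (\<Sum>i. ennreal (content (U i))) + ennreal e" .
qed

section \<open>Outer measure and Caratheodory measurability of open sets\<close>

definition outer :: "'b set \<Rightarrow> ennreal" where
  "outer S = (INF U\<in>{U. openin T U \<and> S \<subseteq> U}. ennreal (content U))"

lemma outer_open: "openin T U \<Longrightarrow> outer U = ennreal (content U)"
  unfolding outer_def
  by (intro antisym INF_lower INF_greatest) (auto intro!: ennreal_leI content_mono)

lemma outer_le: "openin T U \<Longrightarrow> S \<subseteq> U \<Longrightarrow> outer S \<le> ennreal (content U)"
  unfolding outer_def by (rule INF_lower) auto

lemma outer_mono: "S \<subseteq> S' \<Longrightarrow> outer S \<le> outer S'"
  unfolding outer_def by (rule INF_superset_mono) auto

lemma outer_approx: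
  assumes "S \<subseteq> topspace T" "e > 0"
  obtains U where "openin T U" "S \<subseteq> U" "ennreal (content U) \<le> outer S + ennreal e"
proof -
  have "outer S \<le> ennreal (content (topspace T))"
    by (rule outer_le) (use assms in auto)
  then have "outer S < \<infinity>" by (metis ennreal_less_top infinity_ennreal_def le_less_trans)
  then have "outer S < outer S + ennreal e" using assms by (simp add: ennreal_add_left_cancel_less)
  then show ?thesis
    using that unfolding outer_def INF_less_iff by (force intro: less_imp_le)
qed

lemma outer_measure: "outer_measure_space (Pow (topspace T)) outer"
  unfolding outer_measure_space_def
proof (intro conjI)
  show "positive (Pow (topspace T)) outer"
    using outer_open[of "{}"] by (simp add: positive_def content_empty)
  show "increasing (Pow (topspace T)) outer"
    by (simp add: increasing_def outer_mono)
  show "countably_subadditive (Pow (topspace T)) outer"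
    unfolding countably_subadditive_def
  proof (intro allI impI)
    fix A :: "nat \<Rightarrow> 'b set" assume A: "range A \<subseteq> Pow (topspace T)"
    show "outer (\<Union>i. A i) \<le> (\<Sum>i. outer (A i))"
    proof (rule ennreal_le_epsilon)
      fix e :: real assume e: "0 < e"
      have "\<exists>U. openin T U \<and> A i \<subseteq> U \<and> ennreal (content U) \<le> outer (A i) + ennreal (e * (1/2)^Suc i)" for i
      proof -
        have "A i \<subseteq> topspace T" "e * (1/2)^Suc i > 0" using A e by auto
        then show ?thesis by (metis outer_approx)
      qed
      then obtain U where U: "\<And>i. openin T (U i)" "\<And>i. A i \<subseteq> U i"
        "\<And>i. ennreal (content (U i)) \<le> outer (A i) + ennreal (e * (1/2)^Suc i)"
        by metis
      have "outer (\<Union>i. A i) \<le> ennreal (content (\<Union>i. U i))"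
        using U by (intro outer_le) auto
      also have "\<dots> \<le> (\<Sum>i. ennreal (content (U i)))"
        by (rule content_UN[OF U(1)])
      also have "\<dots> \<le> (\<Sum>i. outer (A i) + ennreal (e * (1/2)^Suc i))"
        by (intro suminf_le U(3)) auto
      also have "\<dots> = (\<Sum>i. outer (A i)) + (\<Sum>i. ennreal (e * (1/2)^Suc i))"
        by (intro suminf_add[symmetric]) auto
      also have "(\<Sum>i. ennreal (e * (1/2)^Suc i)) = ennreal e"
        using sums_mult[OF power_half_series, of e] e
        by (intro suminf_ennreal_eq) auto
      finally show "outer (\<Union>i. A i) \<le> (\<Sum>i. outer (A i)) + ennreal e" .
    qed
  qed
qed


text \<open>The content of \<open>G \<inter> U\<close> is nearly reached by a function living on a
  compact \<open>?K \<subseteq> U\<close>, and \<open>G - ?K\<close> is open and contains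
  \<open>S - U\<close>. The nearly optimal functions for the two sets are nonzero on disjoint sets,
  so their sum is still below \<open>G\<close>.\<close>

lemma open_in_lambda_system:
  assumes U: "openin T U"
  shows "U \<in> lambda_system (topspace T) (Pow (topspace T)) outer"
proof -
  interpret algebra "topspace T" "Pow (topspace T)"
    by (rule algebra_Pow)
  have Us: "U \<subseteq> topspace T" using U openin_subset by blast
  have "outer (S \<inter> U) + outer (S - U) = outer S" if S: "S \<subseteq> topspace T" for S
  proof (rule antisym)
    show "outer (S \<inter> U) + outer (S - U) \<le> outer S"
    proof (rule ennreal_le_epsilon)
      fix e :: real assume e: "0 < e"
      \<comment> \<open>The error \<open>e\<close> is spent in four quarters: on \<open>G\<close>,
        on \<open>g\<close>, on the truncation of \<open>g\<close> and on \<open>h\<close>.\<close>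
      obtain G where G: "openin T G" "S \<subseteq> G" "ennreal (content G) \<le> outer S + ennreal (e/4)"
        using outer_approx[OF S, of "e/4"] e by auto
      obtain g where g: "g \<in> below (G \<inter> U)" "content (G \<inter> U) - e/4 < \<nu> g"
        using content_approx[of "e/4"] e by auto
      obtain d where d: "d > 0" "d * \<nu> (\<lambda>x. 1) \<le> e/4"
        using small_multiple[of "e/4"] e by auto
      let ?K = "{x \<in> topspace T. d \<le> g x}" and ?g = "\<lambda>x. max (g x - d) 0"
      have gc: "continuous_map T euclideanreal g" using g by (simp add: below_def)
      have KU: "?K \<subseteq> U" using g d by (force simp: below_def)
      obtain h where h: "h \<in> below (G - ?K)" "content (G - ?K) - e/4 < \<nu> h"
        using content_approx[of "e/4"] e by auto
      have hc: "continuous_map T euclideanreal h" using h by (simp add: below_def)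
      have gc': "continuous_map T euclideanreal ?g" by (intro continuous_intros gc)
      have g': "?g \<in> below (G \<inter> U \<inter> ?K)" by (rule truncate(1)[OF g(1) d(1)])
      have "?g x + h x \<in> {0..1}" "x \<notin> G \<longrightarrow> ?g x + h x = 0" if x: "x \<in> topspace T" for x
      proof -
        have *: "0 \<le> ?g x" "?g x \<le> 1" "x \<notin> G \<inter> U \<inter> ?K \<longrightarrow> ?g x = 0"
          "0 \<le> h x" "h x \<le> 1" "x \<notin> G - ?K \<longrightarrow> h x = 0"
          using belowD[OF g' x] belowD[OF h(1) x] by blast+
        show "x \<notin> G \<longrightarrow> ?g x + h x = 0" using * by auto
        show "?g x + h x \<in> {0..1}"
          using * by (cases "x \<in> ?K") auto
      qed
      then have "(\<lambda>x. ?g x + h x) \<in> below G"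
        unfolding below_def by (auto intro!: continuous_intros gc hc)
      then have "content (G \<inter> U) + content (G - ?K) \<le> content G + 3 * e/4"
        using le_content[of "\<lambda>x. ?g x + h x" G] add[OF gc' hc] truncate(2)[OF g(1) d(1)] d(2) g(2) h(2)
        by linarith
      then have *: "ennreal (content (G \<inter> U) + content (G - ?K)) \<le> ennreal (content G + 3 * e/4)"
        by (rule ennreal_leI)
      have "outer (S \<inter> U) \<le> ennreal (content (G \<inter> U))"
        using G U by (intro outer_le) auto
      moreover have "outer (S - U) \<le> ennreal (content (G - ?K))"
        using G KU level_closed(1)[OF gc, of d] by (intro outer_le) auto
      ultimately have "outer (S \<inter> U) + outer (S - U) \<le> ennreal (content (G \<inter> U)) + ennreal (content (G - ?K))"
        by (rule add_mono)
      also have "\<dots> \<le> ennreal (content G) + ennreal (3 * e/4)"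
        using * e content_nonneg by (simp add: ennreal_plus)
      also have "\<dots> \<le> outer S + ennreal (e/4) + ennreal (3 * e/4)"
        by (intro add_right_mono G)
      also have "\<dots> = outer S + ennreal e"
        using e by (simp add: add.assoc ennreal_plus[symmetric] del: ennreal_plus)
      finally show "outer (S \<inter> U) + outer (S - U) \<le> outer S + ennreal e" .
    qed
    have "subadditive (Pow (topspace T)) outer"
      using outer_measure by (metis outer_measure_space_def countably_subadditive_subadditive)
    then have "outer ((S \<inter> U) \<union> (S - U)) \<le> outer (S \<inter> U) + outer (S - U)"
      using S by (intro subadditiveD[where M = "Pow (topspace T)"]) auto
    then show "outer S \<le> outer (S \<inter> U) + outer (S - U)"
      by (simp add: Int_Diff_Un)
  qed
  then show ?thesis using Us by (simp add: lambda_system_eq)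
qed

definition radon_measure :: "'b measure" where
  "radon_measure = measure_of (topspace T) (lambda_system (topspace T) (Pow (topspace T)) outer) outer"

lemma measure_space_lambda: "measure_space (topspace T) (lambda_system (topspace T) (Pow (topspace T)) outer) outer"
proof -
  interpret sigma_algebra "topspace T" "Pow (topspace T)"
    by (rule sigma_algebra_Pow)
  show ?thesis by (rule caratheodory_lemma[OF outer_measure])
qed

lemma space_radon [simp]: "space radon_measure = topspace T"
  unfolding radon_measure_def
  by (rule space_measure_of) (auto simp: lambda_system_def)

lemma sets_radon: "sets radon_measure = lambda_system (topspace T) (Pow (topspace T)) outer"
  using measure_space_lambda unfolding radon_measure_def measure_space_def
  by (auto intro!: sigma_algebra.sets_measure_of_eq)

lemma open_sets_radon: "openin T U \<Longrightarrow> U \<in> sets radon_measure"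
  by (simp add: sets_radon open_in_lambda_system)

lemma emeasure_radon_open: "openin T U \<Longrightarrow> emeasure radon_measure U = ennreal (content U)"
  using measure_space_lambda open_in_lambda_system[of U] outer_open[of U] sets_radon
  unfolding measure_space_def radon_measure_def
  by (subst emeasure_measure_of_sigma) auto

lemma measure_radon_open: "openin T U \<Longrightarrow> measure radon_measure U = content U"
  by (simp add: measure_def emeasure_radon_open content_nonneg)

sublocale radon: finite_measure radon_measure
  by standard (use emeasure_radon_open[of "topspace T"] in simp)

text \<open>Layer cake: \<open>h\<close> differs by at most \<open>1 / N\<close> from the average of
  the indicators of its open superlevel sets \<open>W j\<close>, and each indicator is replaced by a
  continuous function below \<open>W j\<close>. It serves continuous \<open>h\<close> in
  \<open>integral_radon\<close> and the semicontinuous functions \<open>step\<close> in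
  \<open>q_cells_lower\<close>.\<close>

lemma lsc_integral_le:
  assumes h: "\<And>x. x \<in> topspace T \<Longrightarrow> h x \<in> {0..1::real}"
    and op: "\<And>t. openin T {x \<in> topspace T. h x > t}" and e: "e > 0"
  obtains g where "continuous_map T euclideanreal g"
    "\<And>x. x \<in> topspace T \<Longrightarrow> 0 \<le> g x \<and> g x \<le> h x"
    "integral\<^sup>L radon_measure h - e \<le> \<nu> g"
proof -
  let ?m = "measure radon_measure"
  \<comment> \<open>Rounding \<open>h\<close> down loses \<open>1 / N\<close> of the mass; the
    \<open>N\<close> contents, each approximated within \<open>1 / N\<close> and weighted by
    \<open>1 / N\<close>, lose a further \<open>1 / N\<close>.\<close>
  obtain N :: nat where N: "N > 0" "(1 + ?m (topspace T)) / real N < e"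
  proof -
    obtain n :: nat where "(1 + ?m (topspace T)) / e < real n"
      using reals_Archimedean2 by blast
    moreover have "0 < (1 + ?m (topspace T)) / e" using e by (intro divide_pos_pos add_pos_nonneg) auto
    ultimately have "0 < real n" "1 + ?m (topspace T) < e * real n"
      using e by (linarith, simp add: field_simps)
    then show ?thesis using that[of n] by (simp add: field_simps)
  qed
  define W where "W j = {x \<in> topspace T. h x > real j / real N}" for j :: nat
  have Wop: "openin T (W j)" for j unfolding W_def by (rule op)
  have "\<exists>g. g \<in> below (W j) \<and> content (W j) - 1 / real N < \<nu> g" for j
    using content_approx[of "1 / real N" "W j"] N by auto
  then obtain g where g: "\<And>j. g j \<in> below (W j)" "\<And>j. content (W j) - 1 / real N < \<nu> (g j)"
    by metis
  have gc: "continuous_map T euclideanreal (g j)" for j using g by (simp add: below_def)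
  define G where "G x = (\<Sum>j\<in>{1..N}. (1 / real N) * g j x)" for x
  have Gc: "continuous_map T euclideanreal G"
    unfolding G_def by (intro continuous_intros gc) auto
  have "\<nu> (\<lambda>x. \<Sum>j\<in>I. (1 / real N) * g j x) = (\<Sum>j\<in>I. (1 / real N) * \<nu> (g j))" if "finite I" for I
    using that
  proof (induction I rule: finite_induct)
    case empty then show ?case using const[of 0] by simp
  next
    case (insert i I)
    have ci: "continuous_map T euclideanreal (\<lambda>x. (1 / real N) * g i x)"
      "continuous_map T euclideanreal (\<lambda>x. \<Sum>j\<in>I. (1 / real N) * g j x)"
      by (intro continuous_intros gc insert.hyps)+
    show ?case
      by (simp only: sum.insert[OF insert.hyps] add[OF ci] scale[OF gc] insert.IH)
  qed
  then have LG: "\<nu> G = (\<Sum>j\<in>{1..N}. (1 / real N) * \<nu> (g j))"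
    unfolding G_def by blast
  have key: "(\<Sum>j\<in>{1..N}. (1 / real N) * indicator (W j) x) \<le> h x \<and>
     h x \<le> 1 / real N + (\<Sum>j\<in>{1..N}. (1 / real N) * indicator (W j) x)" if x: "x \<in> topspace T" for x
  proof -
    \<comment> \<open>The number of levels strictly below \<open>h x\<close>. The two estimates that
      follow amount to \<open>c \<le> h x * N \<le> c + 1\<close>.\<close>
    define c where "c = card {j\<in>{1..N}. real j / real N < h x}"
    have s: "(\<Sum>j\<in>{1..N}. (1 / real N) * indicator (W j) x) = real c / real N"
    proof -
      have "(\<Sum>j\<in>{1..N}. (1 / real N) * indicator (W j) x) = (1 / real N) * (\<Sum>j\<in>{1..N}. indicator (W j) x)"
        by (rule sum_distrib_left[symmetric])
      also have "(\<Sum>j\<in>{1..N}. indicator (W j) x) = (\<Sum>j\<in>{1..N}. if real j / real N < h x then 1 else (0::real))"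
        using x by (intro sum.cong) (auto simp: W_def)
      also have "\<dots> = (\<Sum>j\<in>{j\<in>{1..N}. real j / real N < h x}. 1)"
        by (rule sum.inter_filter[symmetric]) simp
      finally show ?thesis by (simp add: c_def)
    qed
    have "c \<le> nat (floor (h x * real N))"
    proof -
      have "{j\<in>{1..N}. real j / real N < h x} \<subseteq> {1..nat (floor (h x * real N))}"
        using N by (auto simp: field_simps le_nat_floor)
      then have "c \<le> card {1..nat (floor (h x * real N))}"
        unfolding c_def by (rule card_mono[rotated]) simp
      then show ?thesis by simp
    qed
    then have "real c \<le> h x * real N"
      using h[OF x] by (simp add: le_nat_iff le_floor_iff zero_le_mult_iff)
    moreover have "h x * real N \<le> real c + 1"
    proof -
      have "{1..nat (ceiling (h x * real N) - 1)} \<subseteq> {j\<in>{1..N}. real j / real N < h x}"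
      proof
        fix j assume j: "j \<in> {1..nat (ceiling (h x * real N) - 1)}"
        then have "int j < ceiling (h x * real N)" by auto
        then have jl: "real j < h x * real N" by (simp add: less_ceiling_iff)
        also have "\<dots> \<le> real N" using h[OF x] by (simp add: mult_left_le_one_le)
        finally show "j \<in> {j\<in>{1..N}. real j / real N < h x}" using jl j N by (auto simp: field_simps)
      qed
      then have "card {1..nat (ceiling (h x * real N) - 1)} \<le> c"
        unfolding c_def by (rule card_mono[rotated]) simp
      then have "nat (ceiling (h x * real N) - 1) \<le> c" by simp
      then have "ceiling (h x * real N) \<le> int c + 1" by linarith
      then show ?thesis by linarith
    qed
    ultimately show ?thesis unfolding s using N by (simp add: field_simps)
  qed
  show thesis
  proof
    show "continuous_map T euclideanreal G" by (rule Gc)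
    fix x assume x: "x \<in> topspace T"
    have g1: "0 \<le> g j x" "g j x \<le> indicator (W j) x" for j
      using g(1)[of j] x by (auto simp: below_def indicator_def)
    have "G x \<le> (\<Sum>j\<in>{1..N}. (1 / real N) * indicator (W j) x)"
      unfolding G_def by (intro sum_mono mult_left_mono g1) auto
    moreover have "0 \<le> G x" unfolding G_def by (intro sum_nonneg mult_nonneg_nonneg g1) auto
    ultimately show "0 \<le> G x \<and> G x \<le> h x" using key[OF x] by linarith
  next
    have ind: "integrable radon_measure (\<lambda>x. indicator (W j) x :: real)" for j
      using open_sets_radon[OF Wop] radon.emeasure_finite
      by (intro integrable_real_indicator) (auto simp: less_top[symmetric])
    have "integral\<^sup>L radon_measure h
      \<le> (\<integral>x. 1 / real N + (\<Sum>j\<in>{1..N}. (1 / real N) * indicator (W j) x) \<partial>radon_measure)"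
    proof (intro integral_mono' Bochner_Integration.integrable_add Bochner_Integration.integrable_sum
           integrable_mult_right ind)
      fix x assume "x \<in> space radon_measure"
      then have x: "x \<in> topspace T" by simp
      show "h x \<le> 1 / real N + (\<Sum>j\<in>{1..N}. (1 / real N) * indicator (W j) x)"
        using key[OF x] by (rule conjunct2)
      then show "0 \<le> 1 / real N + (\<Sum>j\<in>{1..N}. (1 / real N) * indicator (W j) x)"
        using h[OF x] by (meson atLeastAtMost_iff order_trans)
    qed auto
    also have "\<dots> = ?m (topspace T) / real N + (\<Sum>j\<in>{1..N}. (1 / real N) * ?m (W j))"
    proof -
      have "W j \<inter> topspace T = W j" for j by (auto simp: W_def)
      then show ?thesis
        using ind by (subst Bochner_Integration.integral_add) (auto simp: Bochner_Integration.integral_sum)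
    qed
    also have "\<dots> \<le> ?m (topspace T) / real N + (\<Sum>j\<in>{1..N}. (1 / real N) * (\<nu> (g j) + 1 / real N))"
      using g(2) by (intro add_left_mono sum_mono mult_left_mono)
        (auto simp: measure_radon_open[OF Wop] less_imp_le diff_le_eq[symmetric])
    also have "\<dots> = ?m (topspace T) / real N + \<nu> G + 1 / real N"
      using N by (simp add: LG distrib_left sum.distrib)
    also have "\<dots> \<le> \<nu> G + e"
      using N(2) by (simp add: add_divide_distrib)
    finally show "integral\<^sup>L radon_measure h - e \<le> \<nu> G" by simp
  qed
qed


lemma lsc_measurable:
  assumes "\<And>t. openin T {x \<in> topspace T. (h x :: real) > t}"
  shows "h \<in> borel_measurable radon_measure"
  unfolding borel_measurable_iff_greater using open_sets_radon[OF assms] by simp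

lemma continuous_open_levels:
  assumes "continuous_map T euclideanreal g"
  shows "openin T {x \<in> topspace T. g x > t}"
  using openin_continuous_map_preimage[OF assms, of "{t<..}"] by simp

lemma continuous_integrable:
  assumes "continuous_map T euclideanreal g"
  shows "integrable radon_measure g"
proof -
  obtain c where "\<And>x. x \<in> topspace T \<Longrightarrow> \<bar>g x\<bar> \<le> c"
    using continuous_map_bounded[OF compact assms] by blast
  then show ?thesis
    using lsc_measurable[OF continuous_open_levels[OF assms]]
    by (intro radon.integrable_const_bound[where B=c]) auto
qed

text \<open>Approximation from below gives only one inequality. Applying it to \<open>1 - f\<close>
  gives the other, because measure and functional have the same total mass; an affine change brings
  a bounded \<open>g\<close> into \<open>[0,1]\<close>.\<close>

lemma integral_radon:
  assumes gc: "continuous_map T euclideanreal g"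
  shows "integral\<^sup>L radon_measure g = \<nu> g"
proof -
  have le: "integral\<^sup>L radon_measure f \<le> \<nu> f"
    if fc: "continuous_map T euclideanreal f" and f: "\<And>x. x \<in> topspace T \<Longrightarrow> f x \<in> {0..1}" for f
  proof (rule field_le_epsilon)
    fix e :: real assume "e > 0"
    then obtain h where h: "continuous_map T euclideanreal h"
      "\<And>x. x \<in> topspace T \<Longrightarrow> 0 \<le> h x \<and> h x \<le> f x" "integral\<^sup>L radon_measure f - e \<le> \<nu> h"
      using lsc_integral_le[OF f continuous_open_levels[OF fc]] by metis
    then show "integral\<^sup>L radon_measure f \<le> \<nu> f + e"
      using mono[OF h(1) fc] by force
  qed
  have mass: "measure radon_measure (topspace T) = \<nu> (\<lambda>x. 1)"
    by (simp add: measure_radon_open content_topspace)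
  have eq: "integral\<^sup>L radon_measure f = \<nu> f"
    if fc: "continuous_map T euclideanreal f" and f: "\<And>x. x \<in> topspace T \<Longrightarrow> f x \<in> {0..1}" for f
  proof (rule antisym[OF le[OF that]])
    have c: "continuous_map T euclideanreal (\<lambda>x. 1 - f x)" by (intro continuous_intros fc)
    have "integral\<^sup>L radon_measure (\<lambda>x. 1 - f x) \<le> \<nu> (\<lambda>x. 1 - f x)"
      by (rule le[OF c]) (use f in auto)
    also have "\<dots> = \<nu> (\<lambda>x. 1) - \<nu> f" by (rule diff) (auto simp: fc)
    finally show "\<nu> f \<le> integral\<^sup>L radon_measure f"
      using continuous_integrable[OF fc] mass by (simp add: Bochner_Integration.integral_diff)
  qed
  obtain b where b: "\<And>x. x \<in> topspace T \<Longrightarrow> \<bar>g x\<bar> \<le> b"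
    using continuous_map_bounded[OF compact gc] by blast
  define c where "c = \<bar>b\<bar> + 1"
  have c: "c > 0" "\<And>x. x \<in> topspace T \<Longrightarrow> \<bar>g x\<bar> \<le> c"
    using b unfolding c_def by (force simp: abs_le_iff)+
  let ?f = "\<lambda>x. (1 / (2 * c)) * (g x + c)"
  have c1: "continuous_map T euclideanreal (\<lambda>x. g x + c)" by (intro continuous_intros gc)
  have "integral\<^sup>L radon_measure ?f = \<nu> ?f"
  proof (intro eq continuous_intros gc)
    fix x assume x: "x \<in> topspace T"
    have "- c \<le> g x" "g x \<le> c" using c(2)[OF x] by linarith+
    then show "?f x \<in> {0..1}" using c(1) by (auto simp: field_simps)
  qed auto
  moreover have "\<nu> ?f = (1 / (2 * c)) * (\<nu> g + c * \<nu> (\<lambda>x. 1))"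
    using scale[OF c1, of "1 / (2 * c)"] add[OF gc, of "\<lambda>x. c"] const[of c] by simp
  moreover have "integral\<^sup>L radon_measure ?f = (1 / (2 * c)) * (integral\<^sup>L radon_measure g + c * \<nu> (\<lambda>x. 1))"
    using continuous_integrable[OF gc] mass
    by (simp add: Bochner_Integration.integral_add mult.commute)
  ultimately show ?thesis using c(1) by simp
qed

lemma measure_Union_finite:
  assumes op: "\<And>U. U \<in> \<U> \<Longrightarrow> openin T U" and e: "e > 0"
  obtains F where "finite F" "F \<subseteq> \<U>" "measure radon_measure (\<Union>\<U>) \<le> measure radon_measure (\<Union>F) + e"
proof -
  obtain F where F: "finite F" "F \<subseteq> \<U>" "content (\<Union>\<U>) \<le> content (\<Union>F) + e"
    using content_Union_finite[OF op e] by blast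
  moreover have "openin T (\<Union>\<U>)" "openin T (\<Union>F)" using F op by auto
  ultimately show ?thesis using that by (simp add: measure_radon_open)
qed

end

section \<open>The weak-star topology and Simons' argument\<close>

lemma continuous_map_weak_star_eval:
  "continuous_map weak_star_topology euclideanreal (\<lambda>f. blinfun_apply f x)"
  by (rule strong_operator_topology_continuous_evaluation)

lemma topspace_weak_star [simp]: "topspace weak_star_topology = UNIV"
  by (rule strong_operator_topology_topspace)

lemma openin_weak_star_eval:
  "open U \<Longrightarrow> openin weak_star_topology {f. blinfun_apply f x \<in> U}"
  using openin_continuous_map_preimage[OF continuous_map_weak_star_eval, of U x] by simp

lemma Hausdorff_weak_star: "Hausdorff_space (weak_star_topology :: ('a::real_normed_vector \<Rightarrow>\<^sub>L real) topology)"
  unfolding Hausdorff_space_def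
proof (intro allI impI, elim conjE)
  fix f g :: "'a \<Rightarrow>\<^sub>L real" assume "f \<noteq> g"
  then obtain x where "blinfun_apply f x \<noteq> blinfun_apply g x" by (meson blinfun_eqI)
  then obtain U V where UV: "open U" "open V" "blinfun_apply f x \<in> U" "blinfun_apply g x \<in> V" "U \<inter> V = {}"
    using hausdorff by meson
  show "\<exists>U V. openin weak_star_topology U \<and> openin weak_star_topology V \<and> f \<in> U \<and> g \<in> V \<and> disjnt U V"
    by (rule exI[of _ "{f. blinfun_apply f x \<in> U}"], rule exI[of _ "{f. blinfun_apply f x \<in> V}"])
      (use UV openin_weak_star_eval in \<open>auto simp: disjnt_def\<close>)
qed

lemma continuous_map_to_weak_star:
  "(\<And>x. continuous_map T euclideanreal (\<lambda>y. blinfun_apply (f y) x)) \<Longrightarrow> continuous_map T weak_star_topology f"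
  by (simp add: continuous_on_strong_operator_topo_iff_coordinatewise)

text \<open>Makes the sum of two weak-star compact sets weak-star compact, for use in
  \<open>moments_dense\<close>.\<close>

lemma continuous_map_blinfun_add:
  "continuous_map (prod_topology weak_star_topology weak_star_topology) weak_star_topology
     (\<lambda>(f, g). f + g :: 'a::real_normed_vector \<Rightarrow>\<^sub>L real)"
proof (rule continuous_map_to_weak_star)
  fix x :: 'a
  have "continuous_map (prod_topology weak_star_topology weak_star_topology) euclideanreal
      (\<lambda>y. blinfun_apply (fst y) x + blinfun_apply (snd y) x)"
    by (intro continuous_map_add
        continuous_map_compose[OF continuous_map_fst continuous_map_weak_star_eval, unfolded o_def]
        continuous_map_compose[OF continuous_map_snd continuous_map_weak_star_eval, unfolded o_def])
  then show "continuous_map (prod_topology weak_star_topology weak_star_topology) euclideanreal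
      (\<lambda>y. blinfun_apply (case y of (f, g) \<Rightarrow> f + g) x)"
    by (simp add: case_prod_unfold blinfun.add_left)
qed

text \<open>Banach-Alaoglu: the ball is the image of a closed set of linear functions in a Tychonoff
  product of intervals, under a map that is continuous into the weak-star topology.\<close>

lemma compactin_weak_star_cball:
  "compactin weak_star_topology (cball 0 r :: ('a::real_normed_vector \<Rightarrow>\<^sub>L real) set)"
proof (cases "r \<ge> 0")
  case True
  define K where "K = (PiE UNIV (\<lambda>x. {- (r * norm x)..r * norm x}) :: ('a \<Rightarrow> real) set)"
  define L where "L = {\<phi> :: 'a \<Rightarrow> real. (\<forall>x y. \<phi> (x + y) = \<phi> x + \<phi> y) \<and> (\<forall>c x. \<phi> (c *\<^sub>R x) = c * \<phi> x)}"
  have "compactin (product_topology (\<lambda>x::'a. euclideanreal) UNIV) K"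
    unfolding K_def by (simp add: compactin_PiE)
  then have "compact K" by (simp add: euclidean_product_topology)
  moreover have "closed L"
    unfolding L_def
    by (intro closed_Collect_conj closed_Collect_all closed_Collect_eq continuous_intros
        continuous_on_product_coordinates)
  ultimately have "compact (K \<inter> L)" by (rule compact_Int_closed)
  then have "compactin (top_of_set (K \<inter> L)) (K \<inter> L)" by (simp add: compactin_subtopology)
  moreover have ap: "blinfun_apply (Blinfun \<phi>) = \<phi>" if "\<phi> \<in> K \<inter> L" for \<phi>
  proof (rule bounded_linear_Blinfun_apply, rule bounded_linear_intro[where K = r])
    show "norm (\<phi> x) \<le> norm x * r" for x
      using that by (auto simp: K_def abs_le_iff PiE_iff mult.commute minus_le_iff)
  qed (use that in \<open>auto simp: L_def\<close>)
  have "continuous_map (top_of_set (K \<inter> L)) weak_star_topology Blinfun"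
  proof (rule continuous_map_to_weak_star)
    fix x :: 'a
    have "continuous_map (top_of_set (K \<inter> L)) euclideanreal (\<lambda>\<phi>. \<phi> x)"
      using continuous_on_subset[OF continuous_on_product_coordinates[of x], of "K \<inter> L"] by simp
    then show "continuous_map (top_of_set (K \<inter> L)) euclideanreal (\<lambda>\<phi>. blinfun_apply (Blinfun \<phi>) x)"
      by (rule continuous_map_eq) (use ap in auto)
  qed
  ultimately have "compactin weak_star_topology (Blinfun ` (K \<inter> L))"
    using image_compactin by blast
  moreover have "Blinfun ` (K \<inter> L) = cball 0 r"
  proof safe
    fix \<phi> assume \<phi>: "\<phi> \<in> K" "\<phi> \<in> L"
    have "norm (Blinfun \<phi>) \<le> r"
    proof (rule norm_blinfun_bound)
      show "norm (blinfun_apply (Blinfun \<phi>) x) \<le> r * norm x" for x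
        using \<phi> ap[of \<phi>] by (auto simp: K_def abs_le_iff PiE_iff minus_le_iff)
    qed (rule True)
    then show "Blinfun \<phi> \<in> cball 0 r" by simp
  next
    fix f :: "'a \<Rightarrow>\<^sub>L real" assume f: "f \<in> cball 0 r"
    have "\<bar>blinfun_apply f x\<bar> \<le> r * norm x" for x
    proof -
      have "\<bar>blinfun_apply f x\<bar> \<le> norm f * norm x" using norm_blinfun[of f x] by simp
      also have "\<dots> \<le> r * norm x" using f by (intro mult_right_mono) auto
      finally show ?thesis .
    qed
    then have "blinfun_apply f \<in> K \<inter> L"
      by (auto simp: K_def L_def abs_le_iff minus_le_iff blinfun.add_right blinfun.scaleR_right)
    then show "f \<in> Blinfun ` (K \<inter> L)" by (metis blinfun_apply_inverse imageI)
  qed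
  ultimately show ?thesis by simp
qed simp

text \<open>
  In place of the Hahn-Banach theorem: minimise over \<open>C\<close> the Euclidean distance to \<open>f\<close> in finitely
  many coordinates that, by compactness, already separate \<open>f\<close> from \<open>C\<close>.
\<close>

lemma separation:
  fixes f :: "'a::real_normed_vector \<Rightarrow>\<^sub>L real"
  assumes C: "compactin weak_star_topology C" "convex C" and f: "f \<notin> C"
  obtains x \<gamma> where "\<And>c. c \<in> C \<Longrightarrow> blinfun_apply c x \<le> \<gamma>" "\<gamma> < blinfun_apply f x"
proof (cases "C = {}")
  case True
  then show ?thesis using that[of 0 "-1"] by simp
next
  case False
  define \<U> where "\<U> = range (\<lambda>x. {g. blinfun_apply g x \<in> - {blinfun_apply f x}})"
  have "\<And>U. U \<in> \<U> \<Longrightarrow> openin weak_star_topology U"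
    unfolding \<U>_def using openin_weak_star_eval by blast
  moreover have "C \<subseteq> \<Union>\<U>"
  proof
    fix c assume "c \<in> C"
    then have "c \<noteq> f" using f by auto
    then obtain x where "blinfun_apply c x \<noteq> blinfun_apply f x" by (meson blinfun_eqI)
    then show "c \<in> \<Union>\<U>" unfolding \<U>_def by auto
  qed
  ultimately obtain F where F: "finite F" "F \<subseteq> \<U>" "C \<subseteq> \<Union>F"
    using C(1) unfolding compactin_def by meson
  then obtain I where I: "finite I" "F = (\<lambda>x. {g. blinfun_apply g x \<in> - {blinfun_apply f x}}) ` I"
    using finite_subset_image[OF F(1) F(2)[unfolded \<U>_def]] by blast
  define \<phi> where "\<phi> c = (\<Sum>x\<in>I. (blinfun_apply c x - blinfun_apply f x)\<^sup>2)" for c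
  have pos: "\<phi> c > 0" if c: "c \<in> C" for c
  proof -
    obtain x where "x \<in> I" "blinfun_apply c x \<noteq> blinfun_apply f x"
      using F(3) I(2) c by auto
    then show ?thesis unfolding \<phi>_def by (intro sum_pos2[OF I(1)]) auto
  qed
  have "continuous_map weak_star_topology euclideanreal \<phi>"
    unfolding \<phi>_def by (intro continuous_intros continuous_map_weak_star_eval I)
  then have "compact (\<phi> ` C)" using image_compactin[OF C(1)] by force
  then obtain c0 where c0: "c0 \<in> C" "\<And>c. c \<in> C \<Longrightarrow> \<phi> c0 \<le> \<phi> c"
    using compact_attains_inf[of "\<phi> ` C"] False by auto
  \<comment> \<open>Up to the factor \<open>- 1 / 2\<close> the coefficients are the partial
    derivatives of \<phi> at its minimiser \<open>c0\<close>, so that minimality becomes a linear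
    inequality on \<open>C\<close>.\<close>
  define x where "x = (\<Sum>y\<in>I. (blinfun_apply f y - blinfun_apply c0 y) *\<^sub>R y)"
  have ap: "blinfun_apply g x = (\<Sum>y\<in>I. (blinfun_apply f y - blinfun_apply c0 y) * blinfun_apply g y)" for g
    unfolding x_def by (simp add: blinfun.sum_right blinfun.scaleR_right)
  show ?thesis
  proof
    have "blinfun_apply f x - blinfun_apply c0 x = \<phi> c0"
      unfolding ap \<phi>_def sum_subtractf[symmetric]
      by (intro sum.cong) (auto simp: power2_eq_square algebra_simps)
    then show "blinfun_apply c0 x < blinfun_apply f x" using pos[OF c0(1)] by linarith
  next
    fix c assume c: "c \<in> C"
    define A where "A = (\<Sum>y\<in>I. (blinfun_apply c y - blinfun_apply c0 y)\<^sup>2)"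
    define B where "B = (\<Sum>y\<in>I. (blinfun_apply c y - blinfun_apply c0 y) * (blinfun_apply c0 y - blinfun_apply f y))"
    have A: "A \<ge> 0" unfolding A_def by (intro sum_nonneg) auto
    have q: "0 \<le> t\<^sup>2 * A + 2 * t * B" if t: "0 \<le> t" "t \<le> 1" for t
    proof -
      have "(1 - t) *\<^sub>R c0 + t *\<^sub>R c \<in> C" using C(2) c c0(1) t by (simp add: convex_alt)
      then have "\<phi> c0 \<le> \<phi> ((1 - t) *\<^sub>R c0 + t *\<^sub>R c)" by (rule c0)
      also have "\<dots> = \<phi> c0 + (t\<^sup>2 * A + 2 * t * B)"
      proof -
        have "blinfun_apply ((1 - t) *\<^sub>R c0 + t *\<^sub>R c) y = (1 - t) * blinfun_apply c0 y + t * blinfun_apply c y" for y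
          by (simp only: blinfun.add_left blinfun.scaleR_left) simp
        note eval = this
        show ?thesis
          unfolding eval \<phi>_def A_def B_def sum_distrib_left sum.distrib[symmetric]
          by (intro sum.cong refl) (simp only: power2_eq_square, simp add: algebra_simps)
      qed
      finally show ?thesis by simp
    qed
    have "B \<ge> 0"
    proof (rule ccontr)
      assume "\<not> B \<ge> 0"
      then have Bn: "B < 0" by simp
      \<comment> \<open>Chosen so that \<open>t \<le> 1\<close> and \<open>t * A \<le> - B\<close>;
        then \<open>t * A + 2 * B \<le> B < 0\<close>, against \<open>q\<close>.\<close>
      define t where "t = - B / (A - B)"
      have t: "0 < t" "t \<le> 1" using A Bn by (auto simp: t_def field_simps)
      have "t * A \<le> - B"
      proof -
        have "t * A = - B * (A / (A - B))" by (simp add: t_def)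
        also have "\<dots> \<le> - B * 1" using A Bn by (intro mult_left_mono) (auto simp: field_simps)
        finally show ?thesis by simp
      qed
      then have "t * (t * A + 2 * B) < 0" using t Bn by (intro mult_pos_neg) auto
      then show False using q[of t] t by (simp add: power2_eq_square algebra_simps)
    qed
    moreover have "blinfun_apply c x - blinfun_apply c0 x = - B"
      unfolding ap B_def sum_subtractf[symmetric] sum_negf[symmetric]
      by (intro sum.cong) (auto simp: algebra_simps)
    ultimately show "blinfun_apply c x \<le> blinfun_apply c0 x" by linarith
  qed
qed

text \<open>The points \<open>z n\<close> descend along nearly minimal steps for the sublinear
  function \<open>p\<close>. Near-minimality shows that \<open>p (z n) - p Z\<close> is at most
  \<open>r n * (e/2)\<close>, where \<open>Z\<close> is their limit; but a boundary functional
  norming \<open>Z\<close> forces this difference to be at least \<open>e * r n\<close> for large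
  \<open>n\<close>.\<close>

lemma simons:
  fixes x :: "nat \<Rightarrow> 'a::banach" and f :: "'a \<Rightarrow>\<^sub>L real"
  assumes B: "is_boundary B" and f: "norm f \<le> 1" and x1: "\<And>n. norm (x n) \<le> 1" and e: "e > 0"
    and lim: "\<And>b. b \<in> B \<Longrightarrow> \<exists>n0. \<forall>n\<ge>n0. blinfun_apply b (x n) + e \<le> blinfun_apply f (x n)"
  shows False
proof -
  define p where "p z = norm z - blinfun_apply f z" for z
  define C where "C n = convex hull (x ` {n..})" for n
  define r :: "nat \<Rightarrow> real" where "r n = (1/2)^n" for n
  \<comment> \<open>This size makes the induction step of \<open>Cl\<close> close exactly, since
    \<open>(1 - r n) + r n / 2 = 1 - r (Suc n)\<close>.\<close>
  define \<eta> where "\<eta> n = e/4 * (r n)\<^sup>2" for n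
  have r: "r n > 0" "r (Suc n) = r n / 2" "r 0 = 1" for n by (auto simp: r_def)
  have rlim: "r \<longlonglongrightarrow> 0" unfolding r_def by (rule LIMSEQ_power_zero) simp
  have p0: "p z \<ge> 0" for z
  proof -
    have "\<bar>blinfun_apply f z\<bar> \<le> norm f * norm z" using norm_blinfun[of f z] by simp
    also have "\<dots> \<le> norm z" using f by (simp add: mult_left_le_one_le)
    finally show ?thesis by (simp add: p_def)
  qed
  have pconv: "p (a + b) \<le> p a + p b" "p (c *\<^sub>R a) = c * p a" if "c \<ge> 0" for a b c
    using norm_triangle_ineq[of a b] that
    by (auto simp: p_def blinfun.add_right blinfun.scaleR_right algebra_simps)
  have cvx: "convex (C n)" for n unfolding C_def by (rule convex_convex_hull)
  have xC: "x n \<in> C n" for n unfolding C_def by (rule hull_inc) simp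
  have Csub: "C n \<subseteq> C m" if "m \<le> n" for m n
    unfolding C_def using that by (intro hull_mono) auto
  have C1: "norm y \<le> 1" if "y \<in> C n" for y n
  proof -
    have "C n \<subseteq> cball 0 1" unfolding C_def by (rule hull_minimal) (use x1 in auto)
    then show ?thesis using that by auto
  qed
  have "\<exists>y. y \<in> C n \<and> (\<forall>y'\<in>C n. p (z + r n *\<^sub>R y) \<le> p (z + r n *\<^sub>R y') + \<eta> n)" for n z
  proof -
    let ?S = "(\<lambda>y. p (z + r n *\<^sub>R y)) ` C n"
    have bd: "bdd_below ?S" using p0 by (intro bdd_belowI[of _ 0]) auto
    have "Inf ?S < Inf ?S + \<eta> n" using e r(1)[of n] by (simp add: \<eta>_def)
    then obtain s where "s \<in> ?S" "s < Inf ?S + \<eta> n"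
      using cInf_lessD[of ?S] xC by blast
    then obtain y where "y \<in> C n" "p (z + r n *\<^sub>R y) < Inf ?S + \<eta> n" by auto
    moreover have "Inf ?S \<le> p (z + r n *\<^sub>R y')" if "y' \<in> C n" for y'
      using that bd by (intro cInf_lower) auto
    ultimately show ?thesis by force
  qed
  then obtain Y where Y: "\<And>n z. Y n z \<in> C n"
    "\<And>n z y'. y' \<in> C n \<Longrightarrow> p (z + r n *\<^sub>R Y n z) \<le> p (z + r n *\<^sub>R y') + \<eta> n"
    by metis
  define z where "z = rec_nat 0 (\<lambda>n z. z + r (Suc n) *\<^sub>R Y n z)"
  define y where "y n = Y n (z n)" for n
  have z0: "z 0 = 0" and zS: "z (Suc n) = z n + r (Suc n) *\<^sub>R y n" for n
    by (auto simp: z_def y_def)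
  have yC: "y n \<in> C n" for n unfolding y_def by (rule Y)
  have zsum: "z n = (\<Sum>k<n. r (Suc k) *\<^sub>R y k)" for n
    by (induction n) (auto simp: z0 zS)
  have "summable (\<lambda>k. r (Suc k) *\<^sub>R y k)"
  proof (rule summable_comparison_test)
    show "\<exists>N. \<forall>n\<ge>N. norm (r (Suc n) *\<^sub>R y n) \<le> r (Suc n)"
      using C1[OF yC] r(1) by (auto simp: abs_of_pos mult_left_le)
    show "summable (\<lambda>n. r (Suc n))" using sums_summable[OF power_half_series] by (simp add: r_def)
  qed
  then obtain Z where Z: "z \<longlonglongrightarrow> Z"
    unfolding zsum[abs_def] using summable_LIMSEQ by blast
  \<comment> \<open>The increments between \<open>z n\<close> and \<open>z m\<close> go along
    elements of \<open>C n\<close> with weights adding up to \<open>r n - r m\<close>. Together with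
    a last step of weight \<open>r m\<close> they form one step of weight \<open>r n\<close> from
    \<open>z n\<close>, which can be compared with the step along \<open>y n\<close>.\<close>
  have shift: "\<exists>y'\<in>C n. z m + r m *\<^sub>R v = z n + r n *\<^sub>R y'" if "n \<le> m" "v \<in> C n" for n m v
    using that
  proof (induction m arbitrary: v rule: dec_induct)
    case base then show ?case by auto
  next
    case (step m)
    have "y m \<in> C n" using yC Csub step by blast
    then have "(1/2) *\<^sub>R y m + (1/2) *\<^sub>R v \<in> C n"
      using convexD[OF cvx, of "y m" n v "1/2" "1/2"] step by simp
    from step.IH[OF this] show ?case
      by (simp add: zS r(2) scaleR_right_distrib add.assoc)
  qed
  have A: "p (z n + r n *\<^sub>R y n) \<le> p Z + \<eta> n" for n
  proof -
    have "(\<lambda>m. r m *\<^sub>R y m) \<longlonglongrightarrow> 0"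
    proof (rule Lim_null_comparison)
      show "\<forall>\<^sub>F m in sequentially. norm (r m *\<^sub>R y m) \<le> r m"
        using C1[OF yC] r(1) by (auto simp: abs_of_pos mult_left_le)
    qed (rule rlim)
    then have "(\<lambda>m. z m + r m *\<^sub>R y m) \<longlonglongrightarrow> Z + 0" by (intro tendsto_intros Z)
    then have "(\<lambda>m. p (z m + r m *\<^sub>R y m) + \<eta> n) \<longlonglongrightarrow> p Z + \<eta> n"
      unfolding p_def by (auto intro!: tendsto_intros)
    moreover have "p (z n + r n *\<^sub>R y n) \<le> p (z m + r m *\<^sub>R y m) + \<eta> n" if m: "m \<ge> n" for m
    proof -
      have "y m \<in> C n" using yC Csub m by blast
      then obtain y' where "y' \<in> C n" "z m + r m *\<^sub>R y m = z n + r n *\<^sub>R y'" using shift[OF m] by blast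
      then show ?thesis using Y(2)[of y' n "z n"] by (simp add: y_def)
    qed
    ultimately show ?thesis by (intro LIMSEQ_le_const) blast+
  qed
  have Cl: "p Z - p (z n) \<ge> - r n * (e/2) * (1 - r n)" for n
  proof (induction n)
    case 0 then show ?case using p0[of Z] by (simp add: z0 p_def[of 0] r)
  next
    case (Suc n)
    \<comment> \<open>\<open>z (Suc n)\<close> is the midpoint of \<open>z n\<close> and the nearly
      minimal point of \<open>A\<close>, so convexity of \<open>p\<close> gives the
      recursion.\<close>
    have "z (Suc n) = (1/2) *\<^sub>R z n + (1/2) *\<^sub>R (z n + r n *\<^sub>R y n)"
    proof -
      have "z n = (1/2) *\<^sub>R z n + (1/2) *\<^sub>R z n"
        using scaleR_half_double[of "z n"] by (simp only: scaleR_right_distrib)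
      then show ?thesis by (simp only: zS r(2)) (simp add: scaleR_right_distrib)
    qed
    then have "p (z (Suc n)) \<le> (1/2) * p (z n) + (1/2) * p (z n + r n *\<^sub>R y n)"
      using pconv(1)[of 0 "(1/2) *\<^sub>R z n" "(1/2) *\<^sub>R (z n + r n *\<^sub>R y n)"] by (simp only: pconv(2))
    also have "\<dots> \<le> (1/2) * p (z n) + (1/2) * (p Z + \<eta> n)" using A[of n] by simp
    finally show ?case using Suc
      by (simp add: r \<eta>_def power2_eq_square field_simps)
  qed
  obtain b where b: "b \<in> B" "blinfun_apply b Z = norm Z" using B unfolding is_boundary_def by blast
  obtain n where n: "\<And>k. k \<ge> n \<Longrightarrow> blinfun_apply b (x k) + e \<le> blinfun_apply f (x k)"
    using lim[OF b(1)] by blast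
  \<comment> \<open>\<beta> is linear, lies below \<open>p\<close> and agrees with \<open>p\<close>
    at \<open>Z\<close>; along each \<open>y k\<close> with \<open>k \<ge> n\<close> it is at most
    \<open>- e\<close>.\<close>
  define \<beta> where "\<beta> u = blinfun_apply b u - blinfun_apply f u" for u
  have lin: "\<beta> (u + v) = \<beta> u + \<beta> v" "\<beta> (c *\<^sub>R u) = c * \<beta> u" for u v c
    by (simp_all add: \<beta>_def blinfun.add_right blinfun.scaleR_right algebra_simps)
  have \<beta>y: "\<beta> (y k) \<le> - e" if k: "k \<ge> n" for k
  proof -
    have "convex {u. \<beta> u \<le> - e}"
    proof (rule convexI)
      fix u v :: 'a and s t :: real
      assume *: "u \<in> {u. \<beta> u \<le> - e}" "v \<in> {u. \<beta> u \<le> - e}" "0 \<le> s" "0 \<le> t" "s + t = 1"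
      then have "s * \<beta> u \<le> s * (- e)" "t * \<beta> v \<le> t * (- e)" using mult_left_mono[of "\<beta> u" "- e" s] mult_left_mono[of "\<beta> v" "- e" t] by simp_all
      moreover have "s * (- e) + t * (- e) = (s + t) * (- e)" by (simp add: algebra_simps)
      ultimately show "s *\<^sub>R u + t *\<^sub>R v \<in> {u. \<beta> u \<le> - e}" using * by (simp add: lin)
    qed
    moreover have "x ` {k..} \<subseteq> {u. \<beta> u \<le> - e}"
    proof (rule image_subsetI, rule CollectI)
      fix j assume "j \<in> {k..}"
      then have "blinfun_apply b (x j) + e \<le> blinfun_apply f (x j)" using k by (intro n) simp
      then show "\<beta> (x j) \<le> - e" by (simp add: \<beta>_def)
    qed
    ultimately have "C k \<subseteq> {u. \<beta> u \<le> - e}"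
      unfolding C_def by (intro hull_minimal)
    then show ?thesis using yC by auto
  qed
  have "\<beta> (z m) \<le> \<beta> (z n) - e * (r n - r m)" if "m \<ge> n" for m
    using that
  proof (induction m rule: dec_induct)
    case (step m)
    have "r (Suc m) * \<beta> (y m) \<le> r (Suc m) * (- e)"
      using \<beta>y[of m] step r(1) by (intro mult_left_mono) (auto simp: less_imp_le)
    then show ?case using step.IH by (simp add: zS lin r(2) algebra_simps)
  qed simp
  moreover have "(\<lambda>m. \<beta> (z m)) \<longlonglongrightarrow> \<beta> Z" unfolding \<beta>_def by (intro tendsto_intros Z)
  moreover have "(\<lambda>m. \<beta> (z n) - e * (r n - r m)) \<longlonglongrightarrow> \<beta> (z n) - e * (r n - 0)"
    by (intro tendsto_intros rlim)
  ultimately have "\<beta> Z \<le> \<beta> (z n) - e * r n"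
    using LIMSEQ_le[of "\<lambda>m. \<beta> (z m)" "\<beta> Z" "\<lambda>m. \<beta> (z n) - e * (r n - r m)"] by auto
  moreover have "\<beta> Z = p Z" by (simp add: \<beta>_def p_def b)
  moreover have "\<beta> (z n) \<le> p (z n)"
  proof -
    have "norm b \<le> 1" using b(1) B unfolding is_boundary_def by auto
    then have "norm b * norm (z n) \<le> norm (z n)" by (simp add: mult_left_le_one_le)
    then show ?thesis using norm_blinfun[of b "z n"] by (simp add: \<beta>_def p_def)
  qed
  ultimately have "p Z - p (z n) \<le> - e * r n" by simp
  moreover have "r n * (e/2) * (1 - r n) < e * r n" using r(1)[of n] e by (simp add: field_simps add_pos_pos)
  ultimately show False using Cl[of n] by simp
qed

section \<open>Lower semicontinuity and spaces of positive functionals\<close>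

definition lsc_on :: "'b topology \<Rightarrow> ('b \<Rightarrow> real) \<Rightarrow> bool" where
  "lsc_on T \<phi> \<longleftrightarrow> (\<forall>c. openin T {x \<in> topspace T. c < \<phi> x})"

lemma lsc_onI: "(\<And>c. openin T {x \<in> topspace T. c < \<phi> x}) \<Longrightarrow> lsc_on T \<phi>"
  by (simp add: lsc_on_def)

lemma lsc_onD: "lsc_on T \<phi> \<Longrightarrow> openin T {x \<in> topspace T. c < \<phi> x}"
  by (simp add: lsc_on_def)

lemma lsc_on_closed: "lsc_on T \<phi> \<Longrightarrow> closedin T {x \<in> topspace T. \<phi> x \<le> c}"
proof -
  assume "lsc_on T \<phi>"
  then have "closedin T (topspace T - {x \<in> topspace T. c < \<phi> x})"
    by (intro closedin_diff closedin_topspace lsc_onD)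
  moreover have "topspace T - {x \<in> topspace T. c < \<phi> x} = {x \<in> topspace T. \<phi> x \<le> c}" by auto
  ultimately show ?thesis by simp
qed

lemma lsc_on_closedI:
  assumes "\<And>c. closedin T {x \<in> topspace T. \<phi> x \<le> c}"
  shows "lsc_on T \<phi>"
proof (rule lsc_onI)
  fix c
  have "{x \<in> topspace T. c < \<phi> x} = topspace T - {x \<in> topspace T. \<phi> x \<le> c}" by auto
  then show "openin T {x \<in> topspace T. c < \<phi> x}"
    using openin_diff[OF openin_topspace assms[of c]] by simp
qed

lemma lsc_on_cong: "(\<And>x. x \<in> topspace T \<Longrightarrow> \<phi> x = \<psi> x) \<Longrightarrow> lsc_on T \<phi> = lsc_on T \<psi>"
  unfolding lsc_on_def by (intro all_cong1 arg_cong[where f = "openin T"]) auto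

lemma lsc_on_continuous:
  assumes "continuous_map T euclideanreal \<phi>"
  shows "lsc_on T \<phi>"
  using openin_continuous_map_preimage[OF assms, of "{c<..}" for c] by (intro lsc_onI) simp

lemma lsc_on_compose:
  assumes f: "continuous_map S T f" and \<phi>: "lsc_on T \<phi>"
  shows "lsc_on S (\<lambda>x. \<phi> (f x))"
proof (rule lsc_onI)
  fix c
  have "{x \<in> topspace S. c < \<phi> (f x)} = {x \<in> topspace S. f x \<in> {y \<in> topspace T. c < \<phi> y}}"
    using continuous_map_image_subset_topspace[OF f] by auto
  then show "openin S {x \<in> topspace S. c < \<phi> (f x)}"
    using openin_continuous_map_preimage[OF f lsc_onD[OF \<phi>]] by simp
qed

lemma lsc_on_add:
  assumes "lsc_on T \<phi>" "lsc_on T \<psi>"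
  shows "lsc_on T (\<lambda>x. \<phi> x + \<psi> x)"
proof (rule lsc_onI)
  fix c
  have "{x \<in> topspace T. c < \<phi> x + \<psi> x} =
      (\<Union>r. {x \<in> topspace T. r < \<phi> x} \<inter> {x \<in> topspace T. c - r < \<psi> x})"
  proof safe
    fix x assume x: "x \<in> topspace T" "c < \<phi> x + \<psi> x"
    define r where "r = \<phi> x - (\<phi> x + \<psi> x - c) / 2"
    have "r < \<phi> x" "c - r < \<psi> x" using x by (auto simp: r_def field_simps)
    then show "x \<in> (\<Union>r. {x \<in> topspace T. r < \<phi> x} \<inter> {x \<in> topspace T. c - r < \<psi> x})"
      using x by blast
  qed auto
  then show "openin T {x \<in> topspace T. c < \<phi> x + \<psi> x}"
    using assms by (auto intro!: openin_Union lsc_onD)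
qed

lemma lsc_on_SUP:
  assumes "I \<noteq> {}" "\<And>i. i \<in> I \<Longrightarrow> lsc_on T (\<phi> i)"
    and bdd: "\<And>x. x \<in> topspace T \<Longrightarrow> bdd_above ((\<lambda>i. \<phi> i x) ` I)"
  shows "lsc_on T (\<lambda>x. SUP i\<in>I. \<phi> i x)"
proof (rule lsc_onI)
  fix c
  have "{x \<in> topspace T. c < (SUP i\<in>I. \<phi> i x)} = (\<Union>i\<in>I. {x \<in> topspace T. c < \<phi> i x})"
    using less_cSUP_iff[OF assms(1) bdd] by auto
  then show "openin T {x \<in> topspace T. c < (SUP i\<in>I. \<phi> i x)}"
    using assms(2) by (auto intro!: openin_Union lsc_onD)
qed

lemma lsc_on_cmult:
  assumes "lsc_on T \<phi>" "(a::real) \<ge> 0"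
  shows "lsc_on T (\<lambda>x. a * \<phi> x)"
proof (cases "a = 0")
  case True
  then show ?thesis by (auto intro!: lsc_on_continuous)
next
  case False
  then have a: "a > 0" using assms by simp
  show ?thesis
  proof (rule lsc_onI)
    fix c
    have "{x \<in> topspace T. c < a * \<phi> x} = {x \<in> topspace T. c / a < \<phi> x}"
      using a by (auto simp: field_simps)
    then show "openin T {x \<in> topspace T. c < a * \<phi> x}" using lsc_onD[OF assms(1)] by simp
  qed
qed

lemma lsc_on_square:
  assumes "lsc_on T \<phi>" "\<And>x. x \<in> topspace T \<Longrightarrow> \<phi> x \<ge> 0"
  shows "lsc_on T (\<lambda>x. (\<phi> x)\<^sup>2)"
proof (rule lsc_onI)
  fix c
  show "openin T {x \<in> topspace T. c < (\<phi> x)\<^sup>2}"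
  proof (cases "c < 0")
    case True
    then have "{x \<in> topspace T. c < (\<phi> x)\<^sup>2} = topspace T"
      by (auto intro: less_le_trans)
    then show ?thesis by simp
  next
    case False
    then have "{x \<in> topspace T. c < (\<phi> x)\<^sup>2} = {x \<in> topspace T. sqrt c < \<phi> x}"
      using assms(2) by (auto simp: real_less_rsqrt real_sqrt_less_iff real_less_lsqrt)
        (metis not_less real_le_rsqrt real_sqrt_le_iff real_sqrt_unique)+
    then show ?thesis using lsc_onD[OF assms(1)] by simp
  qed
qed

lemma lsc_on_sum:
  assumes "\<And>i. i \<in> I \<Longrightarrow> lsc_on T (\<phi> i)"
  shows "lsc_on T (\<lambda>x. \<Sum>i\<in>I. \<phi> i x)"
  using assms
  by (induction I rule: infinite_finite_induct) (auto intro: lsc_on_add lsc_on_continuous)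

lemma lsc_on_suminf:
  fixes \<phi> :: "nat \<Rightarrow> 'b \<Rightarrow> real"
  assumes "\<And>i. lsc_on T (\<phi> i)" "\<And>i x. x \<in> topspace T \<Longrightarrow> \<phi> i x \<ge> 0"
    "\<And>x. x \<in> topspace T \<Longrightarrow> summable (\<lambda>i. \<phi> i x)"
  shows "lsc_on T (\<lambda>x. \<Sum>i. \<phi> i x)"
proof -
  have "(\<Sum>i. \<phi> i x) = (SUP n. \<Sum>i<n. \<phi> i x)" if x: "x \<in> topspace T" for x
    by (rule suminf_eq_SUP_real) (use assms x in auto)
  then have "lsc_on T (\<lambda>x. \<Sum>i. \<phi> i x) = lsc_on T (\<lambda>x. SUP n. \<Sum>i<n. \<phi> i x)"
    by (rule lsc_on_cong)
  moreover have "bdd_above (range (\<lambda>n. \<Sum>i<n. \<phi> i x))" if x: "x \<in> topspace T" for x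
    using sum_le_suminf[OF assms(3)[OF x]] assms(2)[OF x] by (intro bdd_aboveI[of _ "\<Sum>i. \<phi> i x"]) auto
  then have "lsc_on T (\<lambda>x. SUP n. \<Sum>i<n. \<phi> i x)"
    by (intro lsc_on_SUP lsc_on_sum assms(1)) auto
  ultimately show ?thesis by simp
qed

text \<open>Otherwise the open sets where \<phi> exceeds \<open>\<phi> y\<close> cover the space,
  and among the finitely many \<open>y\<close> of a subcover the one with least
  \<open>\<phi> y\<close> lies in none of its members.\<close>

lemma lsc_on_attains_min:
  assumes T: "compact_space T" "topspace T \<noteq> {}" and \<phi>: "lsc_on T \<phi>" and bd: "\<And>x. x \<in> topspace T \<Longrightarrow> b \<le> \<phi> x"
  obtains x where "x \<in> topspace T" "\<And>y. y \<in> topspace T \<Longrightarrow> \<phi> x \<le> \<phi> y"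
proof -
  have "\<exists>x\<in>topspace T. \<forall>y\<in>topspace T. \<phi> x \<le> \<phi> y"
  proof (rule ccontr)
    assume "\<not> ?thesis"
    then have *: "\<And>x. x \<in> topspace T \<Longrightarrow> \<exists>y\<in>topspace T. \<phi> y < \<phi> x" by force
    define \<U> where "\<U> = (\<lambda>y. {x \<in> topspace T. \<phi> y < \<phi> x}) ` topspace T"
    have "\<And>U. U \<in> \<U> \<Longrightarrow> openin T U" using \<phi> by (auto simp: \<U>_def intro: lsc_onD)
    moreover have "topspace T \<subseteq> \<Union>\<U>" using * by (auto simp: \<U>_def)
    ultimately obtain F where F: "finite F" "F \<subseteq> \<U>" "topspace T \<subseteq> \<Union>F"
      using T(1) unfolding compact_space_alt by meson
    obtain Y where Y: "Y \<subseteq> topspace T" "finite Y" "F = (\<lambda>y. {x \<in> topspace T. \<phi> y < \<phi> x}) ` Y"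
      using finite_subset_image[OF F(1) F(2)[unfolded \<U>_def]] by blast
    have "Y \<noteq> {}" using F(3) Y T(2) by auto
    then obtain y where y: "y \<in> Y" "\<And>y'. y' \<in> Y \<Longrightarrow> \<phi> y \<le> \<phi> y'"
      using arg_min_if_finite[OF Y(2), of \<phi>] by (metis not_le)
    then have "y \<in> \<Union>F" using F(3) Y(1) by auto
    then show False using y Y(3) by force
  qed
  then show ?thesis using that by blast
qed

lemma lsc_on_weak_star_norm:
  "lsc_on weak_star_topology (norm :: ('a::real_normed_vector \<Rightarrow>\<^sub>L real) \<Rightarrow> real)"
proof (rule lsc_on_closedI)
  fix c :: real
  have "{x \<in> topspace weak_star_topology. norm x \<le> c} = (cball 0 c :: ('a \<Rightarrow>\<^sub>L real) set)" by auto
  then show "closedin weak_star_topology {x \<in> topspace weak_star_topology. norm (x :: 'a \<Rightarrow>\<^sub>L real) \<le> c}"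
    using compactin_imp_closedin[OF Hausdorff_weak_star compactin_weak_star_cball[of c]] by simp
qed

text \<open>
  Functionals are total functions; the value \<open>0\<close> off the continuous functions makes the functionals of
  bounded mass a compact subset of the full product space.
\<close>

definition pos_functionals :: "'b topology \<Rightarrow> (('b \<Rightarrow> real) \<Rightarrow> real) set" where
  "pos_functionals T = {\<nu>. positive_functional T \<nu> \<and> (\<forall>g. \<not> continuous_map T euclideanreal g \<longrightarrow> \<nu> g = 0)}"

lemma pos_functionals_add:
  assumes "\<nu> \<in> pos_functionals T" "\<nu>' \<in> pos_functionals T"
  shows "(\<lambda>g. \<nu> g + \<nu>' g) \<in> pos_functionals T"
proof -
  interpret A: positive_functional T \<nu> using assms by (simp add: pos_functionals_def)
  interpret B: positive_functional T \<nu>' using assms by (simp add: pos_functionals_def)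
  have "positive_functional T (\<lambda>g. \<nu> g + \<nu>' g)"
    by standard (auto simp: A.compact A.hausdorff A.add B.add A.scale B.scale A.nonneg B.nonneg distrib_left)
  then show ?thesis using assms by (simp add: pos_functionals_def)
qed

lemma pos_functionals_scale:
  assumes "\<nu> \<in> pos_functionals T" "t \<ge> 0"
  shows "(\<lambda>g. t * \<nu> g) \<in> pos_functionals T"
proof -
  interpret A: positive_functional T \<nu> using assms by (simp add: pos_functionals_def)
  have "positive_functional T (\<lambda>g. t * \<nu> g)"
    by standard (auto simp: A.compact A.hausdorff A.add A.scale A.nonneg distrib_left assms(2))
  then show ?thesis using assms by (simp add: pos_functionals_def)
qed

lemma pos_functionals_zero:
  assumes "compact_space T" "Hausdorff_space T"
  shows "(\<lambda>g. 0) \<in> pos_functionals T"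
  unfolding pos_functionals_def using assms by (auto intro!: positive_functional.intro)

text \<open>Tychonoff again: a mass of at most \<open>R\<close> confines \<open>\<nu> g\<close> to
  an interval depending on \<open>g\<close>, and the axioms are closed conditions under pointwise
  convergence, which on continuous functions is weak-star convergence of measures.\<close>

lemma compact_pos_functionals:
  fixes T :: "'b topology"
  assumes T: "compact_space T" "Hausdorff_space T"
  shows "compact {\<nu> \<in> pos_functionals T. \<nu> (\<lambda>x. 1) \<le> R}"
proof -
  let ?C = "\<lambda>g. continuous_map T euclideanreal g"
  obtain b where b: "\<And>g x. ?C g \<Longrightarrow> x \<in> topspace T \<Longrightarrow> \<bar>g x\<bar> \<le> b g"
    using continuous_map_bounded[OF T(1)] by metis
  define K where "K = (PiE UNIV (\<lambda>g. if ?C g then {- (R * \<bar>b g\<bar>)..R * \<bar>b g\<bar>} else {0}) :: (('b \<Rightarrow> real) \<Rightarrow> real) set)"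
  define A where "A = {\<nu> :: ('b \<Rightarrow> real) \<Rightarrow> real.
    (\<forall>g h. ?C g \<longrightarrow> ?C h \<longrightarrow> \<nu> (\<lambda>x. g x + h x) = \<nu> g + \<nu> h) \<and>
    (\<forall>c g. ?C g \<longrightarrow> \<nu> (\<lambda>x. c * g x) = c * \<nu> g) \<and>
    (\<forall>g. ?C g \<longrightarrow> (\<forall>x\<in>topspace T. 0 \<le> g x) \<longrightarrow> 0 \<le> \<nu> g) \<and>
    (\<forall>g. \<not> ?C g \<longrightarrow> \<nu> g = 0) \<and> \<nu> (\<lambda>x. 1) \<le> R}"
  have "compactin (product_topology (\<lambda>x::'b \<Rightarrow> real. euclideanreal) UNIV) K"
    unfolding K_def by (simp add: compactin_PiE)
  then have "compact K" by (simp add: euclidean_product_topology)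
  moreover have "closed A"
    unfolding A_def
    by (intro closed_Collect_conj closed_Collect_all closed_Collect_imp closed_Collect_eq closed_Collect_le
        open_Collect_const continuous_intros continuous_on_product_coordinates)
  ultimately have "compact (K \<inter> A)" by (rule compact_Int_closed)
  moreover have "{\<nu> \<in> pos_functionals T. \<nu> (\<lambda>x. 1) \<le> R} = K \<inter> A"
  proof (intro equalityI subsetI)
    fix \<nu> assume "\<nu> \<in> {\<nu> \<in> pos_functionals T. \<nu> (\<lambda>x. 1) \<le> R}"
    then have \<nu>: "positive_functional T \<nu>" "\<And>g. \<not> ?C g \<Longrightarrow> \<nu> g = 0" "\<nu> (\<lambda>x. 1) \<le> R"
      by (auto simp: pos_functionals_def)
    interpret positive_functional T \<nu> by (rule \<nu>(1))
    have "\<nu> g \<in> {- (R * \<bar>b g\<bar>)..R * \<bar>b g\<bar>}" if g: "?C g" for g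
    proof -
      have "\<nu> (\<lambda>x. - \<bar>b g\<bar>) \<le> \<nu> g" by (rule mono) (use b[OF g] g in force)+
      moreover have "\<nu> g \<le> \<nu> (\<lambda>x. \<bar>b g\<bar>)" by (rule mono) (use b[OF g] g in force)+
      moreover have "\<bar>b g\<bar> * \<nu> (\<lambda>x. 1) \<le> \<bar>b g\<bar> * R" by (intro mult_left_mono \<nu>) auto
      ultimately show ?thesis using const[of "\<bar>b g\<bar>"] const[of "- \<bar>b g\<bar>"] by (auto simp: mult.commute)
    qed
    then have "\<nu> \<in> K" unfolding K_def using \<nu>(2) by auto
    moreover have "\<nu> \<in> A" unfolding A_def using \<nu> add scale nonneg by auto
    ultimately show "\<nu> \<in> K \<inter> A" by blast
  next
    fix \<nu> assume "\<nu> \<in> K \<inter> A"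
    then show "\<nu> \<in> {\<nu> \<in> pos_functionals T. \<nu> (\<lambda>x. 1) \<le> R}"
      unfolding A_def pos_functionals_def using T by (auto intro!: positive_functional.intro)
  qed
  ultimately show ?thesis by simp
qed

section \<open>Infimal convolution over positive functionals\<close>

lemma young_square:
  fixes a b r :: real
  assumes "r > 0"
  shows "(a + b)\<^sup>2 \<le> (1 + r) * a\<^sup>2 + (1 + 1 / r) * b\<^sup>2"
proof -
  have "0 \<le> (r * a - b)\<^sup>2 / r" using assms by simp
  also have "\<dots> = r * a\<^sup>2 - 2 * a * b + b\<^sup>2 / r"
    using assms by (simp add: power2_eq_square field_simps)
  finally show ?thesis by (simp add: power2_sum algebra_simps)
qed

text \<open>Applied to values \<open>a\<close>, \<open>b\<close> of a seminorm-like function at two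
  points and its value \<open>c\<close> at their sum: when the defect on the right tends to 0, the
  two values become equal in the limit.\<close>

lemma parallelogram_defect:
  fixes a b c :: real
  assumes "0 \<le> c" "c \<le> a + b"
  shows "(a - b)\<^sup>2 \<le> 2 * a\<^sup>2 + 2 * b\<^sup>2 - c\<^sup>2"
proof -
  have "c\<^sup>2 \<le> (a + b)\<^sup>2" using assms by (intro power_mono)
  then show ?thesis by (simp add: power2_eq_square algebra_simps)
qed

lemma tendsto_of_square_diff:
  fixes a :: real
  assumes "(\<lambda>k. (a - b k)\<^sup>2) \<longlonglongrightarrow> 0"
  shows "b \<longlonglongrightarrow> a"
proof -
  have "(\<lambda>k. sqrt ((a - b k)\<^sup>2)) \<longlonglongrightarrow> sqrt 0" by (intro tendsto_intros assms)
  then have "(\<lambda>k. a - b k) \<longlonglongrightarrow> 0" by (simp add: tendsto_rabs_zero_iff)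
  from tendsto_diff[OF tendsto_const[of a] this] show ?thesis by simp
qed

definition moment :: "((('a::real_normed_vector \<Rightarrow>\<^sub>L real) \<Rightarrow> real) \<Rightarrow> real) \<Rightarrow> 'a \<Rightarrow>\<^sub>L real" where
  "moment \<nu> = Blinfun (\<lambda>x. \<nu> (\<lambda>k. blinfun_apply k x))"

text \<open>The test families \<G> stay abstract here. Suprema over continuous functions with values
  in \<open>[0,1]\<close> make the \<open>q i\<close> lower semicontinuous and sublinear, and the
  constant \<open>1\<close> in \<open>\<G> 0\<close> lets the penalty control the mass, which gives
  compactness of sublevel sets. A trivial choice of \<G> suffices in
  \<open>moments_dense\<close>.\<close>

locale lur_setup =
  fixes L :: "('a::real_normed_vector \<Rightarrow>\<^sub>L real) set"
    and \<G> :: "nat \<Rightarrow> (('a \<Rightarrow>\<^sub>L real) \<Rightarrow> real) set"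
  assumes L_compact: "compactin weak_star_topology L" and L_ball: "L \<subseteq> cball 0 1"
    and G0: "\<G> 0 = {\<lambda>x. 1}"
    and G_nonempty: "\<And>i. \<G> i \<noteq> {}"
    and G_cont: "\<And>i g. g \<in> \<G> i \<Longrightarrow> continuous_map (subtopology weak_star_topology L) euclideanreal g"
    and G_range: "\<And>i g x. g \<in> \<G> i \<Longrightarrow> x \<in> L \<Longrightarrow> 0 \<le> g x \<and> g x \<le> 1"
begin

abbreviation "T \<equiv> subtopology weak_star_topology L"
abbreviation "P \<equiv> pos_functionals T"

lemma T_compact: "compact_space T" using L_compact by (simp add: compact_space_subtopology)
lemma T_Hausdorff: "Hausdorff_space T" by (rule Hausdorff_space_subtopology[OF Hausdorff_weak_star])

lemma functional: "\<nu> \<in> P \<Longrightarrow> positive_functional T \<nu>" by (simp add: pos_functionals_def)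

lemma eval_cont: "continuous_map T euclideanreal (\<lambda>k. blinfun_apply k x)"
  by (rule continuous_map_from_subtopology[OF continuous_map_weak_star_eval])

lemma eval_le: "k \<in> L \<Longrightarrow> \<bar>blinfun_apply k x\<bar> \<le> norm x"
proof -
  assume "k \<in> L"
  then have "norm k * norm x \<le> 1 * norm x" using L_ball by (intro mult_right_mono) auto
  then show ?thesis using norm_blinfun[of k x] by simp
qed

lemma moment_bound:
  assumes "\<nu> \<in> P"
  shows "\<bar>\<nu> (\<lambda>k. blinfun_apply k x)\<bar> \<le> \<nu> (\<lambda>x. 1) * norm x"
proof -
  interpret positive_functional T \<nu> by (rule functional[OF assms])
  have b: "- norm x \<le> blinfun_apply k x" "blinfun_apply k x \<le> norm x" if "k \<in> topspace T" for k
    using eval_le[of k x] that by auto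
  have "\<nu> (\<lambda>k. - norm x) \<le> \<nu> (\<lambda>k. blinfun_apply k x)"
    by (rule mono) (use eval_cont b in auto)
  moreover have "\<nu> (\<lambda>k. blinfun_apply k x) \<le> \<nu> (\<lambda>k. norm x)"
    by (rule mono) (use eval_cont b in auto)
  ultimately show ?thesis using const[of "norm x"] const[of "- norm x"] by (simp add: mult.commute)
qed

lemma moment_apply:
  assumes "\<nu> \<in> P"
  shows "blinfun_apply (moment \<nu>) x = \<nu> (\<lambda>k. blinfun_apply k x)"
proof -
  interpret positive_functional T \<nu> by (rule functional[OF assms])
  have "bounded_linear (\<lambda>x. \<nu> (\<lambda>k. blinfun_apply k x))"
    by (rule bounded_linear_intro[where K = "\<nu> (\<lambda>x. 1)"])
      (use add[OF eval_cont eval_cont] scale[OF eval_cont] moment_bound[OF assms] in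
        \<open>simp_all add: blinfun.add_right blinfun.scaleR_right mult.commute\<close>)
  then show ?thesis unfolding moment_def by (simp add: bounded_linear_Blinfun_apply)
qed

lemma moment_add:
  assumes "\<nu> \<in> P" "\<nu>' \<in> P"
  shows "moment (\<lambda>g. \<nu> g + \<nu>' g) = moment \<nu> + moment \<nu>'"
  by (rule blinfun_eqI)
    (simp add: moment_apply assms pos_functionals_add blinfun.add_left)

lemma moment_scale:
  assumes "\<nu> \<in> P" "t \<ge> 0"
  shows "moment (\<lambda>g. t * \<nu> g) = t *\<^sub>R moment \<nu>"
  by (rule blinfun_eqI)
    (simp add: moment_apply assms pos_functionals_scale blinfun.scaleR_left)

lemma zero_P: "(\<lambda>g. 0) \<in> P" by (rule pos_functionals_zero[OF T_compact T_Hausdorff])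

lemma moment_zero: "moment (\<lambda>g. 0) = (0 :: 'a \<Rightarrow>\<^sub>L real)"
  by (rule blinfun_eqI) (simp add: moment_apply[OF zero_P])

section \<open>Sublinear functions of positive functionals and their weighted sum of squares\<close>

definition q :: "nat \<Rightarrow> ((('a \<Rightarrow>\<^sub>L real) \<Rightarrow> real) \<Rightarrow> real) \<Rightarrow> real" where
  "q i \<nu> = (SUP g\<in>\<G> i. \<nu> g)"

lemma G_functional:
  assumes "\<nu> \<in> P" "g \<in> \<G> i"
  shows "0 \<le> \<nu> g" "\<nu> g \<le> \<nu> (\<lambda>x. 1)"
proof -
  interpret positive_functional T \<nu> by (rule functional[OF assms(1)])
  show "0 \<le> \<nu> g" by (rule nonneg) (use G_cont G_range assms in auto)
  show "\<nu> g \<le> \<nu> (\<lambda>x. 1)" by (rule mono) (use G_cont G_range assms in auto)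
qed

lemma q_bdd: "\<nu> \<in> P \<Longrightarrow> bdd_above (\<nu> ` \<G> i)"
  by (rule bdd_aboveI[of _ "\<nu> (\<lambda>x. 1)"]) (auto intro: G_functional)

lemma q_upper: "\<nu> \<in> P \<Longrightarrow> g \<in> \<G> i \<Longrightarrow> \<nu> g \<le> q i \<nu>"
  unfolding q_def by (rule cSUP_upper[OF _ q_bdd])

lemma q_least: "(\<And>g. g \<in> \<G> i \<Longrightarrow> \<nu> g \<le> c) \<Longrightarrow> q i \<nu> \<le> c"
  unfolding q_def using G_nonempty by (intro cSUP_least) auto

lemma q_nonneg: "\<nu> \<in> P \<Longrightarrow> 0 \<le> q i \<nu>"
  using G_nonempty[of i] G_functional(1) q_upper by (meson all_not_in_conv order_trans)

lemma q_le: "\<nu> \<in> P \<Longrightarrow> q i \<nu> \<le> \<nu> (\<lambda>x. 1)"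
  by (rule q_least) (rule G_functional)

lemma q_0: "q 0 \<nu> = \<nu> (\<lambda>x. 1)" by (simp add: q_def G0)

lemma q_add: "\<nu> \<in> P \<Longrightarrow> \<nu>' \<in> P \<Longrightarrow> q i (\<lambda>g. \<nu> g + \<nu>' g) \<le> q i \<nu> + q i \<nu>'"
  by (rule q_least) (intro add_mono q_upper)

lemma q_scale_le: "\<nu> \<in> P \<Longrightarrow> t \<ge> 0 \<Longrightarrow> q i (\<lambda>g. t * \<nu> g) \<le> t * q i \<nu>"
  by (rule q_least) (intro mult_left_mono q_upper)

definition penalty :: "((('a \<Rightarrow>\<^sub>L real) \<Rightarrow> real) \<Rightarrow> real) \<Rightarrow> real" where
  "penalty \<nu> = (\<Sum>i. (1/2)^i * (q i \<nu>)\<^sup>2)"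

lemma q_square_le: "\<nu> \<in> P \<Longrightarrow> (q i \<nu>)\<^sup>2 \<le> (\<nu> (\<lambda>x. 1))\<^sup>2"
  by (rule power_mono[OF q_le q_nonneg])

lemma penalty_summable: "\<nu> \<in> P \<Longrightarrow> summable (\<lambda>i. (1/2)^i * (q i \<nu>)\<^sup>2)"
proof (rule summable_comparison_test)
  assume "\<nu> \<in> P"
  then show "\<exists>N. \<forall>i\<ge>N. norm ((1/2)^i * (q i \<nu>)\<^sup>2) \<le> (1/2)^i * (\<nu> (\<lambda>x. 1))\<^sup>2"
    using q_square_le by (intro exI[of _ 0]) (auto simp: abs_mult intro!: mult_left_mono)
  show "summable (\<lambda>i. (1/2)^i * (\<nu> (\<lambda>x. 1))\<^sup>2)"
    by (intro summable_mult2 summable_geometric) simp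
qed

lemma penalty_mass: "\<nu> \<in> P \<Longrightarrow> (\<nu> (\<lambda>x. 1))\<^sup>2 \<le> penalty \<nu>"
  using sum_le_suminf[OF penalty_summable, of \<nu> "{0}"] unfolding penalty_def by (simp add: q_0)

lemma penalty_nonneg: "\<nu> \<in> P \<Longrightarrow> 0 \<le> penalty \<nu>"
  using penalty_mass[of \<nu>] by (meson order_trans zero_le_power2)

text \<open>
  This form of convexity passes to sums and infima, and the choice \<open>r = b / a\<close> turns it into the triangle
  inequality for the square root.
\<close>

lemma penalty_young:
  assumes "\<nu> \<in> P" "\<nu>' \<in> P" "r > 0"
  shows "penalty (\<lambda>g. \<nu> g + \<nu>' g) \<le> (1 + r) * penalty \<nu> + (1 + 1 / r) * penalty \<nu>'"
proof -
  have "penalty (\<lambda>g. \<nu> g + \<nu>' g) \<le>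
      (\<Sum>i. (1 + r) * ((1/2)^i * (q i \<nu>)\<^sup>2) + (1 + 1 / r) * ((1/2)^i * (q i \<nu>')\<^sup>2))"
    unfolding penalty_def
  proof (intro suminf_le summable_add summable_mult penalty_summable pos_functionals_add assms(1,2))
    fix i
    have "(q i (\<lambda>g. \<nu> g + \<nu>' g))\<^sup>2 \<le> (q i \<nu> + q i \<nu>')\<^sup>2"
      using assms by (intro power_mono q_add q_nonneg pos_functionals_add)
    also have "\<dots> \<le> (1 + r) * (q i \<nu>)\<^sup>2 + (1 + 1 / r) * (q i \<nu>')\<^sup>2" by (rule young_square[OF assms(3)])
    finally have "(1/2)^i * (q i (\<lambda>g. \<nu> g + \<nu>' g))\<^sup>2 \<le> (1/2)^i * ((1 + r) * (q i \<nu>)\<^sup>2 + (1 + 1 / r) * (q i \<nu>')\<^sup>2)"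
      by (intro mult_left_mono) auto
    then show "(1/2)^i * (q i (\<lambda>g. \<nu> g + \<nu>' g))\<^sup>2 \<le>
        (1 + r) * ((1/2)^i * (q i \<nu>)\<^sup>2) + (1 + 1 / r) * ((1/2)^i * (q i \<nu>')\<^sup>2)"
      by (simp only: distrib_left mult.left_commute)
  qed
  also have "\<dots> = (1 + r) * penalty \<nu> + (1 + 1 / r) * penalty \<nu>'"
    unfolding penalty_def
    by (simp only: suminf_add[symmetric] summable_mult penalty_summable assms(1,2) suminf_mult)
  finally show ?thesis .
qed

lemma penalty_scale_le:
  assumes "\<nu> \<in> P" "t \<ge> 0"
  shows "penalty (\<lambda>g. t * \<nu> g) \<le> t\<^sup>2 * penalty \<nu>"
proof -
  have "penalty (\<lambda>g. t * \<nu> g) \<le> (\<Sum>i. t\<^sup>2 * ((1/2)^i * (q i \<nu>)\<^sup>2))"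
    unfolding penalty_def
  proof (intro suminf_le summable_mult penalty_summable pos_functionals_scale assms)
    fix i
    have "(q i (\<lambda>g. t * \<nu> g))\<^sup>2 \<le> (t * q i \<nu>)\<^sup>2"
      using assms by (intro power_mono q_scale_le q_nonneg pos_functionals_scale)
    then have "(1/2)^i * (q i (\<lambda>g. t * \<nu> g))\<^sup>2 \<le> (1/2)^i * (t * q i \<nu>)\<^sup>2"
      by (intro mult_left_mono) auto
    then show "(1/2)^i * (q i (\<lambda>g. t * \<nu> g))\<^sup>2 \<le> t\<^sup>2 * ((1/2)^i * (q i \<nu>)\<^sup>2)"
      by (simp only: power_mult_distrib mult.left_commute)
  qed
  then show ?thesis unfolding penalty_def by (simp only: suminf_mult penalty_summable assms(1))
qed

section \<open>The infimum: attainment, semicontinuity, convexity and defects\<close>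

definition cost :: "real \<Rightarrow> ('a \<Rightarrow>\<^sub>L real) \<Rightarrow> ((('a \<Rightarrow>\<^sub>L real) \<Rightarrow> real) \<Rightarrow> real) \<Rightarrow> real" where
  "cost c f \<nu> = (norm (f - moment \<nu>))\<^sup>2 + c * penalty \<nu>"

definition \<Omega> :: "real \<Rightarrow> ('a \<Rightarrow>\<^sub>L real) \<Rightarrow> real" where
  "\<Omega> c f = (INF \<nu>\<in>P. cost c f \<nu>)"

lemma cost_nonneg: "c > 0 \<Longrightarrow> \<nu> \<in> P \<Longrightarrow> 0 \<le> cost c f \<nu>"
  unfolding cost_def by (intro add_nonneg_nonneg mult_nonneg_nonneg penalty_nonneg) auto

lemma \<Omega>_le: "c > 0 \<Longrightarrow> \<nu> \<in> P \<Longrightarrow> \<Omega> c f \<le> cost c f \<nu>"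
  unfolding \<Omega>_def using cost_nonneg by (intro cINF_lower bdd_belowI[of _ 0]) auto

lemma \<Omega>_greatest: "(\<And>\<nu>. \<nu> \<in> P \<Longrightarrow> b \<le> cost c f \<nu>) \<Longrightarrow> b \<le> \<Omega> c f"
  unfolding \<Omega>_def using zero_P by (intro cINF_greatest) auto

lemma \<Omega>_nonneg: "c > 0 \<Longrightarrow> 0 \<le> \<Omega> c f"
  by (rule \<Omega>_greatest) (rule cost_nonneg)

lemma \<Omega>_le_norm: "c > 0 \<Longrightarrow> \<Omega> c f \<le> (norm f)\<^sup>2"
proof -
  assume c: "c > 0"
  have "penalty (\<lambda>g. 0) \<le> 0" using penalty_scale_le[OF zero_P, of 0] by simp
  then have "cost c f (\<lambda>g. 0) \<le> (norm f)\<^sup>2"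
    using c by (simp add: cost_def moment_zero mult_le_0_iff)
  then show ?thesis using \<Omega>_le[OF c zero_P, of f] by simp
qed

abbreviation "bounded_P R \<equiv> {\<nu> \<in> P. \<nu> (\<lambda>x. 1) \<le> R}"

text \<open>Semicontinuity is needed jointly in both variables, for the projection in
  \<open>\<Omega>_lsc\<close>. The residual \<open>f - moment \<nu>\<close> depends continuously on
  both for the weak-star topologies, and the norm is weak-star lower semicontinuous.\<close>

lemma cost_lsc:
  assumes "c > 0"
  shows "lsc_on (prod_topology weak_star_topology (top_of_set (bounded_P R))) (\<lambda>(f, \<nu>). cost c f \<nu>)"
proof -
  let ?S = "prod_topology weak_star_topology (top_of_set (bounded_P R))"
  have ev: "continuous_map ?S euclideanreal (\<lambda>y. snd y g)" for g
  proof -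
    have "continuous_map (top_of_set (bounded_P R)) euclideanreal (\<lambda>\<nu>. \<nu> g)"
      using continuous_on_subset[OF continuous_on_product_coordinates[of g]] by simp
    from continuous_map_compose[OF continuous_map_snd this] show ?thesis by (simp add: o_def)
  qed
  have "continuous_map ?S weak_star_topology (\<lambda>y. fst y - moment (snd y))"
  proof (rule continuous_map_to_weak_star)
    fix x
    have "continuous_map ?S euclideanreal (\<lambda>y. blinfun_apply (fst y) x - snd y (\<lambda>k. blinfun_apply k x))"
      by (intro continuous_map_diff ev
        continuous_map_compose[OF continuous_map_fst continuous_map_weak_star_eval, unfolded o_def])
    then show "continuous_map ?S euclideanreal (\<lambda>y. blinfun_apply (fst y - moment (snd y)) x)"
      by (rule continuous_map_eq) (auto simp: blinfun.diff_left moment_apply)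
  qed
  then have l1: "lsc_on ?S (\<lambda>y. (norm (fst y - moment (snd y)))\<^sup>2)"
    by (intro lsc_on_square lsc_on_compose[OF _ lsc_on_weak_star_norm]) auto
  have l2: "lsc_on ?S (\<lambda>y. penalty (snd y))"
    unfolding penalty_def
  proof (intro lsc_on_suminf lsc_on_cmult lsc_on_square)
    fix i
    show "lsc_on ?S (\<lambda>y. q i (snd y))"
      unfolding q_def
      by (intro lsc_on_SUP G_nonempty lsc_on_continuous ev) (auto intro: q_bdd)
  qed (auto intro: q_nonneg penalty_summable)
  show ?thesis
    unfolding cost_def case_prod_unfold
    by (intro lsc_on_add lsc_on_cmult l1 l2) (use assms in auto)
qed

lemma bounded_P_compact: "compact (bounded_P R)"
  by (rule compact_pos_functionals[OF T_compact T_Hausdorff])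

lemma cost_le_bounded:
  assumes c: "c > 0" and \<nu>: "\<nu> \<in> P" and le: "cost c f \<nu> \<le> a"
  shows "\<nu> \<in> bounded_P (sqrt (a / c))"
proof -
  have "c * (\<nu> (\<lambda>x. 1))\<^sup>2 \<le> c * penalty \<nu>" using c by (intro mult_left_mono penalty_mass \<nu>) auto
  also have "\<dots> \<le> a" using le unfolding cost_def by (smt (verit) zero_le_power2)
  finally have "(\<nu> (\<lambda>x. 1))\<^sup>2 \<le> a / c" using c by (simp add: field_simps)
  then have "\<nu> (\<lambda>x. 1) \<le> sqrt (a / c)" by (rule real_le_rsqrt)
  then show ?thesis using \<nu> by simp
qed

lemma \<Omega>_attained:
  assumes c: "c > 0"
  obtains \<nu> where "\<nu> \<in> P" "cost c f \<nu> = \<Omega> c f"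
proof -
  \<comment> \<open>The extra \<open>1\<close> leaves room for every functional whose cost exceeds
    the infimum by less than 1, so minimising over the compact set \<open>bounded_P R\<close> loses
    nothing.\<close>
  define R where "R = sqrt ((\<Omega> c f + 1) / c)"
  have "(\<lambda>g. 0) \<in> bounded_P R" using zero_P \<Omega>_nonneg[OF c, of f] c by (simp add: R_def)
  moreover have "continuous_map (top_of_set (bounded_P R))
      (prod_topology weak_star_topology (top_of_set (bounded_P R))) (\<lambda>\<nu>. (f, \<nu>))"
    by (simp add: continuous_map_pairwise o_def)
  from lsc_on_compose[OF this cost_lsc[OF c, of R]]
  have "lsc_on (top_of_set (bounded_P R)) (cost c f)" by simp
  ultimately obtain \<nu> where \<nu>: "\<nu> \<in> bounded_P R" "\<And>\<nu>'. \<nu>' \<in> bounded_P R \<Longrightarrow> cost c f \<nu> \<le> cost c f \<nu>'"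
    using lsc_on_attains_min[of "top_of_set (bounded_P R)" "cost c f" 0] cost_nonneg[OF c] bounded_P_compact[of R]
    by (auto simp: compact_space_subtopology)
  have "cost c f \<nu> \<le> \<Omega> c f"
  proof (rule field_le_epsilon)
    fix e :: real assume e: "e > 0"
    have "\<exists>\<nu>'\<in>P. cost c f \<nu>' < \<Omega> c f + min e 1"
    proof (rule ccontr)
      assume "\<not> ?thesis"
      then have "\<Omega> c f + min e 1 \<le> \<Omega> c f" by (intro \<Omega>_greatest) force
      then show False using e by auto
    qed
    then obtain \<nu>' where \<nu>': "\<nu>' \<in> P" "cost c f \<nu>' < \<Omega> c f + min e 1" by blast
    then have "\<nu>' \<in> bounded_P R" unfolding R_def by (intro cost_le_bounded[OF c, of _ f]) auto
    then show "cost c f \<nu> \<le> \<Omega> c f + e" using \<nu>(2) \<nu>'(2) by fastforce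
  qed
  then show ?thesis using that \<nu>(1) \<Omega>_le[OF c, of \<nu> f] by force
qed

text \<open>Since the infimum is attained, a sublevel set of \<Omega> is the projection of a
  sublevel set of the joint cost; by \<open>cost_le_bounded\<close> the second factor may be taken
  compact, and projection along a compact factor is a closed map.\<close>

lemma \<Omega>_lsc:
  assumes c: "c > 0"
  shows "lsc_on weak_star_topology (\<Omega> c)"
proof (rule lsc_on_closedI)
  fix a
  let ?R = "sqrt (a / c)"
  let ?S = "prod_topology weak_star_topology (top_of_set (bounded_P ?R))"
  have "closedin ?S {y \<in> topspace ?S. (\<lambda>(f, \<nu>). cost c f \<nu>) y \<le> a}"
    by (rule lsc_on_closed[OF cost_lsc[OF c]])
  moreover have "closed_map ?S weak_star_topology fst"
    using bounded_P_compact by (intro closed_map_fst) (simp add: compact_space_subtopology)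
  ultimately have "closedin weak_star_topology (fst ` {y \<in> topspace ?S. (\<lambda>(f, \<nu>). cost c f \<nu>) y \<le> a})"
    unfolding closed_map_def by blast
  moreover have "fst ` {y \<in> topspace ?S. (\<lambda>(f, \<nu>). cost c f \<nu>) y \<le> a} = {f. \<Omega> c f \<le> a}"
  proof safe
    fix f \<nu> assume "(f, \<nu>) \<in> topspace ?S" "cost c f \<nu> \<le> a"
    then show "\<Omega> c (fst (f, \<nu>)) \<le> a" using \<Omega>_le[OF c, of \<nu> f] by auto
  next
    fix f assume "\<Omega> c f \<le> a"
    then obtain \<nu> where "\<nu> \<in> P" "cost c f \<nu> \<le> a" using \<Omega>_attained[OF c] by metis
    moreover from this have "\<nu> \<in> bounded_P ?R" by (rule cost_le_bounded[OF c])
    ultimately show "f \<in> fst ` {y \<in> topspace ?S. (\<lambda>(f, \<nu>). cost c f \<nu>) y \<le> a}"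
      by (intro image_eqI[of _ _ "(f, \<nu>)"]) auto
  qed
  ultimately show "closedin weak_star_topology {f \<in> topspace weak_star_topology. \<Omega> c f \<le> a}" by simp
qed

lemma \<Omega>_young:
  assumes c: "c > 0" and r: "r > 0"
  shows "\<Omega> c (f + g) \<le> (1 + r) * \<Omega> c f + (1 + 1 / r) * \<Omega> c g"
proof -
  obtain \<nu> where \<nu>: "\<nu> \<in> P" "cost c f \<nu> = \<Omega> c f" using \<Omega>_attained[OF c] by metis
  obtain \<nu>' where \<nu>': "\<nu>' \<in> P" "cost c g \<nu>' = \<Omega> c g" using \<Omega>_attained[OF c] by metis
  let ?u = "f - moment \<nu>" and ?v = "g - moment \<nu>'"
  have "\<Omega> c (f + g) \<le> cost c (f + g) (\<lambda>g. \<nu> g + \<nu>' g)"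
    by (intro \<Omega>_le[OF c] pos_functionals_add \<nu>(1) \<nu>'(1))
  also have "\<dots> = (norm (?u + ?v))\<^sup>2 + c * penalty (\<lambda>g. \<nu> g + \<nu>' g)"
    by (simp only: cost_def moment_add[OF \<nu>(1) \<nu>'(1)] add_diff_add)
  also have "\<dots> \<le> ((1 + r) * (norm ?u)\<^sup>2 + (1 + 1 / r) * (norm ?v)\<^sup>2) +
      c * ((1 + r) * penalty \<nu> + (1 + 1 / r) * penalty \<nu>')"
  proof (intro add_mono mult_left_mono penalty_young \<nu>(1) \<nu>'(1) r)
    have "(norm (?u + ?v))\<^sup>2 \<le> (norm ?u + norm ?v)\<^sup>2" by (intro power_mono norm_triangle_ineq) auto
    also have "\<dots> \<le> (1 + r) * (norm ?u)\<^sup>2 + (1 + 1 / r) * (norm ?v)\<^sup>2" by (rule young_square[OF r])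
    finally show "(norm (?u + ?v))\<^sup>2 \<le> (1 + r) * (norm ?u)\<^sup>2 + (1 + 1 / r) * (norm ?v)\<^sup>2" .
  qed (use c in auto)
  also have "\<dots> = (1 + r) * cost c f \<nu> + (1 + 1 / r) * cost c g \<nu>'"
    by (simp add: cost_def algebra_simps)
  finally show ?thesis using \<nu>(2) \<nu>'(2) by simp
qed

lemma \<Omega>_scale_le:
  assumes c: "c > 0" and t: "t \<ge> 0"
  shows "\<Omega> c (t *\<^sub>R f) \<le> t\<^sup>2 * \<Omega> c f"
proof -
  obtain \<nu> where \<nu>: "\<nu> \<in> P" "cost c f \<nu> = \<Omega> c f" using \<Omega>_attained[OF c] by metis
  have "\<Omega> c (t *\<^sub>R f) \<le> cost c (t *\<^sub>R f) (\<lambda>g. t * \<nu> g)"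
    by (intro \<Omega>_le[OF c] pos_functionals_scale \<nu>(1) t)
  also have "\<dots> = t\<^sup>2 * (norm (f - moment \<nu>))\<^sup>2 + c * penalty (\<lambda>g. t * \<nu> g)"
    by (simp add: cost_def moment_scale[OF \<nu>(1) t] power_mult_distrib flip: scaleR_diff_right)
  also have "\<dots> \<le> t\<^sup>2 * (norm (f - moment \<nu>))\<^sup>2 + c * (t\<^sup>2 * penalty \<nu>)"
    using c by (intro add_left_mono mult_left_mono penalty_scale_le \<nu>(1) t) auto
  also have "\<dots> = t\<^sup>2 * cost c f \<nu>" by (simp add: cost_def algebra_simps)
  finally show ?thesis using \<nu>(2) by simp
qed

text \<open>The sum of minimisers for \<open>z\<close> and \<open>s k\<close> competes for
  \<open>z + s k\<close>, so the defect of \<Omega> dominates those of the residual norm and of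
  every \<open>q i\<close>. The latter make the barycentres converge by \<open>determining\<close>.
  Of the residuals one learns only that their norms converge to a number at most
  \<open>sqrt (\<Omega> c z)\<close>, whence twice this root in the conclusion.\<close>

lemma \<Omega>_defect:
  assumes c: "c > 0"
    and determining: "\<And>\<nu> \<nu>s. \<nu> \<in> P \<Longrightarrow> (\<And>k. \<nu>s k \<in> P) \<Longrightarrow> (\<And>i. (\<lambda>k. q i (\<nu>s k)) \<longlonglongrightarrow> q i \<nu>) \<Longrightarrow>
      (\<And>i. (\<lambda>k. q i (\<lambda>g. \<nu> g + \<nu>s k g)) \<longlonglongrightarrow> 2 * q i \<nu>) \<Longrightarrow> (\<lambda>k. moment (\<nu>s k)) \<longlonglongrightarrow> moment \<nu>"
    and lim: "(\<lambda>k. 2 * \<Omega> c z + 2 * \<Omega> c (s k) - \<Omega> c (z + s k)) \<longlonglongrightarrow> 0" and e: "e > 0"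
  shows "\<forall>\<^sub>F k in sequentially. norm (z - s k) < 2 * sqrt (\<Omega> c z) + e"
proof -
  obtain \<nu> where \<nu>: "\<nu> \<in> P" "cost c z \<nu> = \<Omega> c z" using \<Omega>_attained[OF c] by metis
  have "\<exists>M. M \<in> P \<and> cost c (s k) M = \<Omega> c (s k)" for k using \<Omega>_attained[OF c] by metis
  then obtain M where M: "\<And>k. M k \<in> P" "\<And>k. cost c (s k) (M k) = \<Omega> c (s k)" by metis
  define S where "S k = (\<lambda>g. \<nu> g + M k g)" for k
  have S: "S k \<in> P" for k unfolding S_def by (intro pos_functionals_add \<nu>(1) M(1))
  define u where "u = z - moment \<nu>"
  define v where "v k = s k - moment (M k)" for k
  define D where "D k = 2 * \<Omega> c z + 2 * \<Omega> c (s k) - \<Omega> c (z + s k)" for k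
  define d where "d i k = 2 * (q i \<nu>)\<^sup>2 + 2 * (q i (M k))\<^sup>2 - (q i (S k))\<^sup>2" for i k
  have d0: "(q i \<nu> - q i (M k))\<^sup>2 \<le> d i k" for i k
    unfolding d_def using q_add[OF \<nu>(1) M(1), of i k] q_nonneg[OF S, of i k]
    by (intro parallelogram_defect) (auto simp: S_def)
  have dn: "0 \<le> d i k" for i k using order_trans[OF zero_le_power2 d0] .
  have ds: "(\<lambda>i. (1/2)^i * d i k) sums (2 * penalty \<nu> + 2 * penalty (M k) - penalty (S k))" for k
  proof -
    have "(\<lambda>i. 2 * ((1/2)^i * (q i \<nu>)\<^sup>2) + 2 * ((1/2)^i * (q i (M k))\<^sup>2) - (1/2)^i * (q i (S k))\<^sup>2)
      sums (2 * penalty \<nu> + 2 * penalty (M k) - penalty (S k))"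
      unfolding penalty_def
      by (intro sums_diff sums_add sums_mult summable_sums penalty_summable \<nu>(1) M(1) S)
    then show ?thesis by (simp add: d_def algebra_simps)
  qed
  have key: "(norm u - norm (v k))\<^sup>2 + c * (2 * penalty \<nu> + 2 * penalty (M k) - penalty (S k)) \<le> D k" for k
  proof -
    have "\<Omega> c (z + s k) \<le> cost c (z + s k) (S k)" by (rule \<Omega>_le[OF c S])
    also have "\<dots> = (norm (u + v k))\<^sup>2 + c * penalty (S k)"
      unfolding cost_def S_def moment_add[OF \<nu>(1) M(1)] by (simp add: u_def v_def algebra_simps)
    finally have "2 * ((norm u)\<^sup>2 + c * penalty \<nu>) + 2 * ((norm (v k))\<^sup>2 + c * penalty (M k))
        - ((norm (u + v k))\<^sup>2 + c * penalty (S k)) \<le> D k"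
      unfolding D_def \<nu>(2)[symmetric] M(2)[symmetric] by (simp add: cost_def u_def v_def)
    moreover have "(norm u - norm (v k))\<^sup>2 \<le> 2 * (norm u)\<^sup>2 + 2 * (norm (v k))\<^sup>2 - (norm (u + v k))\<^sup>2"
      by (intro parallelogram_defect norm_triangle_ineq) auto
    ultimately show ?thesis by (simp add: algebra_simps)
  qed
  have Dlim: "D \<longlonglongrightarrow> 0" using lim by (simp add: D_def[abs_def])
  have pd: "0 \<le> 2 * penalty \<nu> + 2 * penalty (M k) - penalty (S k)" for k
    using sums_le[OF _ sums_zero ds] dn by simp
  have "(\<lambda>k. (norm u - norm (v k))\<^sup>2) \<longlonglongrightarrow> 0"
  proof (rule tendsto_sandwich[OF _ _ tendsto_const Dlim])
    show "\<forall>\<^sub>F k in sequentially. (norm u - norm (v k))\<^sup>2 \<le> D k"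
      using key pd c by (intro always_eventually allI) (smt (verit) mult_nonneg_nonneg)
  qed auto
  then have vlim: "(\<lambda>k. norm (v k)) \<longlonglongrightarrow> norm u" by (rule tendsto_of_square_diff)
  have dlim: "d i \<longlonglongrightarrow> 0" for i
  proof (rule tendsto_sandwich[OF _ _ tendsto_const])
    \<comment> \<open>The factor \<open>2^i / c\<close> undoes the weights of the
      \<open>i\<close>-th term in the penalty and of the penalty in the cost.\<close>
    have "(\<lambda>k. 2^i * (D k / c)) \<longlonglongrightarrow> 2^i * (0 / c)"
      by (intro tendsto_intros Dlim) (use c in auto)
    then show "(\<lambda>k. 2^i * (D k / c)) \<longlonglongrightarrow> 0" by simp
    show "\<forall>\<^sub>F k in sequentially. d i k \<le> 2^i * (D k / c)"
    proof (intro always_eventually allI)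
      fix k
      have "(1/2)^i * d i k \<le> 2 * penalty \<nu> + 2 * penalty (M k) - penalty (S k)"
        using sum_le_suminf[OF sums_summable[OF ds], of "{i}"] sums_unique[OF ds] dn by simp
      also have "\<dots> \<le> D k / c" using key[of k] c
        by (simp add: field_simps) (smt (verit) zero_le_power2)
      finally show "d i k \<le> 2^i * (D k / c)" by (simp add: field_simps power_one_over)
    qed
  qed (use dn in auto)
  have ql: "(\<lambda>k. q i (M k)) \<longlonglongrightarrow> q i \<nu>" for i
  proof (rule tendsto_of_square_diff, rule tendsto_sandwich[OF _ _ tendsto_const dlim[of i]])
  qed (use d0 in auto)
  have "(\<lambda>k. moment (M k)) \<longlonglongrightarrow> moment \<nu>"
  proof (rule determining[OF \<nu>(1) M(1) ql])
    fix i
    have "(\<lambda>k. 2 * (q i \<nu>)\<^sup>2 + 2 * (q i (M k))\<^sup>2 - d i k) \<longlonglongrightarrow> 2 * (q i \<nu>)\<^sup>2 + 2 * (q i \<nu>)\<^sup>2 - 0"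
      by (intro tendsto_intros ql dlim)
    then have "(\<lambda>k. sqrt ((q i (S k))\<^sup>2)) \<longlonglongrightarrow> sqrt ((2 * q i \<nu>)\<^sup>2)"
      by (intro tendsto_real_sqrt) (simp add: d_def power_mult_distrib)
    then show "(\<lambda>k. q i (\<lambda>g. \<nu> g + M k g)) \<longlonglongrightarrow> 2 * q i \<nu>"
      using q_nonneg[OF \<nu>(1), of i] q_nonneg[OF S, of i] by (simp add: S_def real_sqrt_mult)
  qed
  then have "(\<lambda>k. norm u + norm (v k) + norm (moment (M k) - moment \<nu>)) \<longlonglongrightarrow> norm u + norm u + 0"
    by (intro tendsto_intros vlim) (rule tendsto_norm_zero, rule LIM_zero)
  moreover have "norm u \<le> sqrt (\<Omega> c z)"
    using c penalty_nonneg[OF \<nu>(1)] unfolding \<nu>(2)[symmetric] cost_def u_def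
    by (intro real_le_rsqrt) simp
  ultimately have "\<forall>\<^sub>F k in sequentially. norm u + norm (v k) + norm (moment (M k) - moment \<nu>) < 2 * sqrt (\<Omega> c z) + e"
    using e by (intro order_tendstoD(2)) auto
  then show ?thesis
  proof (rule eventually_mono)
    fix k assume *: "norm u + norm (v k) + norm (moment (M k) - moment \<nu>) < 2 * sqrt (\<Omega> c z) + e"
    have "z - s k = u - v k - (moment (M k) - moment \<nu>)" by (simp add: u_def v_def)
    then have "norm (z - s k) \<le> norm u + norm (v k) + norm (moment (M k) - moment \<nu>)"
      using norm_triangle_ineq4[of "u - v k" "moment (M k) - moment \<nu>"] norm_triangle_ineq4[of u "v k"]
      by simp
    then show "norm (z - s k) < 2 * sqrt (\<Omega> c z) + e" using * by simp
  qed
qed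

end

section \<open>From lower semicontinuous functions to the norm\<close>

lemma (in lur_setup) moment_continuous:
  "continuous_map (top_of_set (bounded_P R)) weak_star_topology moment"
proof (rule continuous_map_to_weak_star)
  fix x :: 'a
  have "continuous_map (top_of_set (bounded_P R)) euclideanreal (\<lambda>\<nu>. \<nu> (\<lambda>k. blinfun_apply k x))"
    using continuous_on_subset[OF continuous_on_product_coordinates] by simp
  then show "continuous_map (top_of_set (bounded_P R)) euclideanreal (\<lambda>\<nu>. blinfun_apply (moment \<nu>) x)"
    by (rule continuous_map_eq) (auto simp: moment_apply)
qed

lemma (in lur_setup) moment_image_compact:
  "compactin weak_star_topology (moment ` bounded_P R)"
  using bounded_P_compact[of R] by (intro image_compactin[OF _ moment_continuous[of R]]) (simp add: compactin_subtopology)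

lemma (in lur_setup) moment_image_convex: "convex (moment ` bounded_P R)"
proof (rule convexI)
  fix f g :: "'a \<Rightarrow>\<^sub>L real" and u v :: real
  assume uv: "0 \<le> u" "0 \<le> v" "u + v = 1" and "f \<in> moment ` bounded_P R" "g \<in> moment ` bounded_P R"
  then obtain \<nu> \<nu>' where \<nu>: "\<nu> \<in> P" "\<nu> (\<lambda>x. 1) \<le> R" "f = moment \<nu>"
    and \<nu>': "\<nu>' \<in> P" "\<nu>' (\<lambda>x. 1) \<le> R" "g = moment \<nu>'" by auto
  let ?M = "\<lambda>g. u * \<nu> g + v * \<nu>' g"
  have "?M \<in> P" by (intro pos_functionals_add pos_functionals_scale \<nu> \<nu>' uv)
  moreover have "?M (\<lambda>x. 1) \<le> R"
    using mult_left_mono[OF \<nu>(2) uv(1)] mult_left_mono[OF \<nu>'(2) uv(2)] uv(3)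
      distrib_right[of u v R] by simp
  moreover have "u *\<^sub>R f + v *\<^sub>R g = moment ?M"
    using \<nu> \<nu>' uv by (simp add: moment_add moment_scale pos_functionals_scale)
  ultimately show "u *\<^sub>R f + v *\<^sub>R g \<in> moment ` bounded_P R" by blast
qed

lemma (in lur_setup) dirac_moment:
  assumes "b \<in> L"
  shows "b \<in> moment ` bounded_P 1"
proof -
  \<comment> \<open>Evaluation at \<open>b\<close>, with the default value 0 that
    \<open>pos_functionals\<close> demands off the continuous functions.\<close>
  let ?d = "\<lambda>g. if continuous_map T euclideanreal g then g b else 0"
  have "positive_functional T ?d"
  proof (rule positive_functional.intro[OF T_compact T_Hausdorff])
    fix g h assume *: "continuous_map T euclideanreal g" "continuous_map T euclideanreal h"
    then have "continuous_map T euclideanreal (\<lambda>x. g x + h x)" by (intro continuous_intros)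
    then show "?d (\<lambda>x. g x + h x) = ?d g + ?d h" using * by simp
  next
    fix c g assume *: "continuous_map T euclideanreal g"
    then have "continuous_map T euclideanreal (\<lambda>x. c * g x)" by (intro continuous_intros)
    then show "?d (\<lambda>x. c * g x) = c * ?d g" using * by simp
  qed (use assms in auto)
  then have d: "?d \<in> P" by (simp add: pos_functionals_def)
  moreover have "moment ?d = b"
    by (rule blinfun_eqI) (simp only: moment_apply[OF d] eval_cont if_True)
  ultimately show ?thesis by (intro image_eqI[of _ _ ?d]) auto
qed

text \<open>If all barycentres stay farther than \<open>e\<close> from \<open>f\<close>, then
  \<open>f\<close> lies outside the convex weak-star compact sum of the barycentres of mass at most
  1 over \<open>L n\<close> and the ball of radius \<open>e\<close>. Separation yields
  \<open>x n\<close>, and these vectors contradict \<open>simons\<close>: as the \<open>L n\<close>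
  increase, the inequality for a fixed \<open>b\<close> persists from some index on.\<close>

lemma moments_dense:
  fixes B :: "('a::banach \<Rightarrow>\<^sub>L real) set" and L :: "nat \<Rightarrow> ('a \<Rightarrow>\<^sub>L real) set"
  assumes B: "is_boundary B" and L: "\<And>n. compactin weak_star_topology (L n)"
    "\<And>m n. m \<le> n \<Longrightarrow> L m \<subseteq> L n" "B = (\<Union>n. L n)"
    and f: "norm f \<le> 1" and e: "e > 0"
  shows "\<exists>n. \<exists>\<nu>\<in>pos_functionals (subtopology weak_star_topology (L n)). norm (f - moment \<nu>) \<le> e"
proof (rule ccontr)
  assume "\<not> ?thesis"
  then have far: "norm (f - moment \<nu>) > e" if "\<nu> \<in> pos_functionals (subtopology weak_star_topology (L n))" for n \<nu>
    using that by (meson not_less)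
  have B1: "B \<subseteq> cball 0 1" using B by (simp add: is_boundary_def)
  have "\<exists>x. norm x \<le> 1 \<and> (\<forall>b\<in>L n. blinfun_apply b x + e \<le> blinfun_apply f x)" for n
  proof -
    have "L n \<subseteq> cball 0 1" using L(3) B1 by blast
    interpret lur_setup "L n" "\<lambda>_. {\<lambda>x. 1}"
      by standard (use L(1) \<open>L n \<subseteq> cball 0 1\<close> in auto)
    define S where "S = moment ` bounded_P 1"
    define D where "D = (\<lambda>(f, g). f + g) ` (S \<times> cball 0 e)"
    have "compactin (prod_topology weak_star_topology weak_star_topology) (S \<times> (cball 0 e :: ('a \<Rightarrow>\<^sub>L real) set))"
      by (simp add: compactin_Times S_def moment_image_compact compactin_weak_star_cball)
    then have "compactin weak_star_topology D"
      unfolding D_def by (rule image_compactin[OF _ continuous_map_blinfun_add])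
    moreover have "convex D"
    proof -
      have "D = (\<Union>x\<in>S. \<Union>y\<in>cball 0 e. {x + y})" unfolding D_def by force
      then show ?thesis using convex_sums[of S "cball 0 e"] moment_image_convex by (simp add: S_def)
    qed
    moreover have "f \<notin> D"
    proof
      assume "f \<in> D"
      then obtain \<nu> v where "\<nu> \<in> P" "v \<in> cball 0 e" "f = moment \<nu> + v" by (auto simp: D_def S_def)
      then show False using far[of \<nu>] by auto
    qed
    ultimately obtain x \<gamma> where x: "\<And>c. c \<in> D \<Longrightarrow> blinfun_apply c x \<le> \<gamma>" "\<gamma> < blinfun_apply f x"
      using separation by blast
    \<comment> \<open>Adding \<open>e\<close> times a functional that norms \<open>x\<close> turns
      separation from the enlarged set into a gap of \<open>e * norm x\<close> above
      \<open>L n\<close>.\<close>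
    obtain b' where b': "b' \<in> B" "blinfun_apply b' x = norm x" using B by (auto simp: is_boundary_def)
    have "e *\<^sub>R b' \<in> cball 0 e" using b' B1 e by (auto simp: mult_left_le)
    then have "b + e *\<^sub>R b' \<in> D" if "b \<in> L n" for b
      using dirac_moment[OF that] unfolding D_def S_def by auto
    then have *: "blinfun_apply b x + e * norm x < blinfun_apply f x" if "b \<in> L n" for b
      using x that b' by (force simp: blinfun.add_left blinfun.scaleR_left)
    \<comment> \<open>Because 0 belongs to \<open>D\<close>, the separating vector takes a positive
      value at \<open>f\<close>, so it can be normalised.\<close>
    have "(\<lambda>g. 0) \<in> bounded_P 1" using zero_P by simp
    then have "moment (\<lambda>g. 0) \<in> S" unfolding S_def by (rule imageI)
    then have "0 \<in> S" by (simp only: moment_zero)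
    then have "(\<lambda>(f, g). f + g) (0, 0) \<in> D" unfolding D_def using e by (intro imageI) auto
    then have "x \<noteq> 0" using x by force
    show ?thesis
    proof (intro exI conjI ballI)
      show "norm (x /\<^sub>R norm x) \<le> 1" using \<open>x \<noteq> 0\<close> by simp
      fix b assume "b \<in> L n"
      then have "inverse (norm x) * (blinfun_apply b x + e * norm x) \<le> inverse (norm x) * blinfun_apply f x"
        using * by (intro mult_left_mono) (auto simp: less_imp_le)
      then show "blinfun_apply b (x /\<^sub>R norm x) + e \<le> blinfun_apply f (x /\<^sub>R norm x)"
        using \<open>x \<noteq> 0\<close> by (simp add: blinfun.scaleR_right distrib_left mult.left_commute[of _ e])
    qed
  qed
  then obtain x where x: "\<And>n. norm (x n) \<le> 1"
    "\<And>n b. b \<in> L n \<Longrightarrow> blinfun_apply b (x n) + e \<le> blinfun_apply f (x n)" by metis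
  show False
  proof (rule simons[OF B f x(1) e])
    fix b assume "b \<in> B"
    then obtain n0 where "b \<in> L n0" using L(3) by auto
    then show "\<exists>n0. \<forall>n\<ge>n0. blinfun_apply b (x n) + e \<le> blinfun_apply f (x n)"
      using L(2) x(2) by blast
  qed
qed

text \<open>With \<nu> fixed, the cost tends to the squared distance between \<open>z\<close> and
  \<open>moment \<nu>\<close> as the factor of the penalty tends to 0.\<close>

lemma (in lur_setup) \<Omega>_small:
  assumes "\<nu> \<in> P" "(norm (z - moment \<nu>))\<^sup>2 < e"
  obtains m :: nat where "\<Omega> (1 / (real m + 1)) z < e"
proof -
  have "(\<lambda>m. (norm (z - moment \<nu>))\<^sup>2 + (1 / (real m + 1)) * penalty \<nu>) \<longlonglongrightarrow> (norm (z - moment \<nu>))\<^sup>2 + 0 * penalty \<nu>"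
    by (intro tendsto_intros) real_asymp
  then have "\<forall>\<^sub>F m in sequentially. (norm (z - moment \<nu>))\<^sup>2 + (1 / (real m + 1)) * penalty \<nu> < e"
    using assms(2) by (intro order_tendstoD(2)) auto
  then obtain m :: nat where "(norm (z - moment \<nu>))\<^sup>2 + (1 / (real m + 1)) * penalty \<nu> < e"
    by (meson eventually_happens sequentially_bot)
  then have "cost (1 / (real m + 1)) z \<nu> < e" by (simp add: cost_def)
  moreover have "\<Omega> (1 / (real m + 1)) z \<le> cost (1 / (real m + 1)) z \<nu>"
    by (rule \<Omega>_le[OF _ assms(1)]) simp
  ultimately show ?thesis by (intro that[of m]) linarith
qed

text \<open>Collects what the functions \<Omega> provide; \<open>\<Psi>_defect\<close> is an LUR
  condition on the whole family. Barycentres of positive functionals need not form a symmetric set,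
  so homogeneity is available for nonnegative factors only, and \<Phi> has to add the reflected
  term.\<close>

locale dual_renorming =
  fixes B :: "('a::banach \<Rightarrow>\<^sub>L real) set" and \<Psi> :: "nat \<Rightarrow> ('a \<Rightarrow>\<^sub>L real) \<Rightarrow> real"
  assumes B: "is_boundary B"
    and \<Psi>_nonneg: "\<And>i f. 0 \<le> \<Psi> i f"
    and \<Psi>_le: "\<And>i f. \<Psi> i f \<le> (norm f)\<^sup>2"
    and \<Psi>_young: "\<And>i r f g. r > 0 \<Longrightarrow> \<Psi> i (f + g) \<le> (1 + r) * \<Psi> i f + (1 + 1 / r) * \<Psi> i g"
    and \<Psi>_scale: "\<And>i t f. t \<ge> 0 \<Longrightarrow> \<Psi> i (t *\<^sub>R f) \<le> t\<^sup>2 * \<Psi> i f"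
    and \<Psi>_lsc: "\<And>i. lsc_on weak_star_topology (\<Psi> i)"
    and \<Psi>_defect: "\<And>z s. (\<And>i. (\<lambda>k. 2 * \<Psi> i z + 2 * \<Psi> i (s k) - \<Psi> i (z + s k)) \<longlonglongrightarrow> 0) \<Longrightarrow> s \<longlonglongrightarrow> z"
begin

section \<open>The square of the new dual norm\<close>

definition \<Phi> :: "nat \<Rightarrow> ('a \<Rightarrow>\<^sub>L real) \<Rightarrow> real" where
  "\<Phi> i f = (1/2)^i * (\<Psi> i f + \<Psi> i (- f))"

definition Q2 :: "('a \<Rightarrow>\<^sub>L real) \<Rightarrow> real" where
  "Q2 f = (norm f)\<^sup>2 + (\<Sum>i. \<Phi> i f)"

definition Q :: "('a \<Rightarrow>\<^sub>L real) \<Rightarrow> real" where "Q f = sqrt (Q2 f)"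

lemma \<Phi>_nonneg: "0 \<le> \<Phi> i f"
  unfolding \<Phi>_def using \<Psi>_nonneg by (intro mult_nonneg_nonneg add_nonneg_nonneg) auto

lemma \<Phi>_le: "\<Phi> i f \<le> (1/2)^i * (2 * (norm f)\<^sup>2)"
  unfolding \<Phi>_def using \<Psi>_le[of i f] \<Psi>_le[of i "- f"] by (intro mult_left_mono) auto

lemma half_sums: "(\<lambda>i. (1/2)^i * c) sums (2 * c :: real)"
  using sums_mult2[OF geometric_sums[of "1/2 :: real"], of c] by simp

lemma \<Phi>_summable: "summable (\<lambda>i. \<Phi> i f)"
proof (rule summable_comparison_test)
  show "\<exists>N. \<forall>i\<ge>N. norm (\<Phi> i f) \<le> (1/2)^i * (2 * (norm f)\<^sup>2)"
    using \<Phi>_le \<Phi>_nonneg by auto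
  show "summable (\<lambda>i. (1/2)^i * (2 * (norm f)\<^sup>2))" using half_sums sums_summable by blast
qed

lemma \<Phi>_young:
  assumes "r > 0"
  shows "\<Phi> i (f + g) \<le> (1 + r) * \<Phi> i f + (1 + 1 / r) * \<Phi> i g"
proof -
  have "\<Psi> i (f + g) + \<Psi> i (- (f + g)) \<le>
      (1 + r) * (\<Psi> i f + \<Psi> i (- f)) + (1 + 1 / r) * (\<Psi> i g + \<Psi> i (- g))"
    using \<Psi>_young[OF assms, of i f g] \<Psi>_young[OF assms, of i "- f" "- g"]
    by (simp add: algebra_simps)
  then have "\<Phi> i (f + g) \<le> (1/2)^i * ((1 + r) * (\<Psi> i f + \<Psi> i (- f)) + (1 + 1 / r) * (\<Psi> i g + \<Psi> i (- g)))"
    unfolding \<Phi>_def by (intro mult_left_mono) auto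
  then show ?thesis unfolding \<Phi>_def by (simp only: distrib_left mult.left_commute)
qed

lemma \<Phi>_scale: "t \<ge> 0 \<Longrightarrow> \<Phi> i (t *\<^sub>R f) \<le> t\<^sup>2 * \<Phi> i f"
proof -
  assume t: "t \<ge> 0"
  have "\<Psi> i (t *\<^sub>R f) + \<Psi> i (- (t *\<^sub>R f)) \<le> t\<^sup>2 * (\<Psi> i f + \<Psi> i (- f))"
    using \<Psi>_scale[OF t, of i f] \<Psi>_scale[OF t, of i "- f"] by (simp add: distrib_left)
  then have "\<Phi> i (t *\<^sub>R f) \<le> (1/2)^i * (t\<^sup>2 * (\<Psi> i f + \<Psi> i (- f)))"
    unfolding \<Phi>_def by (intro mult_left_mono) auto
  then show ?thesis unfolding \<Phi>_def by (simp only: mult.left_commute)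
qed

lemma norm_le_Q2: "(norm f)\<^sup>2 \<le> Q2 f"
  unfolding Q2_def using suminf_nonneg[OF \<Phi>_summable \<Phi>_nonneg] by simp

lemma Q2_nonneg: "0 \<le> Q2 f" using norm_le_Q2[of f] by (meson order_trans zero_le_power2)

text \<open>The weights \<open>(1/2)^i\<close> add up to 2 and every \<Phi> has two terms, hence the
  constant 5 = 1 + 2 * 2.\<close>

lemma Q2_le: "Q2 f \<le> 5 * (norm f)\<^sup>2"
proof -
  have "(\<Sum>i. \<Phi> i f) \<le> (\<Sum>i. (1/2)^i * (2 * (norm f)\<^sup>2))"
    by (intro suminf_le \<Phi>_le \<Phi>_summable sums_summable[OF half_sums])
  also have "\<dots> = 4 * (norm f)\<^sup>2" using sums_unique[OF half_sums, of "2 * (norm f)\<^sup>2"] by simp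
  finally show ?thesis by (simp add: Q2_def)
qed

lemma Q2_young:
  assumes "r > 0"
  shows "Q2 (f + g) \<le> (1 + r) * Q2 f + (1 + 1 / r) * Q2 g"
proof -
  have "(\<Sum>i. \<Phi> i (f + g)) \<le> (\<Sum>i. (1 + r) * \<Phi> i f + (1 + 1 / r) * \<Phi> i g)"
    by (intro suminf_le \<Phi>_young assms summable_add summable_mult \<Phi>_summable)
  also have "\<dots> = (1 + r) * (\<Sum>i. \<Phi> i f) + (1 + 1 / r) * (\<Sum>i. \<Phi> i g)"
    by (simp only: suminf_add[symmetric] summable_mult \<Phi>_summable suminf_mult)
  finally have "(\<Sum>i. \<Phi> i (f + g)) \<le> (1 + r) * (\<Sum>i. \<Phi> i f) + (1 + 1 / r) * (\<Sum>i. \<Phi> i g)" .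
  moreover have "(norm (f + g))\<^sup>2 \<le> (1 + r) * (norm f)\<^sup>2 + (1 + 1 / r) * (norm g)\<^sup>2"
    by (rule order_trans[OF power_mono[OF norm_triangle_ineq] young_square[OF assms]]) simp
  ultimately show ?thesis unfolding Q2_def by (simp add: distrib_left)
qed

lemma Q2_minus: "Q2 (- f) = Q2 f" by (simp add: Q2_def \<Phi>_def add.commute)

lemma Q2_scale_le: "t \<ge> 0 \<Longrightarrow> Q2 (t *\<^sub>R f) \<le> t\<^sup>2 * Q2 f"
proof -
  assume t: "t \<ge> 0"
  have "(\<Sum>i. \<Phi> i (t *\<^sub>R f)) \<le> (\<Sum>i. t\<^sup>2 * \<Phi> i f)"
    by (intro suminf_le \<Phi>_scale t summable_mult \<Phi>_summable)
  also have "\<dots> = t\<^sup>2 * (\<Sum>i. \<Phi> i f)" by (intro suminf_mult \<Phi>_summable)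
  finally show ?thesis by (simp add: Q2_def power_mult_distrib distrib_left)
qed

lemma Q2_scale: "Q2 (t *\<^sub>R f) = t\<^sup>2 * Q2 f"
proof -
  have pos: "Q2 (t *\<^sub>R f) = t\<^sup>2 * Q2 f" if t: "t > 0" for t f
  proof (rule antisym)
    show "Q2 (t *\<^sub>R f) \<le> t\<^sup>2 * Q2 f" using t by (intro Q2_scale_le) auto
    have "Q2 (inverse t *\<^sub>R (t *\<^sub>R f)) \<le> (inverse t)\<^sup>2 * Q2 (t *\<^sub>R f)" using t by (intro Q2_scale_le) auto
    then have "t\<^sup>2 * Q2 f \<le> t\<^sup>2 * ((inverse t)\<^sup>2 * Q2 (t *\<^sub>R f))" using t by (intro mult_left_mono) auto
    also have "\<dots> = Q2 (t *\<^sub>R f)" using t by (simp add: power_inverse)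
    finally show "t\<^sup>2 * Q2 f \<le> Q2 (t *\<^sub>R f)" .
  qed
  consider "t > 0" | "t = 0" | "t < 0" by linarith
  then show ?thesis
  proof cases
    case 1 then show ?thesis by (rule pos)
  next
    case 2 then show ?thesis using Q2_le[of 0] Q2_nonneg[of 0] by simp
  next
    case 3 then show ?thesis using pos[of "- t" f] Q2_minus[of "t *\<^sub>R f"] by simp
  qed
qed

lemma Q_nonneg: "0 \<le> Q f" by (simp add: Q_def Q2_nonneg)
lemma Q_square: "(Q f)\<^sup>2 = Q2 f" by (simp add: Q_def Q2_nonneg)
lemma Q_scale: "Q (t *\<^sub>R f) = \<bar>t\<bar> * Q f" by (simp add: Q_def Q2_scale real_sqrt_mult)
lemma norm_le_Q: "norm f \<le> Q f" unfolding Q_def by (intro real_le_rsqrt norm_le_Q2)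
lemma Q_le: "Q f \<le> 3 * norm f"
  unfolding Q_def using Q2_le[of f] by (intro real_le_lsqrt) (auto simp: power_mult_distrib Q2_nonneg intro: order_trans)

lemma Q_pos: "f \<noteq> 0 \<Longrightarrow> 0 < Q f"
  using norm_le_Q[of f] by (meson less_le_trans zero_less_norm_iff)

lemma Q_zero: "Q 0 = 0" using Q_le[of 0] Q_nonneg[of 0] by simp

lemma Q_triangle: "Q (f + g) \<le> Q f + Q g"
proof (cases "f = 0 \<or> g = 0")
  case True then show ?thesis by (auto simp: Q_zero)
next
  case False
  define a b where "a = Q f" and "b = Q g"
  have ab: "a > 0" "b > 0" using False Q_pos by (auto simp: a_def b_def)
  have "Q2 (f + g) \<le> (1 + b / a) * a\<^sup>2 + (1 + 1 / (b / a)) * b\<^sup>2"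
    using Q2_young[of "b / a" f g] ab by (simp add: a_def b_def Q_square)
  also have "\<dots> = (a + b)\<^sup>2" using ab by (simp add: power2_eq_square field_simps)
  finally have "Q (f + g) \<le> a + b" unfolding Q_def using ab by (intro real_le_lsqrt) (auto simp: Q2_nonneg)
  then show ?thesis by (simp add: a_def b_def)
qed

section \<open>The predual norm, as support function of the unit ball of \<open>Q\<close>\<close>

definition C :: "('a \<Rightarrow>\<^sub>L real) set" where "C = {f. Q f \<le> 1}"

lemma C_ball: "C \<subseteq> cball 0 1"
  unfolding C_def by (auto intro: order_trans[OF norm_le_Q])

lemma C_compact: "compactin weak_star_topology C"
proof -
  have m: "continuous_map weak_star_topology weak_star_topology (\<lambda>f :: 'a \<Rightarrow>\<^sub>L real. - f)"
    by (rule continuous_map_to_weak_star)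
      (simp add: blinfun.minus_left continuous_map_minus continuous_map_weak_star_eval)
  have "lsc_on weak_star_topology Q2"
    unfolding Q2_def
  proof (intro lsc_on_add lsc_on_square[OF lsc_on_weak_star_norm] lsc_on_suminf)
    show "lsc_on weak_star_topology (\<Phi> i)" for i
      unfolding \<Phi>_def by (intro lsc_on_cmult lsc_on_add \<Psi>_lsc lsc_on_compose[OF m]) auto
  qed (auto simp: \<Phi>_nonneg \<Phi>_summable)
  then have "closedin weak_star_topology {f \<in> topspace weak_star_topology. Q2 f \<le> 1}" by (rule lsc_on_closed)
  moreover have "{f \<in> topspace weak_star_topology. Q2 f \<le> 1} = C" by (auto simp: C_def Q_def)
  ultimately show ?thesis using closed_compactin[OF compactin_weak_star_cball C_ball] by simp
qed

lemma C_convex: "convex C"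
proof (rule convexI)
  fix f g :: "'a \<Rightarrow>\<^sub>L real" and u v :: real
  assume *: "f \<in> C" "g \<in> C" "0 \<le> u" "0 \<le> v" "u + v = 1"
  have "Q (u *\<^sub>R f + v *\<^sub>R g) \<le> u * Q f + v * Q g"
    using Q_triangle[of "u *\<^sub>R f" "v *\<^sub>R g"] * by (simp add: Q_scale)
  also have "\<dots> \<le> u * 1 + v * 1" using * by (intro add_mono mult_left_mono) (auto simp: C_def)
  finally show "u *\<^sub>R f + v *\<^sub>R g \<in> C" using * by (simp add: C_def)
qed

definition N :: "'a \<Rightarrow> real" where "N x = (SUP f\<in>C. blinfun_apply f x)"

lemma C_apply_le: "f \<in> C \<Longrightarrow> blinfun_apply f x \<le> norm x"
proof -
  assume "f \<in> C"
  then have "norm f * norm x \<le> 1 * norm x" using C_ball by (intro mult_right_mono) auto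
  then show ?thesis using norm_blinfun[of f x] by simp
qed

lemma N_upper: "f \<in> C \<Longrightarrow> blinfun_apply f x \<le> N x"
  unfolding N_def by (rule cSUP_upper) (auto intro!: bdd_aboveI[of _ "norm x"] C_apply_le)

lemma zero_C: "0 \<in> C" by (simp add: C_def Q_zero)

lemma N_least: "(\<And>f. f \<in> C \<Longrightarrow> blinfun_apply f x \<le> c) \<Longrightarrow> N x \<le> c"
  unfolding N_def using zero_C by (intro cSUP_least) auto

lemma N_nonneg: "0 \<le> N x" using N_upper[OF zero_C, of x] by simp

lemma apply_le_QN: "\<bar>blinfun_apply f x\<bar> \<le> Q f * N x"
proof -
  have "blinfun_apply f x \<le> Q f * N x" for f
  proof (cases "f = 0")
    case True then show ?thesis by (simp add: Q_zero)
  next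
    case False
    then have Qf: "Q f > 0" by (rule Q_pos)
    then have "f /\<^sub>R Q f \<in> C" by (simp add: C_def Q_scale)
    then have "blinfun_apply (f /\<^sub>R Q f) x \<le> N x" by (rule N_upper)
    then show ?thesis using Qf by (simp add: blinfun.scaleR_left field_simps)
  qed
  from this[of f] this[of "- f"] show ?thesis
    using Q_scale[of "-1" f] by (simp add: blinfun.minus_left abs_le_iff)
qed

text \<open>In the role of Hahn-Banach, the boundary supplies a functional of norm at most 1 that
  norms \<open>x\<close>; its \<open>Q\<close> is at most 3.\<close>

lemma N_lower: "norm x / 3 \<le> N x"
proof -
  obtain b where b: "b \<in> B" "blinfun_apply b x = norm x" using B by (auto simp: is_boundary_def)
  have "norm b \<le> 1" using b(1) B by (auto simp: is_boundary_def)
  then have "Q b \<le> 3" using Q_le[of b] by simp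
  then have "Q b * N x \<le> 3 * N x" by (intro mult_right_mono N_nonneg)
  then show ?thesis using apply_le_QN[of b x] b(2) by simp
qed

lemma equivalent_norm_N: "equivalent_norm N"
  unfolding equivalent_norm_def is_norm_def
proof (intro conjI allI)
  fix x y :: 'a and c :: real
  show "0 \<le> N x" by (rule N_nonneg)
  have "N 0 \<le> 0" by (rule N_least) simp
  then show "N x = 0 \<longleftrightarrow> x = 0" using N_lower[of x] N_nonneg[of 0] by auto
  show "N (x + y) \<le> N x + N y"
    by (rule N_least) (auto simp: blinfun.add_right intro!: add_mono N_upper)
  have le: "N (c *\<^sub>R x) \<le> \<bar>c\<bar> * N x" for c x
  proof (rule N_least)
    fix f assume "f \<in> C"
    then have "\<bar>blinfun_apply f x\<bar> \<le> 1 * N x"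
      using apply_le_QN[of f x] mult_right_mono[of "Q f" 1 "N x"] N_nonneg[of x] by (simp add: C_def)
    then have "\<bar>c\<bar> * \<bar>blinfun_apply f x\<bar> \<le> \<bar>c\<bar> * N x" by (intro mult_left_mono) auto
    then show "blinfun_apply f (c *\<^sub>R x) \<le> \<bar>c\<bar> * N x"
      by (simp add: blinfun.scaleR_right flip: abs_mult)
  qed
  show "N (c *\<^sub>R x) = \<bar>c\<bar> * N x"
  proof (cases "c = 0")
    case True then show ?thesis using \<open>N 0 \<le> 0\<close> N_nonneg[of 0] by simp
  next
    case False
    have "N (inverse c *\<^sub>R (c *\<^sub>R x)) \<le> \<bar>inverse c\<bar> * N (c *\<^sub>R x)" by (rule le)
    then have "\<bar>c\<bar> * N x \<le> N (c *\<^sub>R x)" using False by (simp add: field_simps abs_inverse)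
    then show ?thesis using le[of c x] by simp
  qed
next
  show "\<exists>a>0. \<exists>b>0. \<forall>x. a * norm x \<le> N x \<and> N x \<le> b * norm x"
  proof (intro exI conjI allI)
    show "1/3 * norm x \<le> N x" for x using N_lower[of x] by simp
    show "N x \<le> 1 * norm x" for x by (rule N_least) (simp add: C_apply_le)
  qed auto
qed

text \<open>Bipolar argument: for \<open>t\<close> strictly between the dual norm and
  \<open>Q f\<close>, the functional \<open>f /\<^sub>R t\<close> lies outside the convex weak-star
  compact set \<open>C\<close>. A separating vector, normalised for \<open>N\<close>, gives
  \<open>f\<close> a value above \<open>t\<close>.\<close>

lemma dual_norm_N: "dual_norm N f = Q f"
proof (rule antisym)
  have N0: "N 0 \<le> 1" by (rule N_least) simp
  have le: "\<bar>blinfun_apply f x\<bar> \<le> Q f" if "N x \<le> 1" for x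
    using apply_le_QN[of f x] mult_left_mono[OF that Q_nonneg, of f] by simp
  show "dual_norm N f \<le> Q f"
    unfolding dual_norm_def by (rule cSUP_least) (use le N0 in auto)
  have up: "\<bar>blinfun_apply f x\<bar> \<le> dual_norm N f" if "N x \<le> 1" for x
    unfolding dual_norm_def by (rule cSUP_upper) (use le that in \<open>auto intro!: bdd_aboveI[of _ "Q f"]\<close>)
  have d0: "0 \<le> dual_norm N f" using up[OF N0] by simp
  show "Q f \<le> dual_norm N f"
  proof (rule ccontr)
    assume "\<not> Q f \<le> dual_norm N f"
    then obtain t where t: "dual_norm N f < t" "t < Q f" using dense[of "dual_norm N f" "Q f"] by auto
    have t0: "t > 0" using d0 t by simp
    have "f /\<^sub>R t \<notin> C" 
    proof -
      have "Q (f /\<^sub>R t) = Q f / t" using t0 by (simp add: Q_scale divide_inverse mult.commute)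
      also have "\<dots> > 1" using t t0 by simp
      finally show ?thesis by (simp add: C_def)
    qed
    then obtain x \<gamma> where x: "\<And>c. c \<in> C \<Longrightarrow> blinfun_apply c x \<le> \<gamma>" "\<gamma> < blinfun_apply (f /\<^sub>R t) x"
      using separation[OF C_compact C_convex] by blast
    have "N x \<le> \<gamma>" by (rule N_least) (rule x)
    then have Nx: "N x < blinfun_apply f x / t" using x(2) by (simp add: blinfun.scaleR_left field_simps)
    then have "x \<noteq> 0" using N_nonneg[of 0] by auto
    then have N0: "N x > 0" using N_lower[of x] by (meson less_le_trans zero_less_divide_iff zero_less_norm_iff zero_less_numeral)
    have "N (x /\<^sub>R N x) = 1"
      using equivalent_norm_N N0 \<open>x \<noteq> 0\<close> by (simp add: equivalent_norm_def is_norm_def)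
    then have "\<bar>blinfun_apply f (x /\<^sub>R N x)\<bar> \<le> dual_norm N f" by (intro up) simp
    moreover have "blinfun_apply f (x /\<^sub>R N x) > t"
      using Nx t0 N0 by (simp add: blinfun.scaleR_right field_simps)
    ultimately show False using t by simp
  qed
qed

text \<open>The defect of \<open>Q2\<close> tends to 0 and is a sum of nonnegative defects, one from
  the squared norm and one from each \<Phi>. Each of them is therefore squeezed to 0, and
  \<open>\<Psi>_defect\<close> applies.\<close>

lemma LUR_Q: "LUR Q"
  unfolding LUR_def
proof (intro allI impI)
  fix z s assume z: "Q z = 1" and s: "(\<lambda>n. Q (s n)) \<longlonglongrightarrow> 1" and zs: "(\<lambda>n. Q (z + s n)) \<longlonglongrightarrow> 2"
  define D where "D k = 2 * Q2 z + 2 * Q2 (s k) - Q2 (z + s k)" for k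
  have "(\<lambda>k. 2 * (Q z)\<^sup>2 + 2 * (Q (s k))\<^sup>2 - (Q (z + s k))\<^sup>2) \<longlonglongrightarrow> 2 * (Q z)\<^sup>2 + 2 * 1\<^sup>2 - 2\<^sup>2"
    by (intro tendsto_intros s zs)
  moreover have "(\<lambda>k. 2 * (Q z)\<^sup>2 + 2 * (Q (s k))\<^sup>2 - (Q (z + s k))\<^sup>2) = D"
    by (simp only: Q_square D_def[abs_def])
  ultimately have Dlim: "D \<longlonglongrightarrow> 0" using z by simp
  define d where "d i k = 2 * \<Phi> i z + 2 * \<Phi> i (s k) - \<Phi> i (z + s k)" for i k
  \<comment> \<open>Nonnegativity of the defect is the Young inequality with
    \<open>r = 1\<close>.\<close>
  have dn: "0 \<le> d i k" for i k using \<Phi>_young[of 1 i z "s k"] by (simp add: d_def)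
  have ds: "(\<lambda>i. d i k) sums (2 * (\<Sum>i. \<Phi> i z) + 2 * (\<Sum>i. \<Phi> i (s k)) - (\<Sum>i. \<Phi> i (z + s k)))" for k
    unfolding d_def by (intro sums_diff sums_add sums_mult summable_sums \<Phi>_summable)
  have dD: "d i k \<le> D k" for i k
  proof -
    have "d i k \<le> (\<Sum>i. d i k)"
      using sum_le_suminf[OF sums_summable[OF ds], of "{i}"] dn by simp
    also have "\<dots> = 2 * (\<Sum>i. \<Phi> i z) + 2 * (\<Sum>i. \<Phi> i (s k)) - (\<Sum>i. \<Phi> i (z + s k))"
      using sums_unique[OF ds] by simp
    also have "\<dots> \<le> D k"
      using order_trans[OF zero_le_power2 parallelogram_defect[OF norm_ge_zero norm_triangle_ineq[of z "s k"]]]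
      unfolding D_def Q2_def by simp
    finally show ?thesis .
  qed
  have "s \<longlonglongrightarrow> z"
  proof (rule \<Psi>_defect)
    fix i
    show "(\<lambda>k. 2 * \<Psi> i z + 2 * \<Psi> i (s k) - \<Psi> i (z + s k)) \<longlonglongrightarrow> 0"
    proof (rule tendsto_sandwich[OF _ _ tendsto_const])
      show "\<forall>\<^sub>F k in sequentially. 0 \<le> 2 * \<Psi> i z + 2 * \<Psi> i (s k) - \<Psi> i (z + s k)"
        using \<Psi>_young[of 1 i z] by (intro always_eventually allI) simp
      show "\<forall>\<^sub>F k in sequentially. 2 * \<Psi> i z + 2 * \<Psi> i (s k) - \<Psi> i (z + s k) \<le> 2^i * D k"
      proof (intro always_eventually allI)
        fix k
        \<comment> \<open>The defect of the reflected term is nonnegative and may be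
          dropped.\<close>
        have "0 \<le> 2 * \<Psi> i (- z) + 2 * \<Psi> i (- s k) - \<Psi> i (- (z + s k))"
          using \<Psi>_young[of 1 i "- z" "- s k"] by simp
        moreover have "d i k = (1/2)^i * ((2 * \<Psi> i z + 2 * \<Psi> i (s k) - \<Psi> i (z + s k)) +
            (2 * \<Psi> i (- z) + 2 * \<Psi> i (- s k) - \<Psi> i (- (z + s k))))"
          unfolding d_def \<Phi>_def by (simp only: algebra_simps)
        then have "2^i * d i k = (2 * \<Psi> i z + 2 * \<Psi> i (s k) - \<Psi> i (z + s k)) +
            (2 * \<Psi> i (- z) + 2 * \<Psi> i (- s k) - \<Psi> i (- (z + s k)))"
          by (simp only: power_one_over) simp
        ultimately have "2 * \<Psi> i z + 2 * \<Psi> i (s k) - \<Psi> i (z + s k) \<le> 2^i * d i k"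
          by simp
        also have "\<dots> \<le> 2^i * D k" using dD by (intro mult_left_mono) auto
        finally show "2 * \<Psi> i z + 2 * \<Psi> i (s k) - \<Psi> i (z + s k) \<le> 2^i * D k" .
      qed
      show "(\<lambda>k. 2^i * D k) \<longlonglongrightarrow> 0" using tendsto_mult_left[OF Dlim, of "2^i"] by simp
    qed
  qed
  then have "(\<lambda>n. 3 * norm (z - s n)) \<longlonglongrightarrow> 3 * norm (z - z)" by (intro tendsto_intros)
  then have l: "(\<lambda>n. 3 * norm (z - s n)) \<longlonglongrightarrow> 0" by simp
  show "(\<lambda>n. Q (z - s n)) \<longlonglongrightarrow> 0"
    by (rule tendsto_sandwich[OF _ _ tendsto_const l]) (auto simp: Q_le Q_nonneg)
qed

theorem renorming: "\<exists>N :: 'a \<Rightarrow> real. equivalent_norm N \<and> LUR (dual_norm N)"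
proof -
  have "dual_norm N = Q" by (rule ext) (rule dual_norm_N)
  then show ?thesis using equivalent_norm_N LUR_Q by auto
qed

end

section \<open>Layers of cells\<close>

text \<open>Integrate \<open>k - f j\<close> over the piece \<open>D j\<close> and \<open>k\<close>
  itself over the rest of \<open>L\<close>: the integrand has norm at most \<open>e\<close> on the
  pieces, and at most 1 elsewhere because \<open>L\<close> lies in the unit ball.\<close>

lemma (in lur_setup) moment_approx:
  fixes r :: nat
  assumes \<nu>: "\<nu> \<in> P" and D: "\<And>j. j < r \<Longrightarrow> D j \<in> sets (positive_functional.radon_measure T \<nu>)"
    and disj: "disjoint_family_on D {..<r}" and e: "e \<ge> 0"
    and f: "\<And>j k. j < r \<Longrightarrow> k \<in> D j \<Longrightarrow> norm (k - f j) \<le> e"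
  shows "norm (moment \<nu> - (\<Sum>j<r. measure (positive_functional.radon_measure T \<nu>) (D j) *\<^sub>R f j))
    \<le> e * \<nu> (\<lambda>x. 1) + measure (positive_functional.radon_measure T \<nu>) (L - (\<Union>j<r. D j))"
proof -
  interpret positive_functional T \<nu> by (rule functional[OF \<nu>])
  let ?M = "radon_measure"
  have mass: "measure ?M L = \<nu> (\<lambda>x. 1)"
    using measure_radon_open[OF openin_topspace] content_topspace by simp
  have sp: "space ?M = L" by simp
  define E where "E = L - (\<Union>j<r. D j)"
  have E: "E \<in> sets ?M" using sets.top[of ?M] D unfolding E_def sp by (intro sets.Diff sets.finite_UN finite_lessThan) auto
  have fin: "emeasure ?M A < \<infinity>" for A using radon.emeasure_finite[of A] by (simp add: less_top[symmetric])
  have DL: "D j \<subseteq> L" if "j < r" for j using sets.sets_into_space[OF D[OF that]] by simp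
  show ?thesis
  proof (rule norm_blinfun_bound)
    show "0 \<le> e * \<nu> (\<lambda>x. 1) + measure ?M (L - (\<Union>j<r. D j))"
      using e mass_nonneg by simp
    fix x :: 'a
    define \<phi> where "\<phi> k = blinfun_apply k x - (\<Sum>j<r. indicator (D j) k * blinfun_apply (f j) x)" for k
    have i1: "integrable ?M (\<lambda>k. blinfun_apply k x)" by (rule continuous_integrable[OF eval_cont])
    have i2: "integrable ?M (\<lambda>k. indicator (D j) k * blinfun_apply (f j) x)" if "j < r" for j
      by (intro integrable_mult_left integrable_real_indicator D fin that)
    have i3: "integrable ?M (\<lambda>k. \<Sum>j<r. indicator (D j) k * blinfun_apply (f j) x)"
      by (intro Bochner_Integration.integrable_sum i2) auto
    have "integral\<^sup>L ?M \<phi> = \<nu> (\<lambda>k. blinfun_apply k x) - (\<Sum>j<r. measure ?M (D j) * blinfun_apply (f j) x)"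
    proof -
      have "integral\<^sup>L ?M \<phi> = integral\<^sup>L ?M (\<lambda>k. blinfun_apply k x) -
          integral\<^sup>L ?M (\<lambda>k. \<Sum>j<r. indicator (D j) k * blinfun_apply (f j) x)"
        unfolding \<phi>_def by (rule Bochner_Integration.integral_diff[OF i1 i3])
      also have "integral\<^sup>L ?M (\<lambda>k. \<Sum>j<r. indicator (D j) k * blinfun_apply (f j) x) =
          (\<Sum>j<r. integral\<^sup>L ?M (\<lambda>k. indicator (D j) k * blinfun_apply (f j) x))"
        by (intro Bochner_Integration.integral_sum i2) auto
      also have "\<dots> = (\<Sum>j<r. measure ?M (D j) * blinfun_apply (f j) x)"
        using DL by (intro sum.cong refl) (simp add: sp Int_absorb2)
      finally show ?thesis by (simp add: integral_radon[OF eval_cont])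
    qed
    moreover have "norm (integral\<^sup>L ?M \<phi>) \<le> integral\<^sup>L ?M (\<lambda>k. norm x * (e + indicator E k))"
    proof (rule order_trans[OF integral_norm_bound integral_mono])
      show "integrable ?M (\<lambda>k. norm (\<phi> k))"
        unfolding \<phi>_def by (intro integrable_norm Bochner_Integration.integrable_diff i1 i3)
      show "integrable ?M (\<lambda>k. norm x * (e + indicator E k))"
        by (intro integrable_mult_right Bochner_Integration.integrable_add integrable_real_indicator E fin) simp
      fix k assume "k \<in> space ?M"
      then have kL: "k \<in> L" by simp
      show "norm (\<phi> k) \<le> norm x * (e + indicator E k)"
      proof (cases "k \<in> E")
        case True
        then have "\<phi> k = blinfun_apply k x" unfolding \<phi>_def E_def by (auto intro!: sum.neutral)
        then have "norm (\<phi> k) \<le> norm x" using eval_le[OF kL, of x] by simp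
        also have "\<dots> \<le> norm x * (e + 1)" using e by (simp add: distrib_left)
        finally show ?thesis using True by simp
      next
        case False
        then obtain i where i: "i < r" "k \<in> D i" using kL by (auto simp: E_def)
        have "(\<Sum>j<r. indicator (D j) k * blinfun_apply (f j) x) = (\<Sum>j\<in>{i}. indicator (D j) k * blinfun_apply (f j) x)"
          using disj i by (intro sum.mono_neutral_right) (auto simp: disjoint_family_on_def indicator_def)
        then have "\<phi> k = blinfun_apply (k - f i) x" using i by (simp add: \<phi>_def blinfun.diff_left)
        then have "norm (\<phi> k) \<le> norm (k - f i) * norm x" using norm_blinfun[of "k - f i" x] by simp
        also have "\<dots> \<le> e * norm x" by (intro mult_right_mono f i) auto
        finally show ?thesis using False by (simp add: mult.commute)
      qed
    qed
    moreover have "integral\<^sup>L ?M (\<lambda>k. norm x * (e + indicator E k)) = norm x * (e * \<nu> (\<lambda>x. 1) + measure ?M E)"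
    proof -
      have "E \<inter> L = E" by (auto simp: E_def)
      then show ?thesis
        using integrable_real_indicator[OF E fin] by (simp add: Bochner_Integration.integral_add sp mass mult.commute)
    qed
    ultimately have le: "norm (integral\<^sup>L ?M \<phi>) \<le> norm x * (e * \<nu> (\<lambda>x. 1) + measure ?M E)"
      and eq: "blinfun_apply (moment \<nu> - (\<Sum>j<r. measure ?M (D j) *\<^sub>R f j)) x = integral\<^sup>L ?M \<phi>"
      by (simp_all only: blinfun.diff_left blinfun.sum_left blinfun.scaleR_left moment_apply[OF \<nu>] real_scaleR_def)
    show "norm (blinfun_apply (moment \<nu> - (\<Sum>j<r. measure ?M (D j) *\<^sub>R f j)) x)
        \<le> (e * \<nu> (\<lambda>x. 1) + measure ?M (L - (\<Union>j<r. D j))) * norm x"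
      unfolding eq E_def[symmetric] using le by (simp only: mult.commute)
  qed
qed

text \<open>An open part together with a disjoint, possibly uncountable family of cells. A cell need
  not be open, but it is the difference of the open sets \<open>A \<union> fst p\<close> and
  \<open>fst p\<close>, hence measurable for all the Radon measures.\<close>

definition layer :: "'b topology \<Rightarrow> 'b set \<times> 'b set set \<Rightarrow> bool" where
  "layer T p \<longleftrightarrow> openin T (fst p) \<and> disjoint (snd p) \<and>
     (\<forall>A\<in>snd p. A \<inter> fst p = {} \<and> openin T (A \<union> fst p))"

text \<open>The open part collects the points that belong to both layers and to at least one open
  part. It absorbs everything in \<open>(A \<union> G) \<inter> (A' \<union> G')\<close> except
  \<open>A \<inter> A'\<close>, where \<open>G\<close> and \<open>G'\<close> are the open parts; so
  \<open>A \<inter> A'\<close> becomes open after adding it.\<close>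

definition layer_meet :: "'b set \<times> 'b set set \<Rightarrow> 'b set \<times> 'b set set \<Rightarrow> 'b set \<times> 'b set set" where
  "layer_meet p p' = ((fst p \<inter> (fst p' \<union> \<Union>(snd p'))) \<union> ((fst p \<union> \<Union>(snd p)) \<inter> fst p'),
     {A \<inter> A' |A A'. A \<in> snd p \<and> A' \<in> snd p'})"

lemma layer_Union_open:
  assumes "layer T p" "F \<subseteq> snd p"
  shows "openin T (fst p \<union> \<Union>F)"
proof -
  have "fst p \<union> \<Union>F = \<Union>(insert (fst p) ((\<lambda>A. A \<union> fst p) ` F))" by auto
  moreover have "openin T (\<Union>(insert (fst p) ((\<lambda>A. A \<union> fst p) ` F)))"
    using assms by (intro openin_Union) (auto simp: layer_def)
  ultimately show ?thesis by simp
qed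

lemma layer_layer_meet:
  assumes p: "layer T p" and p': "layer T p'"
  shows "layer T (layer_meet p p')"
proof -
  obtain G \<O> G' \<O>' where pp: "p = (G, \<O>)" "p' = (G', \<O>')" by (metis prod.exhaust)
  let ?H = "(G \<inter> (G' \<union> \<Union>\<O>')) \<union> ((G \<union> \<Union>\<O>) \<inter> G')"
  have o: "openin T G" "openin T G'" "openin T (G \<union> \<Union>\<O>)" "openin T (G' \<union> \<Union>\<O>')"
    using p p' layer_Union_open[OF p, of \<O>] layer_Union_open[OF p', of \<O>'] by (auto simp: pp layer_def)
  have H: "openin T ?H" by (rule openin_Un[OF openin_Int[OF o(1,4)] openin_Int[OF o(3,2)]])
  show ?thesis
    unfolding layer_def
  proof (intro conjI ballI)
    show "openin T (fst (layer_meet p p'))" using H by (simp add: layer_meet_def pp)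
    show "disjoint (snd (layer_meet p p'))"
      unfolding disjoint_def
    proof (intro ballI impI)
      fix B B' assume B: "B \<in> snd (layer_meet p p')" "B' \<in> snd (layer_meet p p')" "B \<noteq> B'"
      obtain A1 A2 A1' A2' where A: "B = A1 \<inter> A2" "B' = A1' \<inter> A2'" "A1 \<in> \<O>" "A2 \<in> \<O>'" "A1' \<in> \<O>" "A2' \<in> \<O>'"
        using B(1,2) by (auto simp: layer_meet_def pp)
      have "A1 \<noteq> A1' \<or> A2 \<noteq> A2'" using B(3) A by auto
      then have "A1 \<inter> A1' = {} \<or> A2 \<inter> A2' = {}"
        using p p' A unfolding layer_def disjoint_def pp by (metis fst_conv snd_conv)
      then show "B \<inter> B' = {}" using A by auto
    qed
    fix B assume "B \<in> snd (layer_meet p p')"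
    then obtain A A' where A: "B = A \<inter> A'" "A \<in> \<O>" "A' \<in> \<O>'" by (auto simp: layer_meet_def pp)
    have d: "A \<inter> G = {}" "A' \<inter> G' = {}" "openin T (A \<union> G)" "openin T (A' \<union> G')"
      using p p' A by (auto simp: layer_def pp)
    then show "B \<inter> fst (layer_meet p p') = {}" using A by (auto simp: layer_meet_def pp)
    have "B \<union> ?H = ((A \<union> G) \<inter> (A' \<union> G')) \<union> ?H" using A by auto
    moreover have "openin T (((A \<union> G) \<inter> (A' \<union> G')) \<union> ?H)" by (intro openin_Un openin_Int d o)
    ultimately show "openin T (B \<union> fst (layer_meet p p'))" by (simp add: layer_meet_def pp)
  qed
qed

text \<open>The condition \<open>cover\<close> is the link to the norm. Layers with cells of every
  size are listed in one sequence, so each \<open>e\<close> selects its own set \<open>J\<close> of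
  indices.\<close>

locale layered =
  fixes L :: "('a::real_normed_vector \<Rightarrow>\<^sub>L real) set"
    and \<l> :: "nat \<Rightarrow> ('a \<Rightarrow>\<^sub>L real) set \<times> ('a \<Rightarrow>\<^sub>L real) set set"
  assumes compact_L: "compactin weak_star_topology L" and ball_L: "L \<subseteq> cball 0 1"
    and base_layer: "\<And>t. layer (subtopology weak_star_topology L) (\<l> t)"
    and cover: "\<And>e. e > 0 \<Longrightarrow> \<exists>J. L \<subseteq> (\<Union>t\<in>J. \<Union>(snd (\<l> t))) \<and>
      (\<forall>t\<in>J. \<forall>A\<in>snd (\<l> t). \<forall>f\<in>A. \<forall>g\<in>A. norm (f - g) \<le> e)"
begin

abbreviation "TL \<equiv> subtopology weak_star_topology L"

text \<open>Lists of indices keep the finite meets countable, and intersecting cells corresponds to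
  concatenating lists.\<close>

primrec lay :: "nat list \<Rightarrow> ('a \<Rightarrow>\<^sub>L real) set \<times> ('a \<Rightarrow>\<^sub>L real) set set" where
  "lay [] = ({}, {L})"
| "lay (t # ts) = layer_meet (\<l> t) (lay ts)"

lemma layer_lay: "layer TL (lay ts)"
proof (induction ts)
  case Nil
  have "openin TL L" using openin_topspace[of TL] by simp
  then show ?case by (simp add: layer_def disjoint_def)
qed (simp add: layer_layer_meet base_layer)

lemma lay_sub: "A \<in> snd (lay ts) \<Longrightarrow> A \<subseteq> L"
  using layer_lay[of ts] openin_subset[of TL "A \<union> fst (lay ts)"] by (auto simp: layer_def)

definition cells :: "('a \<Rightarrow>\<^sub>L real) set set" where "cells = (\<Union>ts. snd (lay ts))"

lemma cells_Int:
  assumes "A \<in> cells" "A' \<in> cells"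
  shows "A \<inter> A' \<in> cells"
proof -
  obtain ts ts' where A: "A \<in> snd (lay ts)" "A' \<in> snd (lay ts')" using assms by (auto simp: cells_def)
  have "A \<inter> A' \<in> snd (lay (ts @ ts'))"
    using A(1)
  proof (induction ts arbitrary: A)
    case Nil
    then show ?case using lay_sub[OF A(2)] A(2) by (simp add: Int_absorb1)
  next
    case (Cons t ts)
    then obtain B C where BC: "A = B \<inter> C" "B \<in> snd (\<l> t)" "C \<in> snd (lay ts)" by (auto simp: layer_meet_def)
    then have "C \<inter> A' \<in> snd (lay (ts @ ts'))" using Cons.IH by blast
    then show ?case using BC by (auto simp: layer_meet_def Int_assoc)
  qed
  then show ?thesis by (auto simp: cells_def)
qed

lemma L_cell: "L \<in> cells"
proof -
  have "L \<in> snd (lay [])" by simp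
  then show ?thesis unfolding cells_def by blast
qed

lemma base_cells: "A \<in> snd (\<l> t) \<Longrightarrow> A \<in> cells"
proof -
  assume A: "A \<in> snd (\<l> t)"
  have "A \<subseteq> L" using base_layer[of t] A openin_subset[of TL "A \<union> fst (\<l> t)"] by (auto simp: layer_def)
  then have "A \<in> snd (lay [t])" using A by (force simp: layer_meet_def)
  then show ?thesis unfolding cells_def by blast
qed

text \<open>Nonnegative, finitely supported vectors in the unit ball of l2. By duality the supremum
  of the weighted sums of the cell masses is their l2 norm.\<close>

definition weights :: "('a \<Rightarrow>\<^sub>L real) set \<times> ('a \<Rightarrow>\<^sub>L real) set set \<Rightarrow>
    (('a \<Rightarrow>\<^sub>L real) set set \<times> (('a \<Rightarrow>\<^sub>L real) set \<Rightarrow> real)) set" where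
  "weights p = {(F, w). finite F \<and> F \<subseteq> snd p \<and> (\<forall>A. 0 \<le> w A) \<and> L2_set w F \<le> 1}"

definition step :: "('a \<Rightarrow>\<^sub>L real) set \<times> ('a \<Rightarrow>\<^sub>L real) set set \<Rightarrow> ('a \<Rightarrow>\<^sub>L real) set set \<Rightarrow>
    (('a \<Rightarrow>\<^sub>L real) set \<Rightarrow> real) \<Rightarrow> ('a \<Rightarrow>\<^sub>L real) \<Rightarrow> real" where
  "step p F w x = indicator (fst p) x + (\<Sum>A\<in>F. w A * indicator A x)"

text \<open>
  Index \<open>0\<close> gives the total mass; the others run over the finite meets of layers, with \<open>True\<close> giving
  the mass of the open part and \<open>False\<close> that mass plus the \<open>\<ell>\<^sub>2\<close> norm of the masses of the cells. The
  open part must be added in the latter for \<open>step\<close> to be lower semicontinuous.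
\<close>

fun \<G> :: "nat \<Rightarrow> (('a \<Rightarrow>\<^sub>L real) \<Rightarrow> real) set" where
  "\<G> 0 = {\<lambda>x. 1}"
| "\<G> (Suc i) = (let (b, ts) = from_nat i :: bool \<times> nat list in
     if b then {g. continuous_map TL euclideanreal g \<and>
       (\<forall>x\<in>topspace TL. 0 \<le> g x \<and> g x \<le> 1 \<and> (x \<notin> fst (lay ts) \<longrightarrow> g x = 0))}
     else {g. continuous_map TL euclideanreal g \<and>
       (\<exists>(F, w)\<in>weights (lay ts). \<forall>x\<in>topspace TL. 0 \<le> g x \<and> g x \<le> step (lay ts) F w x)})"

lemma step_eq:
  assumes p: "layer TL p" and Fw: "(F, w) \<in> weights p"
  shows "x \<in> fst p \<Longrightarrow> step p F w x = 1"
    and "x \<notin> fst p \<Longrightarrow> x \<notin> \<Union>F \<Longrightarrow> step p F w x = 0"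
    and "A \<in> F \<Longrightarrow> x \<in> A \<Longrightarrow> step p F w x = w A"
    and "A \<in> F \<Longrightarrow> w A \<le> 1"
proof -
  have F: "finite F" "F \<subseteq> snd p" and w: "\<And>A. 0 \<le> w A" "L2_set w F \<le> 1"
    using Fw by (auto simp: weights_def)
  have dj: "A \<inter> fst p = {}" if "A \<in> F" for A using p F that by (auto simp: layer_def)
  have dd: "A \<inter> B = {}" if "A \<in> F" "B \<in> F" "A \<noteq> B" for A B
    using p F that unfolding layer_def disjoint_def by blast
  show "step p F w x = 1" if "x \<in> fst p"
  proof -
    have "(\<Sum>A\<in>F. w A * indicator A x) = 0" using dj that by (intro sum.neutral) (auto simp: indicator_def)
    then show ?thesis using that by (simp add: step_def)
  qed
  show "step p F w x = 0" if "x \<notin> fst p" "x \<notin> \<Union>F"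
  proof -
    have "(\<Sum>A\<in>F. w A * indicator A x) = 0" using that by (intro sum.neutral) (auto simp: indicator_def)
    then show ?thesis using that by (simp add: step_def)
  qed
  show "step p F w x = w A" if A: "A \<in> F" "x \<in> A"
  proof -
    have "(\<Sum>B\<in>F. w B * indicator B x) = (\<Sum>B\<in>{A}. w B * indicator B x)"
      using dd[of A] A F by (intro sum.mono_neutral_right) (auto simp: indicator_def)
    moreover have "x \<notin> fst p" using dj[OF A(1)] A by auto
    ultimately show ?thesis using A by (simp add: step_def)
  qed
  show "w A \<le> 1" if "A \<in> F"
    using member_le_L2_set[OF F(1) that, of w] w by auto
qed

lemma step_range:
  assumes "layer TL p" "(F, w) \<in> weights p"
  shows "0 \<le> step p F w x" "step p F w x \<le> 1"
proof -
  have w: "0 \<le> w A" for A using assms by (auto simp: weights_def)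
  consider "x \<in> fst p" | "x \<notin> fst p" "x \<notin> \<Union>F" | A where "A \<in> F" "x \<in> A" by auto
  then show "0 \<le> step p F w x" "step p F w x \<le> 1"
    using step_eq[OF assms] w by (cases; force)+
qed

text \<open>For \<open>0 \<le> t < 1\<close> the superlevel set is the open part together with the
  cells of weight above \<open>t\<close>, open by \<open>layer_Union_open\<close>. No weight exceeds
  1, the value on the open part, so no nonempty superlevel set misses that part.\<close>

lemma step_lsc:
  assumes p: "layer TL p" and Fw: "(F, w) \<in> weights p"
  shows "openin TL {x \<in> topspace TL. step p F w x > t}"
proof -
  have w: "0 \<le> w A" for A using Fw by (auto simp: weights_def)
  have FL: "A \<subseteq> L" if "A \<in> F" for A
    using p that Fw openin_subset[of TL "A \<union> fst p"] by (auto simp: layer_def weights_def)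
  have pL: "fst p \<subseteq> L" using p openin_subset[of TL "fst p"] by (auto simp: layer_def)
  consider "t < 0" | "t \<ge> 1" | "0 \<le> t" "t < 1" by linarith
  then show ?thesis
  proof cases
    case 1
    then have "{x \<in> topspace TL. step p F w x > t} = topspace TL"
      using step_range(1)[OF assms] by (auto intro: less_le_trans)
    then show ?thesis by (simp only: openin_topspace)
  next
    case 2
    then have "{x \<in> topspace TL. step p F w x > t} = {}"
      using step_range(2)[OF assms] by (auto simp: not_less intro: order_trans)
    then show ?thesis by (simp only: openin_empty)
  next
    case 3
    have "{x \<in> topspace TL. step p F w x > t} = fst p \<union> \<Union>{A \<in> F. t < w A}" (is "?l = ?r")
    proof (rule set_eqI)
      fix x
      consider "x \<in> fst p" | "x \<notin> fst p" "x \<notin> \<Union>F" | A where "A \<in> F" "x \<in> A" "x \<notin> fst p" by auto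
      then show "x \<in> ?l \<longleftrightarrow> x \<in> ?r"
      proof cases
        case 1 then show ?thesis using step_eq(1)[OF assms] pL 3 by auto
      next
        case 2 then show ?thesis using step_eq(2)[OF assms] 3 by auto
      next
        case (3 A)
        have xL: "x \<in> L" using FL[OF 3(1)] 3(2) by auto
        have u: "w B = w A" if "B \<in> F" "x \<in> B" for B
          using step_eq(3)[OF assms that] step_eq(3)[OF assms 3(1,2)] by simp
        have "x \<in> ?l \<longleftrightarrow> t < w A" using xL step_eq(3)[OF assms 3(1,2)] by simp
        moreover have "x \<in> ?r \<longleftrightarrow> (\<exists>B\<in>F. t < w B \<and> x \<in> B)" using 3(3) by blast
        moreover have "\<dots> \<longleftrightarrow> t < w A" using u 3(1,2) by metis
        ultimately show ?thesis by blast
      qed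
    qed
    moreover have "{A \<in> F. t < w A} \<subseteq> snd p" using Fw by (auto simp: weights_def)
    ultimately show ?thesis using layer_Union_open[OF p] by simp
  qed
qed

lemma zero_weights: "({}, \<lambda>A. 0) \<in> weights p" by (simp add: weights_def)

sublocale lur_setup L \<G>
proof
  fix i
  show "\<G> i \<noteq> {}"
  proof (cases i)
    case (Suc j)
    obtain b ts where b: "(from_nat j :: bool \<times> nat list) = (b, ts)" by fastforce
    have "(\<lambda>x. 0) \<in> \<G> i"
      using zero_weights[of "lay ts"] by (auto simp: Suc b step_def intro!: bexI[of _ "({}, \<lambda>A. 0)"])
    then show ?thesis by auto
  qed simp
  fix g assume g: "g \<in> \<G> i"
  show "continuous_map TL euclideanreal g"
    using g by (cases i) (auto split: prod.splits if_splits)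
  fix x assume x: "x \<in> L"
  show "0 \<le> g x \<and> g x \<le> 1"
  proof (cases i)
    case 0 then show ?thesis using g by simp
  next
    case (Suc j)
    obtain b ts where b: "(from_nat j :: bool \<times> nat list) = (b, ts)" by fastforce
    show ?thesis
    proof (cases b)
      case True then show ?thesis using g x by (simp add: Suc b)
    next
      case False
      then obtain F w where Fw: "(F, w) \<in> weights (lay ts)" "\<forall>x\<in>L. 0 \<le> g x \<and> g x \<le> step (lay ts) F w x"
        using g by (auto simp: Suc b)
      then show ?thesis using step_range(2)[OF layer_lay Fw(1), of x] x by (meson order_trans)
    qed
  qed
qed (use compact_L ball_L in auto)

section \<open>Convergence of the masses of cells and of the barycentres\<close>

abbreviation \<mu> where "\<mu> \<nu> \<equiv> positive_functional.radon_measure T \<nu>"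

lemma finite_mu: "\<nu> \<in> P \<Longrightarrow> finite_measure (\<mu> \<nu>)"
proof -
  assume "\<nu> \<in> P"
  then interpret positive_functional T \<nu> by (rule functional)
  show ?thesis by (rule radon.finite_measure_axioms)
qed

lemma space_mu: "\<nu> \<in> P \<Longrightarrow> space (\<mu> \<nu>) = L"
  using positive_functional.space_radon[OF functional] by simp

lemma open_sets_mu: "\<nu> \<in> P \<Longrightarrow> openin T U \<Longrightarrow> U \<in> sets (\<mu> \<nu>)"
  using positive_functional.open_sets_radon[OF functional] by simp

lemma layer_sets_mu:
  assumes "\<nu> \<in> P" "layer T p" "A \<in> snd p"
  shows "A \<in> sets (\<mu> \<nu>)"
proof -
  have "A = (A \<union> fst p) - fst p" using assms(2,3) by (auto simp: layer_def)
  moreover have "(A \<union> fst p) - fst p \<in> sets (\<mu> \<nu>)"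
    using assms by (intro sets.Diff open_sets_mu) (auto simp: layer_def)
  ultimately show ?thesis by simp
qed

lemma cell_sets_mu: "\<nu> \<in> P \<Longrightarrow> A \<in> cells \<Longrightarrow> A \<in> sets (\<mu> \<nu>)"
  using layer_sets_mu[OF _ layer_lay] by (auto simp: cells_def)

lemma mu_mass: "\<nu> \<in> P \<Longrightarrow> measure (\<mu> \<nu>) L = \<nu> (\<lambda>x. 1)"
proof -
  assume "\<nu> \<in> P"
  then interpret positive_functional T \<nu> by (rule functional)
  show ?thesis using measure_radon_open[OF openin_topspace] content_topspace by simp
qed

lemma integral_step:
  assumes \<nu>: "\<nu> \<in> P" and p: "layer T p" and Fw: "(F, w) \<in> weights p"
  shows "integrable (\<mu> \<nu>) (step p F w)"
    and "integral\<^sup>L (\<mu> \<nu>) (step p F w) = measure (\<mu> \<nu>) (fst p) + (\<Sum>A\<in>F. w A * measure (\<mu> \<nu>) A)"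
proof -
  interpret finite_measure "\<mu> \<nu>" by (rule finite_mu[OF \<nu>])
  have fin: "emeasure (\<mu> \<nu>) A < \<infinity>" for A using emeasure_finite[of A] by (simp add: less_top[symmetric])
  have S: "A \<in> sets (\<mu> \<nu>)" if "A \<in> F" for A
    using layer_sets_mu[OF \<nu> p] that Fw by (auto simp: weights_def)
  have G: "fst p \<in> sets (\<mu> \<nu>)" using open_sets_mu[OF \<nu>] p by (auto simp: layer_def)
  have sub: "A \<inter> L = A" if "A \<in> sets (\<mu> \<nu>)" for A
    using sets.sets_into_space[OF that] space_mu[OF \<nu>] by auto
  have i1: "integrable (\<mu> \<nu>) (indicator (fst p) :: _ \<Rightarrow> real)"
    by (intro integrable_real_indicator G fin)
  have i2: "integrable (\<mu> \<nu>) (\<lambda>x. w A * indicator A x)" if "A \<in> F" for A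
    by (intro integrable_mult_right integrable_real_indicator S fin that)
  have i3: "integrable (\<mu> \<nu>) (\<lambda>x. \<Sum>A\<in>F. w A * indicator A x)"
    by (intro Bochner_Integration.integrable_sum i2)
  show "integrable (\<mu> \<nu>) (step p F w)"
    unfolding step_def[abs_def] by (intro Bochner_Integration.integrable_add i1 i3)
  have "integral\<^sup>L (\<mu> \<nu>) (step p F w) = integral\<^sup>L (\<mu> \<nu>) (indicator (fst p)) + integral\<^sup>L (\<mu> \<nu>) (\<lambda>x. \<Sum>A\<in>F. w A * indicator A x)"
    unfolding step_def[abs_def] by (rule Bochner_Integration.integral_add[OF i1 i3])
  also have "integral\<^sup>L (\<mu> \<nu>) (\<lambda>x. \<Sum>A\<in>F. w A * indicator A x) = (\<Sum>A\<in>F. integral\<^sup>L (\<mu> \<nu>) (\<lambda>x. w A * indicator A x))"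
    by (intro Bochner_Integration.integral_sum i2)
  also have "\<dots> = (\<Sum>A\<in>F. w A * measure (\<mu> \<nu>) A)"
    by (intro sum.cong refl) (simp add: space_mu[OF \<nu>] sub[OF S])
  finally show "integral\<^sup>L (\<mu> \<nu>) (step p F w) = measure (\<mu> \<nu>) (fst p) + (\<Sum>A\<in>F. w A * measure (\<mu> \<nu>) A)"
    by (simp add: space_mu[OF \<nu>] sub[OF G])
qed

lemma q_open:
  assumes \<nu>: "\<nu> \<in> P" and i: "from_nat i = (True, ts)"
  shows "q (Suc i) \<nu> = measure (\<mu> \<nu>) (fst (lay ts))"
proof -
  interpret positive_functional T \<nu> by (rule functional[OF \<nu>])
  have "\<G> (Suc i) = below (fst (lay ts))" by (simp add: i below_def)
  then have "q (Suc i) \<nu> = content (fst (lay ts))" by (simp only: q_def content_def)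
  also have "\<dots> = measure (\<mu> \<nu>) (fst (lay ts))"
    using layer_lay[of ts] by (intro measure_radon_open[symmetric]) (simp add: layer_def)
  finally show ?thesis .
qed

text \<open>The pair \<open>(F, w)\<close> depends on \<open>g\<close> alone: in
  \<open>cell_limit\<close> the same pair has to serve for \<nu> and for
  \<open>\<nu>s k\<close>.\<close>

lemma q_cells_upper:
  assumes i: "from_nat i = (False, ts)" and g: "g \<in> \<G> (Suc i)"
  obtains F w where "(F, w) \<in> weights (lay ts)"
    "\<And>\<nu>. \<nu> \<in> P \<Longrightarrow> \<nu> g \<le> measure (\<mu> \<nu>) (fst (lay ts)) + (\<Sum>A\<in>F. w A * measure (\<mu> \<nu>) A)"
proof -
  obtain F w where Fw: "(F, w) \<in> weights (lay ts)" "\<And>x. x \<in> L \<Longrightarrow> g x \<le> step (lay ts) F w x"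
    using g by (auto simp: i)
  have "\<nu> g \<le> measure (\<mu> \<nu>) (fst (lay ts)) + (\<Sum>A\<in>F. w A * measure (\<mu> \<nu>) A)" if \<nu>: "\<nu> \<in> P" for \<nu>
  proof -
    interpret positive_functional T \<nu> by (rule functional[OF \<nu>])
    have gc: "continuous_map T euclideanreal g" by (rule G_cont[OF g])
    have "\<nu> g = integral\<^sup>L (\<mu> \<nu>) g" by (rule integral_radon[OF gc, symmetric])
    also have "\<dots> \<le> integral\<^sup>L (\<mu> \<nu>) (step (lay ts) F w)"
      using Fw(2) by (intro integral_mono continuous_integrable[OF gc] integral_step(1)[OF \<nu> layer_lay Fw(1)])
        (simp add: space_mu[OF \<nu>])
    finally show ?thesis by (simp add: integral_step(2)[OF \<nu> layer_lay Fw(1)])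
  qed
  then show ?thesis using that Fw(1) by blast
qed

text \<open>The integral of the semicontinuous function \<open>step\<close> is approximated from
  below by continuous functions, which are admissible in \<G>.\<close>

lemma q_cells_lower:
  assumes \<nu>: "\<nu> \<in> P" and i: "from_nat i = (False, ts)" and Fw: "(F, w) \<in> weights (lay ts)"
  shows "measure (\<mu> \<nu>) (fst (lay ts)) + (\<Sum>A\<in>F. w A * measure (\<mu> \<nu>) A) \<le> q (Suc i) \<nu>"
proof (rule field_le_epsilon)
  fix e :: real assume e: "e > 0"
  interpret positive_functional T \<nu> by (rule functional[OF \<nu>])
  obtain g where g: "continuous_map T euclideanreal g"
    "\<And>x. x \<in> topspace T \<Longrightarrow> 0 \<le> g x \<and> g x \<le> step (lay ts) F w x"
    "integral\<^sup>L radon_measure (step (lay ts) F w) - e \<le> \<nu> g"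
    using lsc_integral_le[of "step (lay ts) F w" e] step_range[OF layer_lay Fw] step_lsc[OF layer_lay Fw] e
    by auto
  have "g \<in> \<G> (Suc i)" using g(1,2) Fw by (auto simp: i intro!: bexI[of _ "(F, w)"])
  then have "\<nu> g \<le> q (Suc i) \<nu>" by (rule q_upper[OF \<nu>])
  then show "measure (\<mu> \<nu>) (fst (lay ts)) + (\<Sum>A\<in>F. w A * measure (\<mu> \<nu>) A) \<le> q (Suc i) \<nu> + e"
    using g(3) by (simp add: integral_step(2)[OF \<nu> layer_lay Fw])
qed

lemma L2_set_square: "(L2_set f A)\<^sup>2 = (\<Sum>x\<in>A. (f x)\<^sup>2)"
  unfolding L2_set_def by (intro real_sqrt_pow2 sum_nonneg) auto

text \<open>Weights proportional to the masses themselves give equality in Cauchy-Schwarz. The bound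
  does not depend on the finite set \<open>F\<close>.\<close>

lemma cells_L2_le:
  assumes \<nu>: "\<nu> \<in> P" and i: "from_nat i = (False, ts)" and F: "finite F" "F \<subseteq> snd (lay ts)"
  shows "L2_set (\<lambda>A. measure (\<mu> \<nu>) A) F \<le> q (Suc i) \<nu> - measure (\<mu> \<nu>) (fst (lay ts))"
proof -
  let ?v = "\<lambda>A. measure (\<mu> \<nu>) A"
  define s where "s = L2_set ?v F"
  show ?thesis
  proof (cases "s = 0")
    case True
    then show ?thesis using q_cells_lower[OF \<nu> i zero_weights] by (simp add: s_def)
  next
    case False
    then have s: "s > 0" using L2_set_nonneg[of ?v F] unfolding s_def by linarith
    have sq: "(\<Sum>A\<in>F. (?v A)\<^sup>2) = s\<^sup>2" by (simp add: s_def L2_set_square)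
    have "(L2_set (\<lambda>A. ?v A / s) F)\<^sup>2 = 1"
      using s by (simp add: L2_set_square power_divide sq flip: sum_divide_distrib)
    then have "L2_set (\<lambda>A. ?v A / s) F = 1" 
      by (intro power2_eq_imp_eq[of _ 1]) simp_all
    then have "(F, \<lambda>A. ?v A / s) \<in> weights (lay ts)" using F s by (simp add: weights_def)
    from q_cells_lower[OF \<nu> i this]
    have "measure (\<mu> \<nu>) (fst (lay ts)) + (\<Sum>A\<in>F. (?v A)\<^sup>2 / s) \<le> q (Suc i) \<nu>"
      by (simp add: power2_eq_square)
    moreover have "(\<Sum>A\<in>F. (?v A)\<^sup>2 / s) = s"
      unfolding sum_divide_distrib[symmetric] sq using s by (simp add: power2_eq_square)
    ultimately show ?thesis by (simp add: s_def)
  qed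
qed

text \<open>This is the LUR property of l2. After subtracting the open masses, which converge by
  \<open>q_open\<close>, \<open>a\<close> and \<open>b k\<close> bound the l2 norms of the cell
  masses of \<nu> and \<open>\<nu>s k\<close>, while \<open>c k\<close> bounds the norm of their sum
  from below on some finite set of cells. As \<open>b\<close> tends to \<open>a\<close> and
  \<open>c\<close> to \<open>2 * a\<close>, the parallelogram identity sends the differences to
  0.\<close>

lemma cell_limit:
  assumes \<nu>: "\<nu> \<in> P" and \<nu>s: "\<And>k. \<nu>s k \<in> P"
    and q1: "\<And>i. (\<lambda>k. q i (\<nu>s k)) \<longlonglongrightarrow> q i \<nu>"
    and q2: "\<And>i. (\<lambda>k. q i (\<lambda>g. \<nu> g + \<nu>s k g)) \<longlonglongrightarrow> 2 * q i \<nu>"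
    and A: "A \<in> snd (lay ts)"
  shows "(\<lambda>k. measure (\<mu> (\<nu>s k)) A) \<longlonglongrightarrow> measure (\<mu> \<nu>) A"
proof -
  define i where "i = to_nat (False, ts)"
  define i' where "i' = to_nat (True, ts)"
  have i: "from_nat i = (False, ts)" "from_nat i' = (True, ts)" by (simp_all add: i_def i'_def)
  let ?G = "fst (lay ts)"
  define v where "v B = measure (\<mu> \<nu>) B" for B
  define u where "u k B = measure (\<mu> (\<nu>s k)) B" for k B
  define S where "S k = (\<lambda>g. \<nu> g + \<nu>s k g)" for k
  have S: "S k \<in> P" for k unfolding S_def by (intro pos_functionals_add \<nu> \<nu>s)
  have G: "(\<lambda>k. u k ?G) \<longlonglongrightarrow> v ?G"
    using q1[of "Suc i'"] by (simp only: q_open[OF \<nu> i(2)] q_open[OF \<nu>s i(2)] u_def v_def)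
  define a where "a = q (Suc i) \<nu> - v ?G"
  define b where "b k = q (Suc i) (\<nu>s k) - u k ?G" for k
  \<comment> \<open>The term \<open>1 / (real k + 1)\<close> is the slack for a supremum that need
    not be attained; the maximum with 0 permits squaring.\<close>
  define c where "c k = max (q (Suc i) (S k) - v ?G - u k ?G - 1 / (real k + 1)) 0" for k
  have a0: "0 \<le> a" using cells_L2_le[OF \<nu> i(1), of "{}"] by (simp add: a_def v_def)
  have blim: "b \<longlonglongrightarrow> a" unfolding b_def[abs_def] a_def by (intro tendsto_diff q1 G)
  have "c \<longlonglongrightarrow> max (2 * q (Suc i) \<nu> - v ?G - v ?G - 0) 0"
    unfolding c_def[abs_def] S_def by (intro tendsto_max tendsto_diff q2 G tendsto_const) real_asymp
  then have clim: "c \<longlonglongrightarrow> 2 * a" using a0 by (simp add: a_def)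
  have key: "(v A - u k A)\<^sup>2 \<le> 2 * a\<^sup>2 + 2 * (b k)\<^sup>2 - (c k)\<^sup>2" for k
  proof -
    have "q (Suc i) (S k) - 1 / (real k + 1) < (SUP g\<in>\<G> (Suc i). S k g)"
      by (simp add: q_def[symmetric] del: \<G>.simps)
    then obtain g where g: "g \<in> \<G> (Suc i)" "q (Suc i) (S k) - 1 / (real k + 1) < S k g"
      using less_cSUP_iff[OF G_nonempty q_bdd[OF S]] by (metis (no_types, lifting))
    obtain F w where Fw: "(F, w) \<in> weights (lay ts)"
      "\<And>\<nu>. \<nu> \<in> P \<Longrightarrow> \<nu> g \<le> measure (\<mu> \<nu>) ?G + (\<Sum>A\<in>F. w A * measure (\<mu> \<nu>) A)"
      using q_cells_upper[OF i(1) g(1)] by blast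
    have F: "finite F" "F \<subseteq> snd (lay ts)" and w: "\<And>A. 0 \<le> w A" "L2_set w F \<le> 1"
      using Fw(1) by (auto simp: weights_def)
    have vu: "0 \<le> v B" "0 \<le> u k B" for B by (simp_all add: v_def u_def)
    have "S k g \<le> v ?G + u k ?G + (\<Sum>A\<in>F. w A * (v A + u k A))"
      using Fw(2)[OF \<nu>] Fw(2)[OF \<nu>s, of k] by (simp add: S_def v_def u_def distrib_left sum.distrib)
    also have "(\<Sum>A\<in>F. w A * (v A + u k A)) = (\<Sum>A\<in>F. \<bar>w A\<bar> * \<bar>v A + u k A\<bar>)"
      using w(1) vu by (intro sum.cong) auto
    also have "\<dots> \<le> L2_set w F * L2_set (\<lambda>A. v A + u k A) F" by (rule L2_set_mult_ineq)
    also have "\<dots> \<le> 1 * L2_set (\<lambda>A. v A + u k A) F" by (intro mult_right_mono w L2_set_nonneg)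
    \<comment> \<open>The given cell \<open>A\<close> may be missing from \<open>F\<close>;
      inserting it only enlarges the norm and puts its difference into the parallelogram identity
      below.\<close>
    also have "\<dots> \<le> L2_set (\<lambda>A. v A + u k A) (insert A F)"
      using F by (simp add: L2_set_def, intro sum_mono2) auto
    finally have "c k \<le> L2_set (\<lambda>A. v A + u k A) (insert A F)"
      using g(2) L2_set_nonneg[of "\<lambda>A. v A + u k A" "insert A F"] by (simp add: c_def)
    then have "(c k)\<^sup>2 \<le> (L2_set (\<lambda>A. v A + u k A) (insert A F))\<^sup>2" by (intro power_mono) (auto simp: c_def)
    then have 1: "(c k)\<^sup>2 \<le> (\<Sum>B\<in>insert A F. (v B + u k B)\<^sup>2)" by (simp only: L2_set_square)
    have F': "finite (insert A F)" "insert A F \<subseteq> snd (lay ts)" using F A by auto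
    have "(L2_set v (insert A F))\<^sup>2 \<le> a\<^sup>2"
      using cells_L2_le[OF \<nu> i(1) F'] by (intro power_mono L2_set_nonneg) (simp add: a_def v_def[abs_def])
    then have 2: "(\<Sum>B\<in>insert A F. (v B)\<^sup>2) \<le> a\<^sup>2" by (simp only: L2_set_square)
    have "(L2_set (u k) (insert A F))\<^sup>2 \<le> (b k)\<^sup>2"
      using cells_L2_le[OF \<nu>s i(1) F', of k] by (intro power_mono L2_set_nonneg) (simp add: b_def u_def[abs_def])
    then have 3: "(\<Sum>B\<in>insert A F. (u k B)\<^sup>2) \<le> (b k)\<^sup>2" by (simp only: L2_set_square)
    have "(v A - u k A)\<^sup>2 \<le> (\<Sum>B\<in>insert A F. (v B - u k B)\<^sup>2)"
      by (rule member_le_sum[OF _ _ F'(1)]) auto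
    also have "\<dots> = (\<Sum>B\<in>insert A F. 2 * (v B)\<^sup>2 + 2 * (u k B)\<^sup>2 - (v B + u k B)\<^sup>2)"
      by (intro sum.cong refl) (simp add: power2_eq_square algebra_simps)
    also have "\<dots> = 2 * (\<Sum>B\<in>insert A F. (v B)\<^sup>2) + 2 * (\<Sum>B\<in>insert A F. (u k B)\<^sup>2) - (\<Sum>B\<in>insert A F. (v B + u k B)\<^sup>2)"
      by (simp only: sum_subtractf sum.distrib sum_distrib_left)
    also have "\<dots> \<le> 2 * a\<^sup>2 + 2 * (b k)\<^sup>2 - (c k)\<^sup>2" using 1 2 3 by linarith
    finally show ?thesis .
  qed
  have "(\<lambda>k. 2 * a\<^sup>2 + 2 * (b k)\<^sup>2 - (c k)\<^sup>2) \<longlonglongrightarrow> 2 * a\<^sup>2 + 2 * a\<^sup>2 - (2 * a)\<^sup>2"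
    by (intro tendsto_intros blim clim)
  then have l0: "(\<lambda>k. 2 * a\<^sup>2 + 2 * (b k)\<^sup>2 - (c k)\<^sup>2) \<longlonglongrightarrow> 0" by (simp add: power_mult_distrib)
  have "(\<lambda>k. (v A - u k A)\<^sup>2) \<longlonglongrightarrow> 0"
    by (rule tendsto_sandwich[OF _ _ tendsto_const l0]) (use key in auto)
  then have "(\<lambda>k. u k A) \<longlonglongrightarrow> v A" by (rule tendsto_of_square_diff)
  then show ?thesis by (simp add: u_def v_def)
qed

text \<open>Removing one more cell \<open>B\<close> subtracts the mass of
  \<open>A \<inter> B - \<Union>F\<close>, and the induction hypothesis covers this because
  \<open>A \<inter> B\<close> is again a cell. This is what the meets of layers are for.\<close>

lemma cells_diff_limit:
  assumes \<nu>: "\<nu> \<in> P" and \<nu>s: "\<And>k. \<nu>s k \<in> P"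
    and lim: "\<And>A. A \<in> cells \<Longrightarrow> (\<lambda>k. measure (\<mu> (\<nu>s k)) A) \<longlonglongrightarrow> measure (\<mu> \<nu>) A"
    and F: "finite F" "F \<subseteq> cells" and A: "A \<in> cells"
  shows "(\<lambda>k. measure (\<mu> (\<nu>s k)) (A - \<Union>F)) \<longlonglongrightarrow> measure (\<mu> \<nu>) (A - \<Union>F)"
  using F A
proof (induction F arbitrary: A rule: finite_induct)
  case empty
  then show ?case using lim by simp
next
  case (insert B F)
  have meas: "measure (\<mu> M) (A - \<Union>(insert B F)) = measure (\<mu> M) (A - \<Union>F) - measure (\<mu> M) (A \<inter> B - \<Union>F)"
    if M: "M \<in> P" for M
  proof -
    interpret finite_measure "\<mu> M" by (rule finite_mu[OF M])
    have s: "A \<in> sets (\<mu> M)" "A \<inter> B \<in> sets (\<mu> M)" "\<Union>F \<in> sets (\<mu> M)"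
      using insert.prems insert.hyps cells_Int cell_sets_mu[OF M] by (auto intro!: sets.finite_Union)
    have "A - \<Union>(insert B F) = (A - \<Union>F) - (A \<inter> B - \<Union>F)" by auto
    then show ?thesis using s by (simp only:) (intro finite_measure_Diff sets.Diff, auto)
  qed
  show ?case
    unfolding meas[OF \<nu>] meas[OF \<nu>s]
    using insert.prems cells_Int by (intro tendsto_diff insert.IH) auto
qed

text \<open>Two reductions: continuity from above leaves finitely many of the layers in
  \<open>J\<close>, and \<open>measure_Union_finite\<close> then leaves finitely many cells in each
  of them.\<close>

lemma finite_cells_cover:
  assumes \<nu>: "\<nu> \<in> P" and e: "e > 0"
  obtains F where "finite F" "F \<subseteq> cells" "\<And>A f g. A \<in> F \<Longrightarrow> f \<in> A \<Longrightarrow> g \<in> A \<Longrightarrow> norm (f - g) \<le> e"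
    "measure (\<mu> \<nu>) (L - \<Union>F) \<le> e"
proof -
  interpret finite_measure "\<mu> \<nu>" by (rule finite_mu[OF \<nu>])
  interpret pf: positive_functional T \<nu> by (rule functional[OF \<nu>])
  from cover[OF e] obtain J where J0: "L \<subseteq> (\<Union>t\<in>J. \<Union>(snd (\<l> t))) \<and>
    (\<forall>t\<in>J. \<forall>A\<in>snd (\<l> t). \<forall>f\<in>A. \<forall>g\<in>A. norm (f - g) \<le> e)" ..
  have J: "L \<subseteq> (\<Union>t\<in>J. \<Union>(snd (\<l> t)))"
    "\<And>t A f g. t \<in> J \<Longrightarrow> A \<in> snd (\<l> t) \<Longrightarrow> f \<in> A \<Longrightarrow> g \<in> A \<Longrightarrow> norm (f - g) \<le> e"
    using J0 by simp_all
  define S where "S t = \<Union>(snd (\<l> t))" for t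
  have o: "openin T (fst (\<l> t))" "openin T (fst (\<l> t) \<union> S t)" for t
    using base_layer[of t] layer_Union_open[OF base_layer order_refl, of t]
    by (simp_all add: layer_def S_def)
  have dS: "S t \<inter> fst (\<l> t) = {}" for t using base_layer[of t] by (auto simp: layer_def S_def)
  have SL: "S t \<subseteq> L" for t using openin_subset[OF o(2)[of t]] by simp
  have Sm: "S t \<in> sets (\<mu> \<nu>)" for t
  proof -
    have "S t = (fst (\<l> t) \<union> S t) - fst (\<l> t)" using dS by blast
    then show ?thesis using sets.Diff[OF open_sets_mu[OF \<nu> o(2)] open_sets_mu[OF \<nu> o(1)]] by metis
  qed
  have Lm: "L \<in> sets (\<mu> \<nu>)" by (rule cell_sets_mu[OF \<nu> L_cell])
  define R where "R n = L - (\<Union>t\<in>J \<inter> {..<n}. S t)" for n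
  have Rm: "R n \<in> sets (\<mu> \<nu>)" for n unfolding R_def by (intro sets.Diff Lm sets.finite_UN Sm) auto
  have "(\<lambda>n. measure (\<mu> \<nu>) (R n)) \<longlonglongrightarrow> measure (\<mu> \<nu>) (\<Inter>n. R n)"
    using Rm by (intro finite_Lim_measure_decseq) (auto simp: decseq_def R_def)
  moreover have "(\<Inter>n. R n) = {}"
  proof -
    have "\<exists>n. x \<notin> R n" for x
    proof (cases "x \<in> L")
      case True
      then have "x \<in> (\<Union>t\<in>J. S t)" unfolding S_def by (rule subsetD[OF J(1)])
      then obtain t where "t \<in> J" "x \<in> S t" by blast
      then have "x \<notin> R (Suc t)" by (auto simp: R_def)
      then show ?thesis by blast
    qed (auto simp: R_def)
    then show ?thesis by auto
  qed
  ultimately have "\<forall>\<^sub>F n in sequentially. measure (\<mu> \<nu>) (R n) < e/2"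
    using e by (intro order_tendstoD(2)) auto
  then obtain n where n: "measure (\<mu> \<nu>) (R n) < e/2" by (meson eventually_happens sequentially_bot)
  \<comment> \<open>At most \<open>n\<close> layers remain, so their losses add up to at most
    \<open>n * \<eta> \<le> e/2\<close>.\<close>
  define \<eta> where "\<eta> = e / (2 * (real n + 1))"
  have \<eta>: "\<eta> > 0" using e by (simp add: \<eta>_def)
  have "\<exists>C. finite C \<and> C \<subseteq> snd (\<l> t) \<and> measure (\<mu> \<nu>) (S t - \<Union>C) \<le> \<eta>" for t
  proof -
    let ?G = "fst (\<l> t)"
    \<comment> \<open>Adding the open part makes every cell open; being disjoint from
      \<open>S t\<close>, it does not affect which points of \<open>S t\<close> are left
      uncovered.\<close>
    define \<U> where "\<U> = (\<lambda>A. A \<union> ?G) ` insert {} (snd (\<l> t))"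
    have op: "\<And>U. U \<in> \<U> \<Longrightarrow> openin T U" using base_layer[of t] by (auto simp: \<U>_def layer_def)
    obtain F where F: "finite F" "F \<subseteq> \<U>" "measure (\<mu> \<nu>) (\<Union>\<U>) \<le> measure (\<mu> \<nu>) (\<Union>F) + \<eta>"
      using pf.measure_Union_finite[OF op \<eta>] by blast
    obtain D where D: "D \<subseteq> insert {} (snd (\<l> t))" "finite D" "F = (\<lambda>A. A \<union> ?G) ` D"
      using finite_subset_image[OF F(1) F(2)[unfolded \<U>_def]] by blast
    have m: "\<Union>\<U> \<in> sets (\<mu> \<nu>)" "\<Union>F \<in> sets (\<mu> \<nu>)"
      using op F(2) by (auto intro!: open_sets_mu[OF \<nu>] openin_Union)
    have "S t - \<Union>(D - {{}}) \<subseteq> \<Union>\<U> - \<Union>F"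
      using dS[of t] D unfolding \<U>_def S_def by auto
    then have "measure (\<mu> \<nu>) (S t - \<Union>(D - {{}})) \<le> measure (\<mu> \<nu>) (\<Union>\<U> - \<Union>F)"
      using m by (intro finite_measure_mono sets.Diff)
    also have "\<dots> = measure (\<mu> \<nu>) (\<Union>\<U>) - measure (\<mu> \<nu>) (\<Union>F)"
      using m F(2) by (intro finite_measure_Diff) auto
    also have "\<dots> \<le> \<eta>" using F(3) by simp
    finally show ?thesis using D by (intro exI[of _ "D - {{}}"]) auto
  qed
  then obtain C where C: "\<And>t. finite (C t)" "\<And>t. C t \<subseteq> snd (\<l> t)" "\<And>t. measure (\<mu> \<nu>) (S t - \<Union>(C t)) \<le> \<eta>"
    by metis
  define F where "F = (\<Union>t\<in>J \<inter> {..<n}. C t)"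
  have Cc: "C t \<subseteq> cells" for t using C(2)[of t] base_cells by blast
  have Fc: "finite F" "F \<subseteq> cells" using C(1) Cc unfolding F_def by auto
  have CS: "S t - \<Union>(C t) \<in> sets (\<mu> \<nu>)" for t
    using C(1)[of t] Cc[of t] cell_sets_mu[OF \<nu>] by (intro sets.Diff Sm sets.finite_Union) auto
  have "L - \<Union>F \<subseteq> R n \<union> (\<Union>t\<in>J \<inter> {..<n}. S t - \<Union>(C t))" unfolding R_def F_def by auto
  then have "measure (\<mu> \<nu>) (L - \<Union>F) \<le> measure (\<mu> \<nu>) (R n \<union> (\<Union>t\<in>J \<inter> {..<n}. S t - \<Union>(C t)))"
    using Rm CS by (intro finite_measure_mono sets.Un sets.finite_UN) auto
  also have "\<dots> \<le> measure (\<mu> \<nu>) (R n) + measure (\<mu> \<nu>) (\<Union>t\<in>J \<inter> {..<n}. S t - \<Union>(C t))"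
    using Rm CS by (intro measure_Un_le sets.finite_UN) auto
  also have "measure (\<mu> \<nu>) (\<Union>t\<in>J \<inter> {..<n}. S t - \<Union>(C t)) \<le> (\<Sum>t\<in>J \<inter> {..<n}. measure (\<mu> \<nu>) (S t - \<Union>(C t)))"
    using CS by (intro measure_UNION_le) auto
  also have "\<dots> \<le> (\<Sum>t\<in>J \<inter> {..<n}. \<eta>)" by (intro sum_mono C)
  also have "\<dots> \<le> real n * \<eta>"
    using \<eta> card_mono[of "{..<n}" "J \<inter> {..<n}"] by (simp add: mult_right_mono)
  also have "\<dots> \<le> e/2" using e by (simp add: \<eta>_def field_simps)
  finally have "measure (\<mu> \<nu>) (L - \<Union>F) \<le> e" using n by simp
  moreover have "norm (f - g) \<le> e" if "A \<in> F" "f \<in> A" "g \<in> A" for A f g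
    using that J(2) C(2) unfolding F_def by blast
  ultimately show ?thesis using that Fc by blast
qed

text \<open>Up to a small error a barycentre is a finite sum of masses times fixed representatives,
  over disjoint pieces cut from finitely many small cells. Both the masses of the pieces and the
  error bounds converge.\<close>

lemma determining:
  assumes \<nu>: "\<nu> \<in> P" and \<nu>s: "\<And>k. \<nu>s k \<in> P"
    and q1: "\<And>i. (\<lambda>k. q i (\<nu>s k)) \<longlonglongrightarrow> q i \<nu>"
    and q2: "\<And>i. (\<lambda>k. q i (\<lambda>g. \<nu> g + \<nu>s k g)) \<longlonglongrightarrow> 2 * q i \<nu>"
  shows "(\<lambda>k. moment (\<nu>s k)) \<longlonglongrightarrow> moment \<nu>"
proof (rule tendstoI)
  fix \<delta> :: real assume \<delta>: "\<delta> > 0"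
  have lim: "(\<lambda>k. measure (\<mu> (\<nu>s k)) A) \<longlonglongrightarrow> measure (\<mu> \<nu>) A" if "A \<in> cells" for A
    using cell_limit[OF \<nu> \<nu>s q1 q2] that by (auto simp: cells_def)
  define m where "m = \<nu> (\<lambda>x. 1)"
  have m: "m \<ge> 0" using mu_mass[OF \<nu>] by (metis m_def measure_nonneg)
  \<comment> \<open>The two error bounds tend to a total of at most \<open>e * (2 * m + 2)\<close>;
    the \<open>3\<close> makes this strictly less than \<delta>.\<close>
  define e where "e = \<delta> / (2 * m + 3)"
  have e: "e > 0" using \<delta> m by (simp add: e_def)
  obtain F where F: "finite F" "F \<subseteq> cells" "\<And>A f g. A \<in> F \<Longrightarrow> f \<in> A \<Longrightarrow> g \<in> A \<Longrightarrow> norm (f - g) \<le> e"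
    "measure (\<mu> \<nu>) (L - \<Union>F) \<le> e"
    using finite_cells_cover[OF \<nu> e] by blast
  obtain As where As: "set As = F" using F(1) finite_list by blast
  define r where "r = length As"
  define D where "D j = As ! j - \<Union>(set (take j As))" for j
  \<comment> \<open>For an empty cell the choice is arbitrary; \<open>fb\<close> speaks only about
    points of \<open>D j\<close>.\<close>
  define f where "f j = (SOME x. x \<in> As ! j)" for j
  have AsF: "As ! j \<in> F" if "j < r" for j using As that by (auto simp: r_def)
  have takeF: "set (take j As) \<subseteq> F" for j using As set_take_subset by fast
  have disj: "disjoint_family_on D {..<r}"
  proof -
    have "D i \<inter> D j = {}" if "i < j" "j < r" for i j
    proof -
      have "As ! i \<in> set (take j As)" using that by (auto simp: in_set_conv_nth r_def)
      then show ?thesis by (auto simp: D_def)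
    qed
    then show ?thesis unfolding disjoint_family_on_def
      by (metis Int_commute lessThan_iff linorder_neqE_nat)
  qed
  have UD: "(\<Union>j<r. D j) = \<Union>F"
  proof
    show "(\<Union>j<r. D j) \<subseteq> \<Union>F" using AsF by (auto simp: D_def)
    show "\<Union>F \<subseteq> (\<Union>j<r. D j)"
    proof
      fix x assume "x \<in> \<Union>F"
      then have ex: "\<exists>j. j < r \<and> x \<in> As ! j" using As by (auto simp: r_def in_set_conv_nth)
      define j where "j = (LEAST j. j < r \<and> x \<in> As ! j)"
      have j: "j < r" "x \<in> As ! j" using LeastI_ex[OF ex] by (auto simp: j_def)
      have "x \<notin> As ! i" if "i < j" for i 
        using not_less_Least[of i "\<lambda>j. j < r \<and> x \<in> As ! j"] that j(1) unfolding j_def by simp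
      then have "x \<in> D j" using j by (auto simp: D_def in_set_conv_nth)
      then show "x \<in> (\<Union>j<r. D j)" using j by blast
    qed
  qed
  have Dm: "D j \<in> sets (\<mu> M)" if "M \<in> P" "j < r" for M j
    unfolding D_def using takeF AsF[OF that(2)] F(2) cell_sets_mu[OF that(1)]
    by (intro sets.Diff sets.finite_Union) auto
  have fb: "norm (k - f j) \<le> e" if "j < r" "k \<in> D j" for j k
  proof -
    have "k \<in> As ! j" using that by (simp add: D_def)
    moreover from this have "f j \<in> As ! j" unfolding f_def by (rule someI)
    ultimately show ?thesis using F(3) AsF[OF that(1)] by blast
  qed
  define S where "S M = (\<Sum>j<r. measure (\<mu> M) (D j) *\<^sub>R f j)" for M
  define err where "err M = e * M (\<lambda>x. 1) + measure (\<mu> M) (L - \<Union>F)" for M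
  have approx: "norm (moment M - S M) \<le> err M" if "M \<in> P" for M
    unfolding S_def err_def UD[symmetric] by (rule moment_approx[OF that Dm[OF that] disj less_imp_le[OF e] fb])
  have Dlim: "(\<lambda>k. measure (\<mu> (\<nu>s k)) (D j)) \<longlonglongrightarrow> measure (\<mu> \<nu>) (D j)" if "j < r" for j
    unfolding D_def using takeF AsF[OF that] F(2)
    by (intro cells_diff_limit[OF \<nu> \<nu>s lim]) auto
  have "(\<lambda>k. S (\<nu>s k)) \<longlonglongrightarrow> S \<nu>" unfolding S_def by (intro tendsto_intros Dlim) auto
  then have "(\<lambda>k. norm (S (\<nu>s k) - S \<nu>)) \<longlonglongrightarrow> 0" by (intro tendsto_norm_zero LIM_zero)
  moreover have "(\<lambda>k. err (\<nu>s k)) \<longlonglongrightarrow> err \<nu>"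
    using lim[OF L_cell] unfolding err_def
    by (intro tendsto_intros cells_diff_limit[OF \<nu> \<nu>s lim F(1,2) L_cell]) (simp add: mu_mass[OF \<nu>] mu_mass[OF \<nu>s])
  ultimately have "(\<lambda>k. err (\<nu>s k) + norm (S (\<nu>s k) - S \<nu>) + err \<nu>) \<longlonglongrightarrow> err \<nu> + 0 + err \<nu>"
    by (intro tendsto_intros)
  moreover have "err \<nu> + 0 + err \<nu> < \<delta>"
  proof -
    have "err \<nu> + 0 + err \<nu> \<le> e * (2 * m + 2)" using F(4) by (simp add: err_def m_def algebra_simps)
    also have "\<dots> < e * (2 * m + 3)" using e by simp
    also have "\<dots> = \<delta>" using m by (simp add: e_def)
    finally show ?thesis .
  qed
  ultimately have "\<forall>\<^sub>F k in sequentially. err (\<nu>s k) + norm (S (\<nu>s k) - S \<nu>) + err \<nu> < \<delta>"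
    by (rule order_tendstoD(2))
  then show "\<forall>\<^sub>F k in sequentially. dist (moment (\<nu>s k)) (moment \<nu>) < \<delta>"
  proof (rule eventually_mono)
    fix k assume *: "err (\<nu>s k) + norm (S (\<nu>s k) - S \<nu>) + err \<nu> < \<delta>"
    have eq: "moment (\<nu>s k) - moment \<nu> = (moment (\<nu>s k) - S (\<nu>s k)) + (S (\<nu>s k) - S \<nu>) - (moment \<nu> - S \<nu>)"
      by simp
    have "norm (moment (\<nu>s k) - moment \<nu>) \<le>
        norm (moment (\<nu>s k) - S (\<nu>s k)) + norm (S (\<nu>s k) - S \<nu>) + norm (moment \<nu> - S \<nu>)"
      unfolding eq
      using norm_triangle_ineq4[of "(moment (\<nu>s k) - S (\<nu>s k)) + (S (\<nu>s k) - S \<nu>)" "moment \<nu> - S \<nu>"]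
        norm_triangle_ineq[of "moment (\<nu>s k) - S (\<nu>s k)" "S (\<nu>s k) - S \<nu>"] by linarith
    then show "dist (moment (\<nu>s k)) (moment \<nu>) < \<delta>"
      using approx[OF \<nu>] approx[OF \<nu>s, of k] * by (simp add: dist_norm)
  qed
qed

end

section \<open>Renorming\<close>

text \<open>\<open>W\<close> is the union of the neighbourhoods from the LRC property and
  \<open>C\<close> is the weak-star closure of \<open>E\<close>. Norm compact sets are weak-star
  closed; hence inside \<open>u f\<close> the set \<open>C\<close> stays within the norm compact
  \<open>K\<close>, and removing the compact set \<open>K - U\<close> from \<open>u f\<close> leaves
  the required weak-star neighbourhood.\<close>

lemma LRC_locally_closed_hull:
  fixes E :: "('a::real_normed_vector \<Rightarrow>\<^sub>L real) set"
  assumes E: "weak_star_LRC E"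
  shows "\<exists>W C. openin weak_star_topology W \<and> closedin weak_star_topology C \<and> E \<subseteq> W \<inter> C \<and>
    (\<forall>U g. open U \<longrightarrow> g \<in> U \<inter> W \<inter> C \<longrightarrow> (\<exists>V. openin weak_star_topology V \<and> g \<in> V \<and> V \<inter> W \<inter> C \<subseteq> U))"
proof -
  obtain u where u: "\<And>f. f \<in> E \<Longrightarrow> openin weak_star_topology (u f)" "\<And>f. f \<in> E \<Longrightarrow> f \<in> u f"
    "\<And>f. f \<in> E \<Longrightarrow> compact (closure (E \<inter> u f))"
    using E unfolding weak_star_LRC_def by metis
  define W where "W = (\<Union>f\<in>E. u f)"
  define C where "C = weak_star_topology closure_of E"
  have cl: "closedin weak_star_topology K" if "compact K" for K :: "('a \<Rightarrow>\<^sub>L real) set"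
  proof -
    have "compactin weak_star_topology ((\<lambda>f. f) ` K)"
      using that by (intro image_compactin[OF _ strong_operator_topology_weaker_than_euclidean]) simp
    then show ?thesis using compactin_imp_closedin[OF Hausdorff_weak_star] by simp
  qed
  have "\<exists>V. openin weak_star_topology V \<and> g \<in> V \<and> V \<inter> W \<inter> C \<subseteq> U" if U: "open U" "g \<in> U \<inter> W \<inter> C" for U g
  proof -
    obtain f where f: "f \<in> E" "g \<in> u f" using U by (auto simp: W_def)
    define K where "K = closure (E \<inter> u f)"
    have K: "compact K" using u(3)[OF f(1)] by (simp add: K_def)
    have "u f \<inter> C \<subseteq> weak_star_topology closure_of (u f \<inter> E)"
      unfolding C_def by (rule openin_Int_closure_of_subset[OF u(1)[OF f(1)]])
    also have "\<dots> \<subseteq> K"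
      by (rule closure_of_minimal[OF _ cl[OF K]]) (auto simp: K_def closure_subset Int_commute intro: subsetD[OF closure_subset])
    finally have sub: "u f \<inter> C \<subseteq> K" .
    have "closedin weak_star_topology (K - U)" by (rule cl) (rule compact_diff[OF K U(1)])
    then have "openin weak_star_topology (u f - (K - U))" by (rule openin_diff[OF u(1)[OF f(1)]])
    then show ?thesis using f(2) U(2) sub by (intro exI[of _ "u f - (K - U)"]) auto
  qed
  moreover have "openin weak_star_topology W" unfolding W_def using u(1) by auto
  moreover have "closedin weak_star_topology C" unfolding C_def by (rule closedin_closure_of)
  moreover have "E \<subseteq> W \<inter> C" using u(2) closure_of_subset[of E weak_star_topology] by (auto simp: W_def C_def)
  ultimately show ?thesis by blast
qed

text \<open>The disjointness argument of M. E. Rudin's proof that metric spaces are paracompact.\<close>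

lemma sigma_disjoint_open_cover:
  fixes e :: real
  assumes e: "e > 0"
  obtains \<D> :: "nat \<Rightarrow> 'm::metric_space set set"
  where "\<And>n. disjoint (\<D> n)" "\<And>n U. U \<in> \<D> n \<Longrightarrow> open U"
    "\<And>n U f g. U \<in> \<D> n \<Longrightarrow> f \<in> U \<Longrightarrow> g \<in> U \<Longrightarrow> dist f g \<le> 2 * e" "(\<Union>n. \<Union>(\<D> n)) = UNIV"
proof -
  obtain R :: "'m rel" where R: "Well_order R" "Field R = UNIV" using well_ordering by metis
  have wf: "wf (R - Id)" using R(1) by (simp add: well_order_on_def)
  have tot: "(x, y) \<in> R - Id \<or> (y, x) \<in> R - Id" if "x \<noteq> y" for x y
    using R that by (auto simp: well_order_on_def linear_order_on_def total_on_def)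
  have "\<exists>x. dist x y < e \<and> (\<forall>w. (w, x) \<in> R - Id \<longrightarrow> \<not> dist w y < e)" for y
    using wfE_min[OF wf, of y "{x. dist x y < e}"] e by (metis dist_self mem_Collect_eq)
  then obtain s where s: "\<And>y. dist (s y) y < e" "\<And>y w. (w, s y) \<in> R - Id \<Longrightarrow> \<not> dist w y < e" by metis
  \<comment> \<open>\<open>s y\<close> is the least centre within \<open>e\<close> of
    \<open>y\<close>. If two of these sets meet, the margin of three radii absorbs the two radii
    between \<open>y\<close> and \<open>y'\<close>, so the smaller centre is within \<open>e\<close>
    of \<open>y'\<close>, against the choice of \<open>s y'\<close>.\<close>
  define O' where "O' n x = (\<Union>y\<in>{y. s y = x \<and> dist x y < e - 3 * (1/2)^n}. ball y ((1/2)^n))" for n :: nat and x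
  have dj: "O' n x \<inter> O' n x' = {}" if "x \<noteq> x'" for n x x'
  proof -
    have False if xx: "(x, x') \<in> R - Id" and z: "z \<in> O' n x" and z': "z \<in> O' n x'" for x x' z
    proof -
      obtain y where y: "s y = x" "dist x y < e - 3 * (1/2)^n" "dist y z < (1/2)^n" using z by (auto simp: O'_def)
      obtain y' where y': "s y' = x'" "dist y' z < (1/2)^n" using z' by (auto simp: O'_def)
      have "dist x y' \<le> dist x y + (dist y z + dist y' z)"
        using dist_triangle[of x y' y] dist_triangle[of y y' z] by (simp add: dist_commute)
      also have "\<dots> < e - 3 * (1/2)^n + ((1/2)^n + (1/2)^n)" using y y' by linarith
      also have "\<dots> \<le> e" by simp
      finally show False using s(2)[of x y'] xx y'(1) by simp
    qed
    then show ?thesis using tot[OF that] by blast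
  qed
  have near: "dist x z < e" if z: "z \<in> O' n x" for n x z
  proof -
    obtain y where y: "dist x y < e - 3 * (1/2)^n" "dist y z < (1/2)^n" using z by (auto simp: O'_def)
    have "dist x z < e - 3 * (1/2)^n + (1/2)^n" using dist_triangle[of x z y] y by linarith
    also have "\<dots> \<le> e" by simp
    finally show ?thesis .
  qed
  show ?thesis
  proof
    fix n
    show "disjoint (range (O' n))"
      unfolding disjoint_def
    proof (intro ballI impI)
      fix a b assume ab: "a \<in> range (O' n)" "b \<in> range (O' n)" "a \<noteq> b"
      obtain x x' where x: "a = O' n x" "b = O' n x'" using ab(1,2) by auto
      then have "x \<noteq> x'" using ab(3) by auto
      then show "a \<inter> b = {}" unfolding x by (rule dj)
    qed
    fix U assume U: "U \<in> range (O' n)"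
    then show "open U" by (auto simp: O'_def)
    fix f g assume "f \<in> U" "g \<in> U"
    then obtain x where "dist x f < e" "dist x g < e" using U near by auto
    then show "dist f g \<le> 2 * e" using dist_triangle[of f g x] by (simp add: dist_commute)
  next
    have "\<exists>n. y \<in> O' n (s y)" for y
    proof -
      have "(e - dist (s y) y) / 3 > 0" using s(1)[of y] by simp
      then have "\<exists>n. (1/2)^n < (e - dist (s y) y) / 3" by (rule real_arch_pow_inv) simp
      then obtain n where "(1/2)^n < (e - dist (s y) y) / 3" ..
      then have "3 * (1/2)^n < 3 * ((e - dist (s y) y) / 3)" by (rule mult_strict_left_mono) simp
      also have "\<dots> = e - dist (s y) y" by simp
      finally have "dist (s y) y < e - 3 * (1/2)^n" by (simp only: less_diff_eq add.commute)
      then have "y \<in> O' n (s y)" unfolding O'_def by (intro UN_I[of y]) simp_all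
      then show ?thesis by blast
    qed
    note ex = this
    show "(\<Union>n. \<Union>(range (O' n))) = UNIV"
    proof (intro equalityI subset_UNIV subsetI)
      fix y :: 'm
      obtain n where "y \<in> O' n (s y)" using ex[of y] ..
      then have "y \<in> \<Union>(range (O' n))" by (rule UnionI[OF rangeI])
      then show "y \<in> (\<Union>n. \<Union>(range (O' n)))" by (rule UN_I[OF UNIV_I])
    qed
  qed
qed

text \<open>An index codes a set \<open>E j\<close>, a radius \<open>1 / (m + 1)\<close> and one of
  the disjoint families for it. Cells are traces of norm-open sets on
  \<open>W j \<inter> C j\<close>, where the topologies agree, so they are relatively weak-star open
  there; the rest of \<open>W j\<close> is the open part. All of this is cut down to
  \<open>L\<close>.\<close>

lemma layers_of_LRC_cover:
  fixes L :: "('a::real_normed_vector \<Rightarrow>\<^sub>L real) set" and E :: "nat \<Rightarrow> ('a \<Rightarrow>\<^sub>L real) set"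
  assumes L: "compactin weak_star_topology L" "L \<subseteq> cball 0 1"
    and E: "\<And>j. weak_star_LRC (E j)" "L \<subseteq> (\<Union>j. E j)"
  shows "\<exists>\<l>. layered L \<l>"
proof -
  let ?T = "subtopology weak_star_topology L"
  have "\<exists>W C. openin weak_star_topology W \<and> closedin weak_star_topology C \<and> E j \<subseteq> W \<inter> C \<and>
    (\<forall>U g. open U \<longrightarrow> g \<in> U \<inter> W \<inter> C \<longrightarrow> (\<exists>V. openin weak_star_topology V \<and> g \<in> V \<and> V \<inter> W \<inter> C \<subseteq> U))" for j
    by (rule LRC_locally_closed_hull[OF E(1)])
  then obtain W C where W: "\<And>j. openin weak_star_topology (W j)" and C: "\<And>j. closedin weak_star_topology (C j)"
    and EWC: "\<And>j. E j \<subseteq> W j \<inter> C j"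
    and V: "\<And>j U g. open U \<Longrightarrow> g \<in> U \<inter> W j \<inter> C j \<Longrightarrow>
      \<exists>V. openin weak_star_topology V \<and> g \<in> V \<and> V \<inter> W j \<inter> C j \<subseteq> U"
    by metis
  have "\<exists>\<D> :: nat \<Rightarrow> ('a \<Rightarrow>\<^sub>L real) set set. (\<forall>n. disjoint (\<D> n)) \<and> (\<forall>n. \<forall>U\<in>\<D> n. open U) \<and>
      (\<forall>n. \<forall>U\<in>\<D> n. \<forall>f\<in>U. \<forall>g\<in>U. dist f g \<le> 2 * (1 / (real m + 1))) \<and> (\<Union>n. \<Union>(\<D> n)) = UNIV" for m :: nat
    by (rule sigma_disjoint_open_cover[of "1 / (real m + 1)"]) (simp, blast)
  then obtain \<D> :: "nat \<Rightarrow> nat \<Rightarrow> ('a \<Rightarrow>\<^sub>L real) set set" where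
    D1: "\<And>m n. disjoint (\<D> m n)" and D2: "\<And>m n U. U \<in> \<D> m n \<Longrightarrow> open U"
    and D3: "\<And>m n U f g. U \<in> \<D> m n \<Longrightarrow> f \<in> U \<Longrightarrow> g \<in> U \<Longrightarrow> dist f g \<le> 2 * (1 / (real m + 1))"
    and D4: "\<And>m. (\<Union>n. \<Union>(\<D> m n)) = UNIV"
    by metis
  define \<l> where "\<l> t = (case from_nat t :: nat \<times> nat \<times> nat of (j, m, n) \<Rightarrow>
    (L \<inter> (W j - C j), (\<lambda>U. L \<inter> (U \<inter> W j \<inter> C j)) ` \<D> m n))" for t
  have "layered L \<l>"
  proof
    fix t
    obtain j m n where t: "(from_nat t :: nat \<times> nat \<times> nat) = (j, m, n)" by (metis prod_cases3)
    have G: "openin weak_star_topology (W j - C j)" by (rule openin_diff[OF W C])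
    show "layer ?T (\<l> t)"
      unfolding layer_def
    proof (intro conjI ballI)
      show "openin ?T (fst (\<l> t))" using G by (auto simp: \<l>_def t openin_subtopology)
      show "disjoint (snd (\<l> t))"
        unfolding disjoint_def
      proof (intro ballI impI)
        fix A B assume "A \<in> snd (\<l> t)" "B \<in> snd (\<l> t)" "A \<noteq> B"
        then obtain U U' where U: "U \<in> \<D> m n" "U' \<in> \<D> m n" "U \<noteq> U'" "A \<subseteq> U" "B \<subseteq> U'" by (auto simp: \<l>_def t)
        then have "U \<inter> U' = {}" using D1[of m n] unfolding disjoint_def by blast
        then show "A \<inter> B = {}" using U by blast
      qed
      fix A assume "A \<in> snd (\<l> t)"
      then obtain U where U: "U \<in> \<D> m n" "A = L \<inter> (U \<inter> W j \<inter> C j)" by (auto simp: \<l>_def t)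
      show "A \<inter> fst (\<l> t) = {}" using U by (auto simp: \<l>_def t)
      \<comment> \<open>The largest weak-star open set whose trace on
        \<open>W j \<inter> C j\<close> lies in \<open>U\<close>; by \<open>V\<close> that trace is
        all of \<open>U \<inter> W j \<inter> C j\<close>.\<close>
      define H where "H = \<Union>{V. openin weak_star_topology V \<and> V \<inter> W j \<inter> C j \<subseteq> U}"
      have "openin weak_star_topology H" unfolding H_def by auto
      then have "openin weak_star_topology ((W j \<inter> H) \<union> (W j - C j))" by (intro openin_Un openin_Int W G)
      moreover have "A \<union> fst (\<l> t) = ((W j \<inter> H) \<union> (W j - C j)) \<inter> L"
      proof -
        have "U \<inter> W j \<inter> C j \<subseteq> H" using V[OF D2[OF U(1)]] unfolding H_def by blast
        moreover have "H \<inter> W j \<inter> C j \<subseteq> U" unfolding H_def by blast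
        ultimately show ?thesis unfolding U(2) \<l>_def t by auto
      qed
      ultimately show "openin ?T (A \<union> fst (\<l> t))" by (auto simp: openin_subtopology)
    qed
  next
    fix e :: real assume e: "e > 0"
    obtain m :: nat where "2 / e < real m" using reals_Archimedean2 by blast
    then have m: "2 * (1 / (real m + 1)) \<le> e" using e by (simp add: field_simps)
    let ?J = "range (\<lambda>(j :: nat, n :: nat). to_nat (j, m, n))"
    have lJ: "\<l> (to_nat (j, m, n)) = (L \<inter> (W j - C j), (\<lambda>U. L \<inter> (U \<inter> W j \<inter> C j)) ` \<D> m n)" for j n
      by (simp add: \<l>_def)
    have "L \<subseteq> (\<Union>t\<in>?J. \<Union>(snd (\<l> t)))"
    proof
      fix x assume x: "x \<in> L"
      then obtain j where "x \<in> E j" using E(2) by auto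
      then have j: "x \<in> W j \<inter> C j" using EWC by auto
      obtain n U where "U \<in> \<D> m n" "x \<in> U" using D4[of m] by blast
      then have "x \<in> \<Union>(snd (\<l> (to_nat (j, m, n))))" using x j by (auto simp: lJ)
      moreover have "to_nat (j, m, n) \<in> ?J" by (rule image_eqI[of _ _ "(j, n)"]) auto
      ultimately show "x \<in> (\<Union>t\<in>?J. \<Union>(snd (\<l> t)))" by (rule UN_I[rotated])
    qed
    moreover have "norm (f - g) \<le> e" if t: "t \<in> ?J" and A: "A \<in> snd (\<l> t)" "f \<in> A" "g \<in> A" for t A f g
    proof -
      obtain j n :: nat where "t = to_nat (j, m, n)" using t by auto
      then obtain U where "U \<in> \<D> m n" "f \<in> U" "g \<in> U" using A by (auto simp: lJ)
      then show ?thesis using D3[of U m n f g] m by (simp add: dist_norm)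
    qed
    ultimately show "\<exists>J. L \<subseteq> (\<Union>t\<in>J. \<Union>(snd (\<l> t))) \<and> (\<forall>t\<in>J. \<forall>A\<in>snd (\<l> t). \<forall>f\<in>A. \<forall>g\<in>A. norm (f - g) \<le> e)"
      by blast
  qed (use L in auto)
  then show ?thesis by blast
qed

text \<open>Inserting the empty set leaves the union unchanged and guarantees a nonempty family to
  enumerate.\<close>

lemma countable_family_sequence:
  assumes "countable \<F>" "P {}" "\<forall>A\<in>\<F>. P A"
  shows "\<exists>S :: nat \<Rightarrow> 'b set. (\<forall>n. P (S n)) \<and> (\<Union>n. S n) = \<Union>\<F>"
proof (intro exI conjI allI)
  have r: "range (from_nat_into (insert {} \<F>)) = insert {} \<F>"
    using assms(1) by (intro range_from_nat_into) auto
  then show "(\<Union>n. from_nat_into (insert {} \<F>) n) = \<Union>\<F>" by auto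
  show "P (from_nat_into (insert {} \<F>) n)" for n
    using r assms(2,3) rangeI[of "from_nat_into (insert {} \<F>)" n] by auto
qed

theorem theorem3p2:
  assumes "\<exists>B :: ('a::banach \<Rightarrow>\<^sub>L real) set.
    is_boundary B \<and> sigma_weak_star_LRC B \<and> weak_star_K_sigma B"
  shows "\<exists>N :: 'a \<Rightarrow> real. equivalent_norm N \<and> LUR (dual_norm N)"
proof -
  obtain B :: "('a \<Rightarrow>\<^sub>L real) set" where B: "is_boundary B" "sigma_weak_star_LRC B" "weak_star_K_sigma B"
    using assms by blast
  from B(2) obtain \<E> where \<E>0: "countable \<E> \<and> (\<forall>E\<in>\<E>. weak_star_LRC E) \<and> B = \<Union>\<E>"
    unfolding sigma_weak_star_LRC_def ..
  then have \<E>: "countable \<E>" "\<forall>E\<in>\<E>. weak_star_LRC E" "B = \<Union>\<E>" by simp_all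
  have empty: "weak_star_LRC ({} :: ('a \<Rightarrow>\<^sub>L real) set)" by (simp add: weak_star_LRC_def)
  have "\<exists>S :: nat \<Rightarrow> ('a \<Rightarrow>\<^sub>L real) set. (\<forall>n. weak_star_LRC (S n)) \<and> (\<Union>n. S n) = \<Union>\<E>"
    by (rule countable_family_sequence[OF \<E>(1) empty \<E>(2)])
  then obtain E :: "nat \<Rightarrow> ('a \<Rightarrow>\<^sub>L real) set" where E0: "(\<forall>n. weak_star_LRC (E n)) \<and> (\<Union>n. E n) = \<Union>\<E>" ..
  have E: "\<And>n. weak_star_LRC (E n)" "(\<Union>n. E n) = B"
    using E0 \<E>(3) by simp_all
  from B(3) obtain \<K> where \<K>0: "countable \<K> \<and> (\<forall>K\<in>\<K>. compactin weak_star_topology K) \<and> B = \<Union>\<K>"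
    unfolding weak_star_K_sigma_def ..
  then have \<K>: "countable \<K>" "\<forall>K\<in>\<K>. compactin weak_star_topology K" "B = \<Union>\<K>" by simp_all
  have "\<exists>S :: nat \<Rightarrow> ('a \<Rightarrow>\<^sub>L real) set. (\<forall>n. compactin weak_star_topology (S n)) \<and> (\<Union>n. S n) = \<Union>\<K>"
    by (rule countable_family_sequence[OF \<K>(1) compactin_empty \<K>(2)])
  then obtain K :: "nat \<Rightarrow> ('a \<Rightarrow>\<^sub>L real) set" where K0: "(\<forall>n. compactin weak_star_topology (K n)) \<and> (\<Union>n. K n) = \<Union>\<K>" ..
  have K: "\<And>n. compactin weak_star_topology (K n)" "(\<Union>n. K n) = B"
    using K0 \<K>(3) by simp_all
  \<comment> \<open>Finite unions make the compact sets increase, as \<open>moments_dense\<close>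
    requires.\<close>
  define L where "L n = (\<Union>i\<le>n. K i)" for n :: nat
  have L: "compactin weak_star_topology (L n)" for n
    unfolding L_def using K(1) by (intro compactin_Union) auto
  have Lmono: "L m \<subseteq> L n" if "m \<le> n" for m n
    unfolding L_def using that by (intro UN_mono) auto
  have LB: "B = (\<Union>n. L n)" 
  proof
    have "K n \<subseteq> L n" for n unfolding L_def by (rule UN_upper) simp
    then show "B \<subseteq> (\<Union>n. L n)" unfolding K(2)[symmetric] by (intro UN_mono) auto
    show "(\<Union>n. L n) \<subseteq> B" unfolding K(2)[symmetric] L_def by (intro UN_least UN_upper UNIV_I)
  qed
  have Lball: "L n \<subseteq> cball 0 1" for n using LB B(1) unfolding is_boundary_def by blast
  have "\<exists>\<l>. layered (L n) \<l>" for n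
    using LB E by (intro layers_of_LRC_cover[OF L Lball]) auto
  then obtain \<l> where \<l>: "\<And>n. layered (L n) (\<l> n)" by metis
  define \<Psi> where "\<Psi> n m = lur_setup.\<Omega> (L n) (layered.\<G> (L n) (\<l> n)) (1 / (real m + 1))" for n m :: nat
  have \<Psi>1: "0 \<le> \<Psi> n m f" "\<Psi> n m f \<le> (norm f)\<^sup>2" "lsc_on weak_star_topology (\<Psi> n m)" for n m f
  proof -
    interpret layered "L n" "\<l> n" by (rule \<l>)
    show "0 \<le> \<Psi> n m f" "\<Psi> n m f \<le> (norm f)\<^sup>2" "lsc_on weak_star_topology (\<Psi> n m)"
      unfolding \<Psi>_def by (rule \<Omega>_nonneg \<Omega>_le_norm \<Omega>_lsc; simp)+
  qed
  have \<Psi>2: "\<Psi> n m (f + g) \<le> (1 + r) * \<Psi> n m f + (1 + 1 / r) * \<Psi> n m g" if "r > 0" for n m r f g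
  proof -
    interpret layered "L n" "\<l> n" by (rule \<l>)
    show ?thesis unfolding \<Psi>_def by (rule \<Omega>_young) (use that in simp_all)
  qed
  have \<Psi>3: "\<Psi> n m (t *\<^sub>R f) \<le> t\<^sup>2 * \<Psi> n m f" if "t \<ge> 0" for n m t f
  proof -
    interpret layered "L n" "\<l> n" by (rule \<l>)
    show ?thesis unfolding \<Psi>_def by (rule \<Omega>_scale_le) (use that in simp_all)
  qed
  have \<Psi>5: "\<forall>\<^sub>F k in sequentially. norm (z - s k) < 2 * sqrt (\<Psi> n m z) + e"
    if *: "(\<lambda>k. 2 * \<Psi> n m z + 2 * \<Psi> n m (s k) - \<Psi> n m (z + s k)) \<longlonglongrightarrow> 0" "e > 0" for n m z s e
  proof -
    interpret layered "L n" "\<l> n" by (rule \<l>)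
    show ?thesis
      unfolding \<Psi>_def
    proof (rule \<Omega>_defect[OF _ _ *(1)[unfolded \<Psi>_def] *(2)])
      show "(\<lambda>k. moment (\<nu>s k)) \<longlonglongrightarrow> moment \<nu>"
        if "\<nu> \<in> P" "\<And>k. \<nu>s k \<in> P" "\<And>i. (\<lambda>k. q i (\<nu>s k)) \<longlonglongrightarrow> q i \<nu>"
          "\<And>i. (\<lambda>k. q i (\<lambda>g. \<nu> g + \<nu>s k g)) \<longlonglongrightarrow> 2 * q i \<nu>" for \<nu> \<nu>s
        using that by (rule determining)
    qed simp
  qed
  \<comment> \<open>\<open>moments_dense\<close> reaches points of the unit ball; the factor
    \<open>t\<close> extends this to every \<open>z\<close>, since multiples of \<nu> are admissible
    too.\<close>
  have \<Psi>6: "\<exists>m. \<Psi> n m z < e"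
    if *: "t \<ge> 0" "\<nu> \<in> pos_functionals (subtopology weak_star_topology (L n))"
      "(norm (z - t *\<^sub>R moment \<nu>))\<^sup>2 < e" for n z t \<nu> e
  proof -
    interpret layered "L n" "\<l> n" by (rule \<l>)
    have "(norm (z - moment (\<lambda>g. t * \<nu> g)))\<^sup>2 < e"
      unfolding moment_scale[OF *(2,1)] by (rule *(3))
    then obtain m :: nat where "\<Omega> (1 / (real m + 1)) z < e"
      by (rule \<Omega>_small[OF pos_functionals_scale[OF *(2,1)]])
    then show ?thesis unfolding \<Psi>_def ..
  qed
  interpret dual_renorming B "\<lambda>i. case prod_decode i of (n, m) \<Rightarrow> \<Psi> n m"
  proof
    fix z :: "'a \<Rightarrow>\<^sub>L real" and s
    assume "\<And>i. (\<lambda>k. 2 * (case prod_decode i of (n, m) \<Rightarrow> \<Psi> n m) z + 2 * (case prod_decode i of (n, m) \<Rightarrow> \<Psi> n m) (s k)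
        - (case prod_decode i of (n, m) \<Rightarrow> \<Psi> n m) (z + s k)) \<longlonglongrightarrow> 0"
    from this[of "prod_encode (n, m)" for n m]
    have d: "(\<lambda>k. 2 * \<Psi> n m z + 2 * \<Psi> n m (s k) - \<Psi> n m (z + s k)) \<longlonglongrightarrow> 0" for n m by simp
    show "s \<longlonglongrightarrow> z"
    proof (rule tendstoI)
      fix e :: real assume e: "e > 0"
      define t where "t = norm z + 1"
      have t: "t > 0" by (simp add: t_def add_nonneg_pos)
      have "norm (z /\<^sub>R t) \<le> 1" using t by (simp add: t_def field_simps)
      \<comment> \<open>The \<open>5\<close> yields a strict bound by \<open>e/4\<close> after
        scaling back; then \<open>2 * (e/4) + e/2 = e\<close>.\<close>
      moreover have "e / (5 * t) > 0" using e t by simp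
      ultimately obtain n \<nu> where \<nu>: "\<nu> \<in> pos_functionals (subtopology weak_star_topology (L n))"
        "norm (z /\<^sub>R t - moment \<nu>) \<le> e / (5 * t)"
        using moments_dense[OF B(1) L Lmono LB] by blast
      have "z - t *\<^sub>R moment \<nu> = t *\<^sub>R (z /\<^sub>R t - moment \<nu>)" using t by (simp add: scaleR_diff_right)
      then have "norm (z - t *\<^sub>R moment \<nu>) = t * norm (z /\<^sub>R t - moment \<nu>)" using t by simp
      also have "\<dots> \<le> t * (e / (5 * t))" using t \<nu>(2) by (intro mult_left_mono) auto
      also have "\<dots> < e/4" using t e by simp
      finally have "(norm (z - t *\<^sub>R moment \<nu>))\<^sup>2 < (e/4)\<^sup>2" by (intro power_strict_mono) auto
      then obtain m where "\<Psi> n m z < (e/4)\<^sup>2" using \<Psi>6[OF _ \<nu>(1), of t z "(e/4)\<^sup>2"] t by auto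
      then have "sqrt (\<Psi> n m z) < e/4" using e by (intro real_less_lsqrt) (auto simp: \<Psi>1)
      moreover have "\<forall>\<^sub>F k in sequentially. norm (z - s k) < 2 * sqrt (\<Psi> n m z) + e/2"
        using e by (intro \<Psi>5[OF d]) simp
      ultimately show "\<forall>\<^sub>F k in sequentially. dist (s k) z < e"
        by (elim eventually_mono) (simp add: dist_norm norm_minus_commute)
    qed
  qed (auto simp: B(1) \<Psi>1 \<Psi>2 \<Psi>3 split: prod.splits)
  show ?thesis by (rule renorming)
qed

end
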